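(* Let $H$ be a separable real Hilbert space, let $\alpha\in(0,1/2)$, let $(\phi_n)_{n\ge0}$ be the Schauder functions on $[0,1]$, and let $(Z_n)_{n\ge0}$ be a sequence of independent $\mathcal N(0,Q)$-distributed Gaussian random variables with values in $H$, where $Q$ is a positive self-adjoint trace class operator on $H$. Then the series $$W_t=\sum_{n=0}^\infty\phi_n(t)Z_n,\qquad t\in[0,1],$$ converges $\mathbb P$-almost surely with respect to the norm $\lVert\cdot\rVert_\alpha$ on $[0,1]$, and the process $W$ it defines is an $H$-valued $Q$-Wiener process.
   Context: Haar functions: $\chi_0\equiv1$, and for $k\ge0$, $0\le l\le2^k-1$, $\chi_{2^k+l}(t)=\sqrt{2^k}$ for $\frac{2l}{2^{k+1}}\le t<\frac{2l+1}{2^{k+1}}$, $=-\sqrt{2^k}$ for $\frac{2l+1}{2^{k+1}}\le t\le\frac{2l+2}{2^{k+1}}$, and $=0$ otherwise. Schauder functions: $\phi_n(t)=\int_0^t\chi_n(s)\,ds$, $t\in[0,1]$. For $F:[0,1]\to H$, $\lVert F\rVert_\alpha=\sup_{0\le s<t\le1}\lVert F(t)-F(s)\rVert_H/|t-s|^\alpha$ (a norm on functions with $F(0)=0$ for which it is finite). A random variable $X$ in $H$ is $\mathcal N(m,Q)$-distributed if $E[\exp(i\langle h,X\rangle)]=\exp(i\langle h,m\rangle-\tfrac12\langle Qh,h\rangle)$ for all $h\in H$. A $Q$-Wiener process is an $H$-valued stochastic process $(W(t):t\in[0,1])$ with $W(0)=0$, continuous trajectories, independent increments, and $W(t)-W(s)\sim\mathcal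 N(0,(t-s)Q)$ for $s\le t$. Here $W$ is defined by the series on the almost sure event where it converges, and arbitrarily (e.g. as $0$) on the exceptional null event. *)

theory Defs
  imports "HOL-Probability.Probability" "HOL-Library.Discrete_Functions"
begin

text \<open>
  A separable real Hilbert space is a type of sort \<open>{real_inner, polish_space}\<close>:
  a complete inner product space with a countable base.
\<close>

subsection \<open>Operators\<close>

definition self_adjoint_op :: "('a::real_inner \<Rightarrow> 'a) \<Rightarrow> bool" where
  "self_adjoint_op T \<longleftrightarrow> bounded_linear T \<and> (\<forall>x y. T x \<bullet> y = x \<bullet> T y)"

definition positive_op :: "('a::real_inner \<Rightarrow> 'a) \<Rightarrow> bool" where
  "positive_op T \<longleftrightarrow> bounded_linear T \<and> (\<forall>x. 0 \<le> T x \<bullet> x)"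

text \<open>Orthonormal bases in the Hilbert space sense (complete orthonormal systems).\<close>

definition orthonormal_basis :: "'a::real_inner set \<Rightarrow> bool" where
  "orthonormal_basis B \<longleftrightarrow>
     pairwise orthogonal B \<and> (\<forall>e\<in>B. norm e = 1) \<and> closure (span B) = UNIV"

text \<open>
  \<open>A = |T|\<close>, the positive square root of \<open>T\<^sup>* T\<close>. On a real Hilbert space positivity of the
  quadratic form does not imply symmetry, so self-adjointness is required separately.
\<close>

definition is_abs_op :: "('a::real_inner \<Rightarrow> 'a) \<Rightarrow> ('a \<Rightarrow> 'a) \<Rightarrow> bool" where
  "is_abs_op A T \<longleftrightarrow> self_adjoint_op A \<and> positive_op A \<and> A \<circ> A = adjoint T \<circ> T"

text \<open>
  \<open>T\<close> is of trace class if the trace of \<open>|T|\<close> over an orthonormal basis is finite. The sum of the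
  nonnegative numbers \<open>|T| e \<bullet> e\<close> does not depend on the basis, so one basis suffices.
\<close>

definition trace_class_op :: "('a::real_inner \<Rightarrow> 'a) \<Rightarrow> bool" where
  "trace_class_op T \<longleftrightarrow> bounded_linear T \<and>
     (\<exists>A B. is_abs_op A T \<and> orthonormal_basis B \<and> (\<lambda>e. A e \<bullet> e) summable_on B)"


subsection \<open>Haar and Schauder functions\<close>

text \<open>
  For \<open>n \<ge> 1\<close> the decomposition \<open>n = 2 ^ k + l\<close> with \<open>0 \<le> l \<le> 2 ^ k - 1\<close> is unique, and \<open>k\<close> is
  the integer part of the binary logarithm of \<open>n\<close>.
\<close>

definition haar :: "nat \<Rightarrow> real \<Rightarrow> real" where
  "haar n t =
     (if n = 0 then 1
      else let k = floor_log n; l = n - 2 ^ k in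
        if 2 * real l / 2 ^ (k + 1) \<le> t \<and> t < (2 * real l + 1) / 2 ^ (k + 1)
          then sqrt (2 ^ k)
        else if (2 * real l + 1) / 2 ^ (k + 1) \<le> t \<and> t \<le> (2 * real l + 2) / 2 ^ (k + 1)
          then - sqrt (2 ^ k)
        else 0)"

definition schauder :: "nat \<Rightarrow> real \<Rightarrow> real" where
  "schauder n t = integral {0..t} (haar n)"


subsection \<open>Series in the Hoelder norm on the unit interval\<close>

text \<open>
  The Hoelder norm is extended-valued, so that it is meaningful for every function. Only the
  restriction of the function to the unit interval matters.
\<close>

definition holder_norm :: "real \<Rightarrow> (real \<Rightarrow> 'a::real_normed_vector) \<Rightarrow> ennreal" where
  "holder_norm \<alpha> F =
     (SUP (s, t) \<in> {(s, t). 0 \<le> s \<and> s < t \<and> t \<le> 1}.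
        ennreal (norm (F t - F s) / \<bar>t - s\<bar> powr \<alpha>))"

text \<open>The space on which \<open>holder_norm \<alpha>\<close> is a norm.\<close>

definition holder_space :: "real \<Rightarrow> (real \<Rightarrow> 'a::real_normed_vector) set" where
  "holder_space \<alpha> = {F. F 0 = 0 \<and> holder_norm \<alpha> F < \<infinity>}"

definition holder_sums ::
    "real \<Rightarrow> (nat \<Rightarrow> real \<Rightarrow> 'a::real_normed_vector) \<Rightarrow> (real \<Rightarrow> 'a) \<Rightarrow> bool" where
  "holder_sums \<alpha> f F \<longleftrightarrow> (\<forall>n. f n \<in> holder_space \<alpha>) \<and> F \<in> holder_space \<alpha> \<and>
     (\<lambda>N. holder_norm \<alpha> (\<lambda>t. (\<Sum>n<N. f n t) - F t)) \<longlonglongrightarrow> 0"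

definition holder_summable :: "real \<Rightarrow> (nat \<Rightarrow> real \<Rightarrow> 'a::real_normed_vector) \<Rightarrow> bool" where
  "holder_summable \<alpha> f \<longleftrightarrow> (\<exists>F. holder_sums \<alpha> f F)"

text \<open>
  The process given by the series where it converges in the Hoelder norm, and by \<open>0\<close> elsewhere.
\<close>

definition schauder_process ::
    "real \<Rightarrow> (nat \<Rightarrow> 'w \<Rightarrow> 'a::real_normed_vector) \<Rightarrow> real \<Rightarrow> 'w \<Rightarrow> 'a" where
  "schauder_process \<alpha> Z t \<omega> =
     (if holder_summable \<alpha> (\<lambda>n t. schauder n t *\<^sub>R Z n \<omega>)
      then (\<Sum>n. schauder n t *\<^sub>R Z n \<omega>) else 0)"


subsection \<open>Gaussian random variables and Wiener processes\<close>

definition gaussian_rv ::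
    "'w measure \<Rightarrow> ('w \<Rightarrow> 'a::real_inner) \<Rightarrow> 'a \<Rightarrow> ('a \<Rightarrow> 'a) \<Rightarrow> bool" where
  "gaussian_rv M X m Q \<longleftrightarrow> X \<in> borel_measurable M \<and>
     (\<forall>h. (LINT \<omega>|M. exp (\<i> * complex_of_real (h \<bullet> X \<omega>))) =
           exp (\<i> * complex_of_real (h \<bullet> m) - complex_of_real (Q h \<bullet> h) / 2))"

definition wiener_process ::
    "'w measure \<Rightarrow> ('a \<Rightarrow> 'a) \<Rightarrow> (real \<Rightarrow> 'w \<Rightarrow> 'a::real_inner) \<Rightarrow> bool" where
  "wiener_process M Q W \<longleftrightarrow>
     (\<forall>t\<in>{0..1}. W t \<in> borel_measurable M) \<and>
     (\<forall>\<omega>\<in>space M. W 0 \<omega> = 0) \<and>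
     (\<forall>\<omega>\<in>space M. continuous_on {0..1} (\<lambda>t. W t \<omega>)) \<and>
     (\<forall>(n::nat) (t::nat \<Rightarrow> real).
        0 \<le> t 0 \<longrightarrow> (\<forall>i<n. t i \<le> t (Suc i)) \<longrightarrow> t n \<le> 1 \<longrightarrow>
        prob_space.indep_vars M (\<lambda>_. borel) (\<lambda>i \<omega>. W (t (Suc i)) \<omega> - W (t i) \<omega>) {..<n}) \<and>
     (\<forall>s t. 0 \<le> s \<longrightarrow> s \<le> t \<longrightarrow> t \<le> 1 \<longrightarrow>
        gaussian_rv M (\<lambda>\<omega>. W t \<omega> - W s \<omega>) 0 (\<lambda>h. (t - s) *\<^sub>R Q h))"

end

theory Submission
  imports Defs
begin

text \<open>
  The Hoelder norm of the partial sums is controlled level by level: the Schauder functions of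
  level \<open>k\<close> have disjoint supports, height of order \<open>2 powr (- k / 2)\<close> and slope of order
  \<open>2 powr (k / 2)\<close>, so level \<open>k\<close> contributes at most
  \<open>2 * 2 powr (- k * (1 / 2 - \<alpha>))\<close> times the largest coefficient of that level. It therefore
  suffices that almost surely \<open>norm (Z n)\<close> grows at most like a small power of \<open>n\<close>, which follows
  from moment bounds: by Jensen's inequality over an orthonormal basis \<open>B\<close>, weighted by
  \<open>Q e \<bullet> e\<close>, the moment of \<open>norm Z\<close> of order \<open>2 p\<close> is at most
  \<open>(\<Sum>e\<in>B. Q e \<bullet> e) ^ p\<close> times that of a standard normal variable.

  The joint characteristic functional of increments is computed from Parseval's identity
  \<open>(\<Sum>n. schauder n s * schauder n t) = min s t\<close>, which holds because the partial sums interpolate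
  \<open>min s\<close> linearly at dyadic points. It factorizes, and independence follows from the uniqueness
  of characteristic functionals on \<open>H\<close>.
\<close>

subsection \<open>Trace class operators and orthonormal bases\<close>

text \<open>The process is set to 0 where the series fails to converge and \<open>M\<close> is not
  assumed complete, so the convergence event itself has to be measurable. This is why convergence is
  reduced to a Cauchy criterion whose Hoelder bounds are tested at rational times.

  The decay of level \<open>k\<close> beats coefficients growing like
  \<open>n powr \<epsilon>\<close> as soon as \<open>\<alpha> + \<epsilon> < 1 / 2\<close>, and one
  moment of order \<open>q\<close> with \<open>2 \<le> q * \<epsilon>\<close> yields that growth. As
  \<alpha> approaches 1/2, \<open>q\<close> has to increase, so moments of all orders are needed.

  Independence concerns several variables with values in \<open>H\<close> at once. Instead of
  working with functionals on a power of \<open>H\<close>, exponentials are exchanged for indicators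
  one variable at a time, the other factors being carried along as a bounded complex weight. The
  same exchange, with real coordinates \<open>e \<bullet> x\<close> in place of variables, gives
  uniqueness on \<open>H\<close>.\<close>

text \<open>The form is nonnegative at \<open>x - (1/K) *\<^sub>R T x\<close>. With the factor
  \<open>1/K\<close> the term \<open>T (T x) \<bullet> T x\<close> cancels at most half of the mixed
  term, which leaves \<open>T x \<bullet> x - (T x \<bullet> T x) / K\<close>.\<close>

lemma norm_square_le_quadratic_form:
  fixes T :: "'a::real_inner \<Rightarrow> 'a"
  assumes sa: "self_adjoint_op T" and pos: "positive_op T" and K: "0 < K" "\<And>y. norm (T y) \<le> K * norm y"
  shows "(norm (T x))\<^sup>2 \<le> K * (T x \<bullet> x)"
proof -
  interpret bounded_linear T using pos by (simp add: positive_op_def)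
  have sym: "T u \<bullet> v = u \<bullet> T v" for u v using sa by (simp add: self_adjoint_op_def)
  have "0 \<le> T (x - (1/K) *\<^sub>R T x) \<bullet> (x - (1/K) *\<^sub>R T x)"
    using pos by (simp add: positive_op_def)
  also have "\<dots> = T x \<bullet> x - 2 / K * (T x \<bullet> T x) + 1 / K\<^sup>2 * (T (T x) \<bullet> T x)"
    using sym[of "T x" x]
    by (simp add: diff scaleR inner_diff_left inner_diff_right power2_eq_square field_simps inner_commute)
  also have "T (T x) \<bullet> T x \<le> K * (T x \<bullet> T x)"
  proof -
    have "T (T x) \<bullet> T x \<le> norm (T (T x)) * norm (T x)" by (rule norm_cauchy_schwarz)
    also have "\<dots> \<le> K * norm (T x) * norm (T x)" by (intro mult_right_mono K) auto
    finally show ?thesis by (simp add: dot_square_norm power2_eq_square mult_ac)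
  qed
  finally have "0 \<le> T x \<bullet> x - 2 / K * (T x \<bullet> T x) + 1 / K\<^sup>2 * (K * (T x \<bullet> T x))"
    using K(1) by (simp add: mult_left_mono divide_right_mono)
  hence "0 \<le> T x \<bullet> x - (T x \<bullet> T x) / K"
    using K(1) by (simp add: power2_eq_square field_simps)
  thus ?thesis using K(1) by (simp add: field_simps dot_square_norm)
qed

text \<open>
  \<open>D = A - Q\<close> satisfies \<open>A D = - D Q\<close>. On an approximate eigenvector of \<open>D\<^sup>2\<close> for
  \<open>\<parallel>D\<parallel>\<^sup>2\<close> this makes a nonnegative number nearly equal to a nonpositive one, so both quadratic
  forms nearly vanish there. No functional calculus is needed.
\<close>

lemma positive_square_root_unique:
  fixes A Q :: "'a::real_inner \<Rightarrow> 'a"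
  assumes A: "self_adjoint_op A" "positive_op A" and Q: "self_adjoint_op Q" "positive_op Q"
    and eq: "\<And>x. A (A x) = Q (Q x)"
  shows "A = Q"
proof -
  interpret A: bounded_linear A using A by (simp add: positive_op_def)
  interpret Q: bounded_linear Q using Q by (simp add: positive_op_def)
  define D where "D x = A x - Q x" for x
  have blD: "bounded_linear D"
    unfolding D_def by (intro bounded_linear_sub A.bounded_linear_axioms Q.bounded_linear_axioms)
  interpret D: bounded_linear D by (rule blD)
  have symD: "D u \<bullet> v = u \<bullet> D v" for u v
    using A(1) Q(1) by (simp add: D_def self_adjoint_op_def inner_diff_left inner_diff_right)
  obtain K where K: "0 < K" "\<And>y. norm (A y) \<le> K * norm y" "\<And>y. norm (Q y) \<le> K * norm y"
  proof -
    obtain K1 where K1: "0 < K1" "\<And>y. norm (A y) \<le> norm y * K1" using A.pos_bounded by auto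
    obtain K2 where K2: "0 < K2" "\<And>y. norm (Q y) \<le> norm y * K2" using Q.pos_bounded by auto
    show ?thesis
    proof (rule that[of "max K1 K2"])
      show "norm (A y) \<le> max K1 K2 * norm y" for y
        by (rule order_trans[OF K1(2)]) (subst mult.commute, intro mult_right_mono, auto)
      show "norm (Q y) \<le> max K1 K2 * norm y" for y
        by (rule order_trans[OF K2(2)]) (subst mult.commute, intro mult_right_mono, auto)
    qed (use K1 in auto)
  qed
  define m where "m = onorm D"
  have m0: "0 \<le> m" unfolding m_def by (rule onorm_pos_le[OF blD])
  have mD: "norm (D y) \<le> m * norm y" for y unfolding m_def by (rule onorm[OF blD])
  have "m = 0"
  proof (rule ccontr)
    assume "m \<noteq> 0"
    hence mp: "0 < m" using m0 by simp
    have bound: "m\<^sup>2 \<le> \<delta> + 4 * K\<^sup>2 * sqrt (2 * \<delta>) / m" if "\<delta> > 0" for \<delta>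
    proof (cases "\<delta> < m\<^sup>2")
      case False
      thus ?thesis using K(1) mp that by (simp add: add_increasing2)
    next
      case True
      \<comment> \<open>Some vector is stretched by more than
        \<open>sqrt (m\<^sup>2 - \<delta>)\<close>; otherwise this smaller number would bound the
        operator norm.\<close>
      have "sqrt (m\<^sup>2 - \<delta>) < m" using mp that by (intro real_less_lsqrt) auto
      moreover have "0 \<le> sqrt (m\<^sup>2 - \<delta>)" using True by simp
      ultimately have "\<not> (\<forall>x. norm (D x) \<le> sqrt (m\<^sup>2 - \<delta>) * norm x)"
        using onorm_bound[of "sqrt (m\<^sup>2 - \<delta>)" D] by (auto simp flip: m_def)
      then obtain x0 where x0: "norm (D x0) > sqrt (m\<^sup>2 - \<delta>) * norm x0" by (auto simp: not_le)
      have "x0 \<noteq> 0" using x0 by auto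
      define x where "x = (1 / norm x0) *\<^sub>R x0"
      have nx: "norm x = 1" using \<open>x0 \<noteq> 0\<close> by (simp add: x_def)
      have "norm (D x) > sqrt (m\<^sup>2 - \<delta>)"
        using x0 \<open>x0 \<noteq> 0\<close> by (simp add: x_def D.scaleR field_simps)
      hence Dx: "(norm (D x))\<^sup>2 \<ge> m\<^sup>2 - \<delta>"
        using True by (smt (verit) real_sqrt_ge_zero power_mono real_sqrt_pow2)
      \<comment> \<open>The error in the eigenvalue equation
        \<open>D (D x) = m\<^sup>2 *\<^sub>R x\<close>. Its square is at most
        \<open>m\<^sup>2 * (m\<^sup>2 - (norm (D x))\<^sup>2)\<close>, which is small by the choice
        of \<open>x\<close>.\<close>
      define r where "r = D (D x) - m\<^sup>2 *\<^sub>R x"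
      have "(norm r)\<^sup>2 = (norm (D (D x)))\<^sup>2 - 2 * m\<^sup>2 * (D (D x) \<bullet> x) + m ^ 4"
      proof -
        have "x \<bullet> x = 1" using nx by (simp add: dot_square_norm)
        thus ?thesis
          unfolding power2_norm_eq_inner r_def
          by (simp add: inner_diff_left inner_diff_right inner_commute[of x "D (D x)"]
                power4_eq_xxxx power2_eq_square algebra_simps)
      qed
      also have "D (D x) \<bullet> x = (norm (D x))\<^sup>2" by (simp add: symD dot_square_norm)
      also have "(norm (D (D x)))\<^sup>2 \<le> m\<^sup>2 * (norm (D x))\<^sup>2"
        using power_mono[OF mD[of "D x"], of 2] by (simp add: power_mult_distrib)
      also have "m\<^sup>2 * (norm (D x))\<^sup>2 - 2 * m\<^sup>2 * (norm (D x))\<^sup>2 + m ^ 4 = m\<^sup>2 * (m\<^sup>2 - (norm (D x))\<^sup>2)"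
        by (simp add: algebra_simps power4_eq_xxxx power2_eq_square)
      also have "\<dots> \<le> m\<^sup>2 * (2 * \<delta>)" using Dx that by (intro mult_left_mono) auto
      finally have "norm r \<le> sqrt (m\<^sup>2 * (2 * \<delta>))" by (simp add: real_le_rsqrt)
      also have "\<dots> = m * sqrt (2 * \<delta>)" using mp by (simp add: real_sqrt_mult)
      finally have r: "norm r \<le> m * sqrt (2 * \<delta>)" .
      \<comment> \<open>Moving \<open>D\<close> across turns \<open>T (D x) \<bullet> D x\<close>
        into \<open>- (S x \<bullet> D (D x))\<close>, which is close to
        \<open>- m\<^sup>2 * (S x \<bullet> x)\<close>. So \<open>S x \<bullet> x\<close> is small,
        and for a positive \<open>S\<close> this makes \<open>norm (S x)\<close> small.\<close>
      have form: "(norm (S x))\<^sup>2 \<le> K\<^sup>2 * (norm r / m\<^sup>2)"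
        if S: "self_adjoint_op S" "positive_op S" "\<And>y. norm (S y) \<le> K * norm y"
          and T: "positive_op T" and TD: "T (D x) = - D (S x)" for S T
      proof -
        have "0 \<le> T (D x) \<bullet> D x" using T by (simp add: positive_op_def)
        also have "\<dots> = - (S x \<bullet> D (D x))" by (simp add: TD symD)
        also have "D (D x) = r + m\<^sup>2 *\<^sub>R x" by (simp add: r_def)
        finally have "m\<^sup>2 * (S x \<bullet> x) \<le> - (S x \<bullet> r)" by (simp add: inner_add_right)
        also have "\<dots> \<le> norm (S x) * norm r" using Cauchy_Schwarz_ineq2[of "S x" r] by linarith
        also have "\<dots> \<le> K * norm r" using S(3)[of x] nx by (intro mult_right_mono) auto
        finally have "S x \<bullet> x \<le> K * norm r / m\<^sup>2" using mp by (simp add: field_simps)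
        hence "K * (S x \<bullet> x) \<le> K * (K * norm r / m\<^sup>2)" using K(1) by (intro mult_left_mono) auto
        with norm_square_le_quadratic_form[OF S(1,2) K(1) S(3), of x]
        show ?thesis by (simp add: power2_eq_square mult_ac)
      qed
      have fA: "(norm (A x))\<^sup>2 \<le> K\<^sup>2 * (norm r / m\<^sup>2)"
        by (rule form[where S=A and T=Q]) (use A Q K in \<open>auto simp: D_def Q.diff A.diff eq\<close>)
      have fQ: "(norm (Q x))\<^sup>2 \<le> K\<^sup>2 * (norm r / m\<^sup>2)"
        by (rule form[where S=Q and T=A]) (use A Q K in \<open>auto simp: D_def Q.diff A.diff eq\<close>)
      have "m\<^sup>2 - \<delta> \<le> (norm (D x))\<^sup>2" by (rule Dx)
      also have "\<dots> \<le> (norm (A x) + norm (Q x))\<^sup>2"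
        unfolding D_def by (intro power_mono norm_triangle_ineq4) auto
      also have "\<dots> \<le> 2 * (norm (A x))\<^sup>2 + 2 * (norm (Q x))\<^sup>2"
        using sum_squares_bound[of "norm (A x)" "norm (Q x)"] by (simp add: power2_sum)
      also have "\<dots> \<le> 4 * K\<^sup>2 * (norm r / m\<^sup>2)" using fA fQ by simp
      also have "\<dots> \<le> 4 * K\<^sup>2 * (m * sqrt (2 * \<delta>) / m\<^sup>2)"
        using r by (intro mult_left_mono divide_right_mono) auto
      also have "\<dots> = 4 * K\<^sup>2 * sqrt (2 * \<delta>) / m" using mp by (simp add: power2_eq_square)
      finally show ?thesis by simp
    qed
    have "(\<lambda>n. inverse (real (Suc n)) + 4 * K\<^sup>2 * sqrt (2 * inverse (real (Suc n))) / m) \<longlonglongrightarrow>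
            0 + 4 * K\<^sup>2 * sqrt (2 * 0) / m"
      by (intro tendsto_intros LIMSEQ_inverse_real_of_nat) (use mp in auto)
    hence "m\<^sup>2 \<le> 0 + 4 * K\<^sup>2 * sqrt (2 * 0) / m"
      by (rule LIMSEQ_le_const) (use bound in auto)
    thus False using mp by simp
  qed
  hence "D x = 0" for x using mD[of x] by simp
  thus ?thesis by (auto simp: D_def)
qed

text \<open>\<open>trace_class_op\<close> only provides some positive self-adjoint root
  \<open>A\<close> of \<open>adjoint Q \<circ> Q\<close>. For self-adjoint \<open>Q\<close> this is
  the square of \<open>Q\<close>, so \<open>A\<close> is \<open>Q\<close> and the summable diagonal
  is that of \<open>Q\<close> itself.\<close>

lemma positive_trace_class_summable:
  fixes Q :: "'a::real_inner \<Rightarrow> 'a"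
  assumes "positive_op Q" "self_adjoint_op Q" "trace_class_op Q"
  obtains B where "orthonormal_basis B" "(\<lambda>e. Q e \<bullet> e) summable_on B"
proof -
  obtain A B where A: "is_abs_op A Q" and B: "orthonormal_basis B" "(\<lambda>e. A e \<bullet> e) summable_on B"
    using assms(3) by (auto simp: trace_class_op_def)
  have "adjoint Q = Q" using assms(2) by (intro adjoint_unique) (simp add: self_adjoint_op_def)
  hence "A (A x) = Q (Q x)" for x using A by (auto simp: is_abs_op_def dest: fun_cong[of _ _ x])
  hence "A = Q" using A assms by (intro positive_square_root_unique) (auto simp: is_abs_op_def)
  thus ?thesis using that B by auto
qed

section \<open>Countability of orthonormal bases and Parseval's identity\<close>

text \<open>Distinct basis vectors lie at distance \<open>sqrt 2\<close>, so the balls of radius 1/2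
  around them are disjoint open sets, of which a second countable space has only countably
  many.\<close>

lemma countable_orthonormal_basis:
  fixes B :: "'a::{real_inner, second_countable_topology} set"
  assumes "orthonormal_basis B"
  shows "countable B"
proof -
  have far: "dist x y \<ge> 1" if "x \<in> B" "y \<in> B" "x \<noteq> y" for x y
  proof -
    have "x \<bullet> y = 0" "norm x = 1" "norm y = 1"
      using assms that by (auto simp: orthonormal_basis_def pairwise_def orthogonal_def)
    hence "(norm (x - y))\<^sup>2 = 2"
      by (simp flip: dot_square_norm add: inner_diff_left inner_diff_right inner_commute)
        (simp add: dot_square_norm)
    hence "1\<^sup>2 \<le> (norm (x - y))\<^sup>2" by simp
    thus ?thesis unfolding dist_norm by (rule power2_le_imp_le) simp
  qed
  define F where "F = (\<lambda>x. ball x (1/2)) ` B"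
  have disj: "disjnt (ball x (1/2)) (ball y (1/2))" if "x \<in> B" "y \<in> B" "x \<noteq> y" for x y
    using far[OF that] by (auto simp: disjnt_def disjoint_iff) (smt (verit) dist_commute dist_triangle field_sum_of_halves)
  have "countable F"
    by (rule countable_disjoint_open_subsets) (auto simp: F_def pairwise_def intro!: disj)
  moreover have "inj_on (\<lambda>x. ball x (1/2)) B"
  proof (rule inj_onI, rule ccontr)
    fix x y assume "x \<in> B" "y \<in> B" "ball x (1/2) = ball y (1/2)" "x \<noteq> y"
    with disj[of x y] have "ball x (1/2) = {}" by (simp add: disjnt_def)
    thus False by simp
  qed
  ultimately show ?thesis unfolding F_def using countable_image_inj_eq by blast
qed

text \<open>Pythagoras twice: the defect in Bessel's inequality is the squared distance from
  \<open>x\<close> to its projection \<open>p\<close>, and \<open>x - p\<close> is orthogonal to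
  \<open>p - y\<close>, so no point \<open>y\<close> of the span is closer.\<close>

lemma orthonormal_projection_distance:
  fixes F :: "'a::real_inner set"
  assumes "finite F" "pairwise orthogonal F" "\<And>e. e \<in> F \<Longrightarrow> norm e = 1"
  shows "(norm (x - (\<Sum>e\<in>F. (e \<bullet> x) *\<^sub>R e)))\<^sup>2 = (norm x)\<^sup>2 - (\<Sum>e\<in>F. (e \<bullet> x)\<^sup>2)"
    and "y \<in> span F \<Longrightarrow> (norm x)\<^sup>2 - (\<Sum>e\<in>F. (e \<bullet> x)\<^sup>2) \<le> (norm (x - y))\<^sup>2"
proof -
  define p where "p = (\<Sum>e\<in>F. (e \<bullet> x) *\<^sub>R e)"
  have ee: "e \<bullet> e' = (if e = e' then 1 else 0)" if "e \<in> F" "e' \<in> F" for e e'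
    using assms(2,3) that by (auto simp: pairwise_def orthogonal_def dot_square_norm)
  have pe: "e \<bullet> p = e \<bullet> x" if "e \<in> F" for e
    unfolding p_def using that assms(1) by (simp add: inner_sum_right ee if_distrib cong: if_cong sum.cong)
  have pe': "p \<bullet> e = x \<bullet> e" if "e \<in> F" for e
    using pe[OF that] by (simp only: inner_commute)
  have xp: "x \<bullet> p = (\<Sum>e\<in>F. (e \<bullet> x)\<^sup>2)"
    by (simp add: p_def inner_sum_right power2_eq_square inner_commute)
  have pp: "p \<bullet> p = (\<Sum>e\<in>F. (e \<bullet> x)\<^sup>2)"
    by (subst p_def) (simp add: inner_sum_left pe power2_eq_square)
  show 1: "(norm (x - (\<Sum>e\<in>F. (e \<bullet> x) *\<^sub>R e)))\<^sup>2 = (norm x)\<^sup>2 - (\<Sum>e\<in>F. (e \<bullet> x)\<^sup>2)"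
    unfolding p_def[symmetric]
    by (simp add: power2_norm_eq_inner inner_diff_left inner_diff_right inner_commute[of p x] xp pp)
  assume y: "y \<in> span F"
  have "p \<in> span F" unfolding p_def by (intro span_sum span_scale span_base)
  hence "p - y \<in> span F" using y by (rule span_diff)
  hence "orthogonal (x - p) (p - y)"
    by (rule orthogonal_to_span) (simp add: orthogonal_def inner_diff_left pe')
  hence "(norm (x - p + (p - y)))\<^sup>2 = (norm (x - p))\<^sup>2 + (norm (p - y))\<^sup>2"
    by (rule norm_add_Pythagorean)
  thus "(norm x)\<^sup>2 - (\<Sum>e\<in>F. (e \<bullet> x)\<^sup>2) \<le> (norm (x - y))\<^sup>2" using 1 by (simp add: p_def)
qed

text \<open>A point \<open>y\<close> of \<open>span B\<close> close to \<open>x\<close> uses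
  finitely many basis vectors, all of which lie in \<open>F k\<close> for large \<open>k\<close>.
  Projecting \<open>x\<close> onto \<open>span (F k)\<close> does at least as well as
  \<open>y\<close>.\<close>

lemma orthonormal_basis_Parseval:
  fixes B :: "'a::real_inner set"
  assumes B: "orthonormal_basis B" and F: "incseq F" "\<And>k::nat. finite (F k)" "(\<Union>k. F k) = B"
  shows "(\<lambda>k. \<Sum>e\<in>F k. (e \<bullet> x)\<^sup>2) \<longlonglongrightarrow> (norm x)\<^sup>2"
proof (rule LIMSEQ_I)
  fix r :: real assume r: "0 < r"
  have "x \<in> closure (span B)" using B by (simp add: orthonormal_basis_def)
  then obtain y where y: "y \<in> span B" "dist y x < sqrt r"
    using r by (meson closure_approachable real_sqrt_gt_0_iff)
  obtain S where S: "finite S" "S \<subseteq> B" "y \<in> span S"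
    using y(1) unfolding span_explicit by (auto intro: span_sum span_scale span_base)
  have "\<exists>k. S \<subseteq> F k" using S(1,2)
  proof (induction S)
    case (insert a S)
    then obtain k1 k2 where "S \<subseteq> F k1" "a \<in> F k2" using F(3) by auto
    hence "insert a S \<subseteq> F (max k1 k2)"
      using incseqD[OF F(1), of k1 "max k1 k2"] incseqD[OF F(1), of k2 "max k1 k2"] by auto
    thus ?case by blast
  qed auto
  then obtain k0 where k0: "S \<subseteq> F k0" by blast
  have "norm ((\<Sum>e\<in>F k. (e \<bullet> x)\<^sup>2) - (norm x)\<^sup>2) < r" if "k \<ge> k0" for k
  proof -
    have "F k \<subseteq> B" using F(3) by auto
    hence o: "pairwise orthogonal (F k)" "\<And>e. e \<in> F k \<Longrightarrow> norm e = 1"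
      using B by (auto simp: orthonormal_basis_def intro: pairwise_subset)
    have "y \<in> span (F k)" using S(3) k0 incseqD[OF F(1) that] span_mono by blast
    note b = orthonormal_projection_distance[OF F(2) o, where x=x]
    have "(norm x)\<^sup>2 - (\<Sum>e\<in>F k. (e \<bullet> x)\<^sup>2) \<le> (norm (x - y))\<^sup>2"
      by (rule b(2)) (use \<open>y \<in> span (F k)\<close> in auto)
    also have "\<dots> < (sqrt r)\<^sup>2" using y(2) by (intro power_strict_mono) (auto simp: dist_norm norm_minus_commute)
    finally have u: "(norm x)\<^sup>2 - (\<Sum>e\<in>F k. (e \<bullet> x)\<^sup>2) < r" using r by simp
    have "0 \<le> (norm x)\<^sup>2 - (\<Sum>e\<in>F k. (e \<bullet> x)\<^sup>2)" by (subst b(1)[symmetric]) auto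
    with u show ?thesis by simp
  qed
  thus "\<exists>no. \<forall>n\<ge>no. norm ((\<Sum>e\<in>F n. (e \<bullet> x)\<^sup>2) - (norm x)\<^sup>2) < r" by blast
qed

subsection \<open>Schauder functions\<close>

lemma sum_lessThan_add:
  fixes f :: "nat \<Rightarrow> 'a::comm_monoid_add"
  shows "sum f {..<m + n} = sum f {..<m} + (\<Sum>l<n. f (m + l))"
  by (induction n) (auto simp: add.assoc)

lemma level_decomposition:
  assumes "0 < n"
  obtains k l :: nat where "n = 2 ^ k + l" "l < 2 ^ k"
proof (rule that[of "floor_log n" "n - 2 ^ floor_log n"])
  show "n - 2 ^ floor_log n < 2 ^ floor_log n"
    using floor_log_exp2_gt[of n] floor_log_exp2_le[OF assms] by simp
qed (use floor_log_exp2_le[OF assms] in simp)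

text \<open>The fundamental theorem of calculus away from the three kinks. The values of
  \<open>g\<close> at the kinks are left free, so half-open and closed pieces of \<open>haar\<close>
  both fit; \<open>m - h \<ge> 0\<close> makes the primitive vanish at 0.\<close>

lemma has_integral_tent:
  fixes c h m t :: real and g :: "real \<Rightarrow> real"
  assumes "0 \<le> t" "h \<ge> 0" "m - h \<ge> 0"
    and g: "\<And>x. x < m - h \<Longrightarrow> g x = 0" "\<And>x. m - h < x \<Longrightarrow> x < m \<Longrightarrow> g x = c"
           "\<And>x. m < x \<Longrightarrow> x < m + h \<Longrightarrow> g x = - c" "\<And>x. m + h < x \<Longrightarrow> g x = 0"
  shows "(g has_integral c * max 0 (h - \<bar>t - m\<bar>)) {0..t}"
proof -
  let ?f = "\<lambda>x. c * max 0 (h - \<bar>x - m\<bar>)"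
  have "(?f has_vector_derivative g x) (at x)" if "x \<notin> {m - h, m, m + h}" for x
  proof -
    consider "x < m - h" | "m - h < x" "x < m" | "m < x" "x < m + h" | "m + h < x"
      using \<open>x \<notin> {m - h, m, m + h}\<close> by (auto simp: not_less) linarith
    thus ?thesis
    proof cases
      case 1
      show ?thesis unfolding g(1)[OF 1]
        by (rule has_vector_derivative_transform_within_open[of "\<lambda>_. 0" _ _ "{..<m - h}"]) (use 1 assms(2) in auto)
    next
      case 2
      have "((\<lambda>x. c * (x - (m - h))) has_vector_derivative c) (at x)"
        unfolding has_real_derivative_iff_has_vector_derivative[symmetric] by (auto intro!: derivative_eq_intros)
      thus ?thesis unfolding g(2)[OF 2]
        by (rule has_vector_derivative_transform_within_open[of _ _ _ "{m - h<..<m}"]) (use 2 in \<open>auto simp: max_def\<close>)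
    next
      case 3
      have "((\<lambda>x. c * (m + h - x)) has_vector_derivative - c) (at x)"
        unfolding has_real_derivative_iff_has_vector_derivative[symmetric] by (auto intro!: derivative_eq_intros)
      thus ?thesis unfolding g(3)[OF 3]
        by (rule has_vector_derivative_transform_within_open[of _ _ _ "{m<..<m + h}"]) (use 3 in \<open>auto simp: max_def\<close>)
    next
      case 4
      show ?thesis unfolding g(4)[OF 4]
        by (rule has_vector_derivative_transform_within_open[of "\<lambda>_. 0" _ _ "{m + h<..}"]) (use 4 assms(2) in auto)
    qed
  qed
  hence "(g has_integral (?f t - ?f 0)) {0..t}"
    using \<open>0 \<le> t\<close>
    by (intro fundamental_theorem_of_calculus_interior_strong[of "{m - h, m, m + h}"]) (auto intro!: continuous_intros)
  moreover have "?f 0 = 0" using assms by simp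
  ultimately show ?thesis by (simp only: diff_zero)
qed

lemma schauder_0: "0 \<le> t \<Longrightarrow> schauder 0 t = t"
  by (simp add: schauder_def haar_def[abs_def])

lemma schauder_level:
  assumes "l < 2 ^ k" "0 \<le> t"
  shows "schauder (2 ^ k + l) t =
    sqrt (2 ^ k) * max 0 (1 / 2 ^ (k + 1) - \<bar>t - (2 * real l + 1) / 2 ^ (k + 1)\<bar>)"
proof -
  have fl: "floor_log (2 ^ k + l) = k" using assms by (intro floor_log_eqI) auto
  define m where "m = (2 * real l + 1) / 2 ^ (k + 1)"
  define h where "h = 1 / (2 :: real) ^ (k + 1)"
  have mh: "2 * real l / 2 ^ (k + 1) = m - h" "(2 * real l + 2) / 2 ^ (k + 1) = m + h"
    by (simp_all add: m_def h_def add_divide_distrib diff_divide_distrib)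
  have H: "haar (2 ^ k + l) s = (if m - h \<le> s \<and> s < m then sqrt (2 ^ k)
      else if m \<le> s \<and> s \<le> m + h then - sqrt (2 ^ k) else 0)" for s
    using mh by (simp add: haar_def fl Let_def m_def)
  have "h > 0" by (simp add: h_def)
  have "m - h \<ge> 0" unfolding mh(1)[symmetric] by simp
  have "(haar (2 ^ k + l) has_integral sqrt (2 ^ k) * max 0 (h - \<bar>t - m\<bar>)) {0..t}"
    by (rule has_integral_tent) (use assms \<open>h > 0\<close> \<open>m - h \<ge> 0\<close> in \<open>auto simp: H\<close>)
  thus ?thesis by (auto simp: schauder_def m_def h_def intro: integral_unique)
qed

lemma schauder_at_0 [simp]: "schauder n 0 = 0"
  by (simp add: schauder_def)

lemma schauder_nonneg: "0 \<le> t \<Longrightarrow> 0 \<le> schauder n t"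
proof (cases "n = 0")
  case False
  assume "0 \<le> t"
  obtain k l where "n = 2 ^ k + l" "l < 2 ^ k" using False level_decomposition by blast
  thus ?thesis using \<open>0 \<le> t\<close> by (simp add: schauder_level)
qed (simp add: schauder_0)

lemma schauder_le_1:
  assumes "0 \<le> t" "t \<le> 1" shows "schauder n t \<le> 1"
proof (cases "n = 0")
  case False
  then obtain k l where kl: "n = 2 ^ k + l" "l < 2 ^ k" using level_decomposition by blast
  have "schauder n t \<le> sqrt (2 ^ k) * (1 / 2 ^ (k + 1))"
    unfolding kl(1) schauder_level[OF kl(2) assms(1)] by (intro mult_left_mono) auto
  also have "\<dots> \<le> 2 ^ k * (1 / 2 ^ (k + 1))"
    by (intro mult_right_mono real_le_lsqrt) (auto simp: power2_eq_square)
  also have "\<dots> \<le> 1" by simp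
  finally show ?thesis .
qed (use assms in \<open>simp add: schauder_0\<close>)

section \<open>Supports and Hoelder bounds within one level\<close>

text \<open>Scaling time by \<open>2 ^ k\<close> turns the supports of level \<open>k\<close> into
  consecutive unit intervals. The strict inequalities exclude common end points, so only the index
  \<open>\<lfloor>2 ^ k * t\<rfloor>\<close> can be active at \<open>t\<close>.\<close>

lemma schauder_level_support:
  assumes "l < 2 ^ k" "0 \<le> t" "schauder (2 ^ k + l) t \<noteq> 0"
  shows "real l < 2 ^ k * t" "2 ^ k * t < real l + 1"
proof -
  have "\<bar>t - (2 * real l + 1) / 2 ^ (k + 1)\<bar> < 1 / 2 ^ (k + 1)"
    using assms by (auto simp: schauder_level max_def split: if_splits)
  hence "\<bar>t - (2 * real l + 1) / 2 ^ (k + 1)\<bar> * 2 ^ (k + 1) < 1" by (simp add: field_simps)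
  moreover have "\<bar>t - (2 * real l + 1) / 2 ^ (k + 1)\<bar> * 2 ^ (k + 1) =
      \<bar>(t - (2 * real l + 1) / 2 ^ (k + 1)) * 2 ^ (k + 1)\<bar>" by (simp add: abs_mult)
  moreover have "(t - (2 * real l + 1) / 2 ^ (k + 1)) * 2 ^ (k + 1) = 2 * (2 ^ k * t) - (2 * real l + 1)"
    by (simp add: field_simps)
  ultimately have "\<bar>2 * (2 ^ k * t) - (2 * real l + 1)\<bar> < 1" by simp
  thus "real l < 2 ^ k * t" "2 ^ k * t < real l + 1" by linarith+
qed

lemma schauder_level_support_unique:
  assumes "0 \<le> t"
  obtains l0 where "\<And>l. l < 2 ^ k \<Longrightarrow> l \<noteq> l0 \<Longrightarrow> schauder (2 ^ k + l) t = 0"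
proof (rule that[of "nat \<lfloor>2 ^ k * t\<rfloor>"], rule ccontr)
  fix l :: nat assume l: "l < 2 ^ k" "l \<noteq> nat \<lfloor>2 ^ k * t\<rfloor>" "schauder (2 ^ k + l) t \<noteq> 0"
  from schauder_level_support[OF l(1) assms l(3)] have "\<lfloor>2 ^ k * t\<rfloor> = int l"
    by (intro floor_unique) auto
  with l(2) show False by simp
qed

lemma le_powr_interpolate:
  fixes x a b \<alpha> :: real
  assumes "0 \<le> x" "x \<le> a" "x \<le> b" "0 \<le> \<alpha>" "\<alpha> \<le> 1"
  shows "x \<le> a powr (1 - \<alpha>) * b powr \<alpha>"
proof (cases "x = 0")
  case False
  hence "x = x powr (1 - \<alpha>) * x powr \<alpha>" using assms by (simp flip: powr_add)
  also have "\<dots> \<le> a powr (1 - \<alpha>) * b powr \<alpha>" using assms by (intro mult_mono powr_mono2) auto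
  finally show ?thesis .
qed simp

text \<open>Without the slope factor, the increment of a tent is bounded by its height, at most
  \<open>2 powr (- k)\<close>, and by \<open>t - s\<close>. Interpolating with weights
  \<open>1 - \<alpha>\<close> and \<alpha> gives the exponent
  \<open>k / 2 - k * (1 - \<alpha>) = - k * (1 / 2 - \<alpha>)\<close>.\<close>

lemma schauder_level_holder:
  assumes "l < 2 ^ k" "0 \<le> s" "s \<le> t" "0 \<le> \<alpha>" "\<alpha> \<le> 1"
  shows "\<bar>schauder (2 ^ k + l) t - schauder (2 ^ k + l) s\<bar> \<le> 2 powr (- real k * (1 / 2 - \<alpha>)) * (t - s) powr \<alpha>"
proof -
  define h m where "h = 1 / (2 :: real) ^ (k + 1)" and "m = (2 * real l + 1) / 2 ^ (k + 1)"
  let ?d = "\<bar>max 0 (h - \<bar>t - m\<bar>) - max 0 (h - \<bar>s - m\<bar>)\<bar>"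
  have h: "0 < h" "h \<le> 2 powr (- real k)"
    by (auto simp: h_def powr_minus powr_realpow divide_simps)
  have "\<bar>schauder (2 ^ k + l) t - schauder (2 ^ k + l) s\<bar> = sqrt (2 ^ k) * ?d"
    using assms by (simp add: schauder_level abs_mult h_def m_def flip: right_diff_distrib)
  also have "?d \<le> (2 powr (- real k)) powr (1 - \<alpha>) * (t - s) powr \<alpha>"
    by (rule le_powr_interpolate) (use assms h in auto)
  hence "sqrt (2 ^ k) * ?d \<le> sqrt (2 ^ k) * ((2 powr (- real k)) powr (1 - \<alpha>) * (t - s) powr \<alpha>)"
    by (rule mult_left_mono) simp
  also have "sqrt (2 ^ k) = 2 powr (real k / 2)"
    by (simp add: powr_half_sqrt[symmetric] powr_powr flip: powr_realpow)
  also have "2 powr (real k / 2) * ((2 powr (- real k)) powr (1 - \<alpha>) * (t - s) powr \<alpha>) =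
     2 powr (- real k * (1 / 2 - \<alpha>)) * (t - s) powr \<alpha>"
    by (simp add: powr_powr mult.assoc[symmetric] powr_add[symmetric]) (simp add: algebra_simps)
  finally show ?thesis .
qed

text \<open>At most one index is active at \<open>s\<close> and one at \<open>t\<close>, hence a
  factor 2 instead of the number \<open>2 ^ k\<close> of functions in the level.\<close>

lemma schauder_level_sum_holder:
  assumes "0 \<le> s" "s \<le> t" "0 \<le> \<alpha>" "\<alpha> \<le> 1"
  shows "(\<Sum>l<2 ^ k. \<bar>schauder (2 ^ k + l) t - schauder (2 ^ k + l) s\<bar>)
           \<le> 2 * (2 powr (- real k * (1 / 2 - \<alpha>)) * (t - s) powr \<alpha>)"
proof -
  let ?C = "2 powr (- real k * (1 / 2 - \<alpha>)) * (t - s) powr \<alpha>"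
  let ?g = "\<lambda>l. \<bar>schauder (2 ^ k + l) t - schauder (2 ^ k + l) s\<bar>"
  obtain l1 where l1: "\<And>l. l < 2 ^ k \<Longrightarrow> l \<noteq> l1 \<Longrightarrow> schauder (2 ^ k + l) t = 0"
    using schauder_level_support_unique[of t k] assms by auto
  obtain l2 where l2: "\<And>l. l < 2 ^ k \<Longrightarrow> l \<noteq> l2 \<Longrightarrow> schauder (2 ^ k + l) s = 0"
    using schauder_level_support_unique[of s k] assms by auto
  let ?L = "{..<2 ^ k} \<inter> {l1, l2}"
  have "sum ?g {..<2 ^ k} = sum ?g ?L"
    by (rule sum.mono_neutral_right) (use l1 l2 in auto)
  also have "\<dots> \<le> of_nat (card ?L) * ?C"
    by (rule sum_bounded_above) (use schauder_level_holder[OF _ assms] in auto)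
  also have "card ?L \<le> card {l1, l2}" by (intro card_mono) auto
  hence "card ?L \<le> 2" using card_insert_le_m1[of 2 "{l2}" l1] by simp
  hence "of_nat (card ?L) * ?C \<le> 2 * ?C" by (intro mult_right_mono) auto
  finally show ?thesis .
qed

section \<open>The kernel identity at dyadic points\<close>

text \<open>Functions of index below \<open>2 ^ k\<close> have all their kinks on the grid of mesh
  \<open>1 / 2 ^ k\<close>, so they are affine on each cell.\<close>

lemma schauder_midpoint:
  assumes "n < 2 ^ k"
  shows "schauder n ((2 * real i + 1) / 2 ^ (k + 1)) =
    (schauder n (real i / 2 ^ k) + schauder n ((real i + 1) / 2 ^ k)) / 2"
proof (cases "n = 0")
  case True
  thus ?thesis by (simp add: schauder_0 field_simps)
next
  case False
  then obtain j l where jl: "n = 2 ^ j + l" "l < 2 ^ j" using level_decomposition by blast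
  have "(2 :: nat) ^ j < 2 ^ k" using jl assms by linarith
  hence "j < k" by simp
  \<comment> \<open>Half the width of the tent's support, counted in cells of mesh
    \<open>1 / 2 ^ k\<close>. In this unit both kinks and cell ends are integers.\<close>
  define D where "D = (2 :: nat) ^ (k - j - 1)"
  have k: "2 ^ k = real D * 2 ^ (j + 1)"
    using \<open>j < k\<close> unfolding D_def by (simp flip: power_add power_Suc)
  have D: "D > 0" by (simp add: D_def)
  have tent: "max 0 (1 / 2 ^ (j + 1) - \<bar>x / 2 ^ k - (2 * real l + 1) / 2 ^ (j + 1)\<bar>) =
      max 0 (real D - \<bar>x - (2 * real l + 1) * real D\<bar>) / 2 ^ k" for x
  proof -
    have e1: "x / 2 ^ k - (2 * real l + 1) / 2 ^ (j + 1) = (x - (2 * real l + 1) * real D) / 2 ^ k"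
      using D unfolding k by (simp add: field_simps)
    have e2: "1 / 2 ^ (j + 1) = real D / 2 ^ k" using D unfolding k by simp
    have "1 / 2 ^ (j + 1) - \<bar>x / 2 ^ k - (2 * real l + 1) / 2 ^ (j + 1)\<bar> =
        (real D - \<bar>x - (2 * real l + 1) * real D\<bar>) / 2 ^ k"
      unfolding e1 e2 abs_divide by (simp add: diff_divide_distrib)
    thus ?thesis by (simp only: max_divide_distrib_right) simp
  qed
  define r where "r = int i - (2 * int l + 1) * int D"
  have r: "real i - (2 * real l + 1) * real D = real_of_int r" by (simp add: r_def)
  have r': "real i + 1 - (2 * real l + 1) * real D = real_of_int r + 1"
     "(real i + 1 / 2) - (2 * real l + 1) * real D = real_of_int r + 1 / 2"
    using r by linarith+
  have *: "max 0 (real D - \<bar>real_of_int r + 1 / 2\<bar>) =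
    (max 0 (real D - \<bar>real_of_int r\<bar>) + max 0 (real D - \<bar>real_of_int r + 1\<bar>)) / 2"
  proof -
    \<comment> \<open>\<open>r\<close> and \<open>r + 1\<close> are the cell ends relative to the
      centre of the tent. As integers they cannot strictly enclose one of the kinks
      \<open>- D\<close>, \<open>0\<close>, \<open>D\<close>.\<close>
    have "r \<ge> int D \<or> r + 1 \<le> - int D \<or> (- int D \<le> r \<and> r + 1 \<le> int D)" by linarith
    hence "real_of_int r \<ge> real D \<or> real_of_int r + 1 \<le> - real D \<or>
       (- real D \<le> real_of_int r \<and> real_of_int r + 1 \<le> real D)" by linarith
    moreover have "r \<ge> 0 \<or> r + 1 \<le> 0" by linarith
    hence "real_of_int r \<ge> 0 \<or> real_of_int r + 1 \<le> 0" by linarith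
    ultimately show ?thesis by (auto simp: max_def)
  qed
  have mid: "(2 * real i + 1) / 2 ^ (k + 1) = (real i + 1 / 2) / 2 ^ k" by (simp add: field_simps)
  have pos: "0 \<le> (real i + 1 / 2) / 2 ^ k" "0 \<le> real i / 2 ^ k" "0 \<le> (real i + 1) / 2 ^ k" by auto
  show ?thesis
    unfolding mid unfolding jl(1) pos[THEN schauder_level[OF jl(2)]] unfolding tent r r' *
    by (simp add: field_simps)
qed

text \<open>Passing to a finer grid, the new level vanishes at the old grid points. At a new point
  \<open>m\<close> the old levels give the average of \<open>min s\<close> over the two neighbours
  \<open>m - h\<close> and \<open>m + h\<close>. The single new tent active at \<open>m\<close> adds
  \<open>max 0 (h - \<bar>s - m\<bar>) / 2\<close>, exactly the gap between \<open>min s\<close> and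
  its linear interpolant.\<close>

lemma schauder_kernel_dyadic:
  assumes "0 \<le> s" "s \<le> 1" "j \<le> 2 ^ k"
  shows "(\<Sum>n<2 ^ k. schauder n s * schauder n (real j / 2 ^ k)) = min s (real j / 2 ^ k)"
  using assms(3)
proof (induction k arbitrary: j)
  case 0
  thus ?case using assms by (cases j) (auto simp: schauder_0)
next
  case (Suc k)
  have split: "(\<Sum>n<2 ^ Suc k. f n) = (\<Sum>n<2 ^ k. f n) + (\<Sum>l<2 ^ k. f (2 ^ k + l))" for f :: "nat \<Rightarrow> real"
    using sum_lessThan_add[of f "2 ^ k" "2 ^ k"] by (simp add: mult_2)
  show ?case
  proof (cases "even j")
    case True
    then obtain i where i: "j = 2 * i" by auto
    have e: "real j / 2 ^ Suc k = real i / 2 ^ k" by (simp add: i)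
    have "schauder (2 ^ k + l) (real i / 2 ^ k) = 0" if "l < 2 ^ k" for l
      using schauder_level_support[OF that, of "real i / 2 ^ k"] by fastforce
    thus ?thesis unfolding split e using Suc.IH[of i] Suc.prems i by simp
  next
    case False
    then obtain i where i: "j = 2 * i + 1" by (auto elim: oddE)
    have il: "i < 2 ^ k" using Suc.prems i by simp
    define h m where "h = 1 / (2 :: real) ^ (k + 1)" and "m = (2 * real i + 1) / 2 ^ (k + 1)"
    have e: "real j / 2 ^ Suc k = m" by (simp add: i m_def)
    have ab: "real i / 2 ^ k = m - h" "(real i + 1) / 2 ^ k = m + h"
      by (simp_all add: m_def h_def field_simps)
    have "h > 0" by (simp add: h_def)
    have "m > 0" by (simp add: m_def add_pos_nonneg)

    have mk: "2 ^ k * m = real i + 1 / 2" by (simp add: m_def field_simps)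
    have z: "schauder (2 ^ k + l) m = 0" if "l < 2 ^ k" "l \<noteq> i" for l
    proof (rule ccontr)
      assume "schauder (2 ^ k + l) m \<noteq> 0"
      from schauder_level_support[OF that(1) _ this] \<open>m > 0\<close>
      have "real l < real i + 1 / 2" "real i + 1/2 < real l + 1" unfolding mk by simp_all
      with that show False by linarith
    qed
    have "(\<Sum>l<2 ^ k. schauder (2 ^ k + l) s * schauder (2 ^ k + l) m) =
        (\<Sum>l<2 ^ k. if l = i then schauder (2 ^ k + l) s * schauder (2 ^ k + l) m else 0)"
      by (intro sum.cong) (auto simp: z)
    also have "\<dots> = schauder (2 ^ k + i) s * schauder (2 ^ k + i) m" using il by simp
    \<comment> \<open>At \<open>m\<close> the tent has its peak \<open>sqrt (2 ^ k) * h\<close>, and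
      \<open>2 ^ k * h = 1 / 2\<close>.\<close>
    also have "\<dots> = max 0 (h - \<bar>s - m\<bar>) * (sqrt (2 ^ k) * sqrt (2 ^ k)) * h"
      using il assms \<open>m > 0\<close> \<open>h > 0\<close> by (simp only: schauder_level less_imp_le flip: h_def m_def) simp
    also have "\<dots> = max 0 (h - \<bar>s - m\<bar>) / 2" by (simp add: h_def)
    finally have new: "(\<Sum>l<2 ^ k. schauder (2 ^ k + l) s * schauder (2 ^ k + l) m) = max 0 (h - \<bar>s - m\<bar>) / 2" .
    have mid: "schauder n m = (schauder n (real i / 2 ^ k) + schauder n (real (Suc i) / 2 ^ k)) / 2" if "n < 2 ^ k" for n
      using schauder_midpoint[OF that, of i] by (simp add: m_def add.commute)
    have "(\<Sum>n<2 ^ k. schauder n s * schauder n m) =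
      ((\<Sum>n<2 ^ k. schauder n s * schauder n (real i / 2 ^ k)) + (\<Sum>n<2 ^ k. schauder n s * schauder n (real (Suc i) / 2 ^ k))) / 2"
      unfolding sum.distrib[symmetric] sum_divide_distrib
    proof (rule sum.cong[OF refl])
      fix n assume "n \<in> {..<(2::nat) ^ k}"
      hence "n < 2 ^ k" by simp
      from mid[OF this] show "schauder n s * schauder n m =
          (schauder n s * schauder n (real i / 2 ^ k) + schauder n s * schauder n (real (Suc i) / 2 ^ k)) / 2"
        by (simp only: distrib_left times_divide_eq_right)
    qed
    also have "\<dots> = (min s (m - h) + min s (m + h)) / 2"
      using Suc.IH[of i] Suc.IH[of "Suc i"] il ab by (simp add: add.commute)
    finally show ?thesis unfolding split e new using \<open>h > 0\<close> by (auto simp: min_def max_def field_simps split: if_splits)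
  qed
qed

subsection \<open>Series in the Hoelder norm\<close>

lemma holder_norm_le_iff:
  assumes "0 \<le> c"
  shows "holder_norm \<alpha> F \<le> ennreal c \<longleftrightarrow>
    (\<forall>s t. 0 \<le> s \<longrightarrow> s < t \<longrightarrow> t \<le> 1 \<longrightarrow> norm (F t - F s) \<le> c * (t - s) powr \<alpha>)"
proof -
  have "norm (F t - F s) / \<bar>t - s\<bar> powr \<alpha> \<le> c \<longleftrightarrow> norm (F t - F s) \<le> c * (t - s) powr \<alpha>"
    if "s < t" for s t using that by (simp add: divide_le_eq)
  thus ?thesis using assms unfolding holder_norm_def SUP_le_iff by (auto simp: ennreal_le_iff)
qed

lemma holder_norm_finite_bound:
  assumes "holder_norm \<alpha> F < \<infinity>"
  obtains c where "0 \<le> c" "\<And>s t. 0 \<le> s \<Longrightarrow> s < t \<Longrightarrow> t \<le> 1 \<Longrightarrow> norm (F t - F s) \<le> c * (t - s) powr \<alpha>"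
proof -
  obtain c where c: "0 \<le> c" "holder_norm \<alpha> F = ennreal c"
    using assms by (cases "holder_norm \<alpha> F") auto
  thus ?thesis using that holder_norm_le_iff[of c \<alpha> F] by auto
qed

lemma holder_norm_diff_le: "holder_norm \<alpha> (\<lambda>t. F t - G t) \<le> holder_norm \<alpha> F + holder_norm \<alpha> G"
  unfolding holder_norm_def
proof (rule SUP_least)
  fix p :: "real \<times> real" assume "p \<in> {(s, t). 0 \<le> s \<and> s < t \<and> t \<le> 1}"
  then obtain s t where p: "p = (s, t)" and st: "0 \<le> s" "s < t" "t \<le> 1" by (cases p) simp
  let ?d = "\<bar>t - s\<bar> powr \<alpha>"
  have "norm (F t - G t - (F s - G s)) \<le> norm (F t - F s) + norm (G t - G s)"
    using norm_triangle_ineq4[of "F t - F s" "G t - G s"] by (simp add: algebra_simps)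
  hence "norm (F t - G t - (F s - G s)) / ?d \<le> norm (F t - F s) / ?d + norm (G t - G s) / ?d"
    by (simp add: divide_right_mono flip: add_divide_distrib)
  hence "ennreal (norm (F t - G t - (F s - G s)) / ?d) \<le> ennreal (norm (F t - F s) / ?d + norm (G t - G s) / ?d)"
    by (rule ennreal_leI)
  also have "\<dots> = ennreal (norm (F t - F s) / ?d) + ennreal (norm (G t - G s) / ?d)"
    by (intro ennreal_plus divide_nonneg_nonneg) auto
  also have "\<dots> \<le> (SUP (s, t)\<in>{(s, t). 0 \<le> s \<and> s < t \<and> t \<le> 1}. ennreal (norm (F t - F s) / \<bar>t - s\<bar> powr \<alpha>)) +
      (SUP (s, t)\<in>{(s, t). 0 \<le> s \<and> s < t \<and> t \<le> 1}. ennreal (norm (G t - G s) / \<bar>t - s\<bar> powr \<alpha>))"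
    using st by (intro add_mono SUP_upper2[of "(s, t)"]) auto
  finally show "(case p of (s, t) \<Rightarrow> ennreal (norm (F t - G t - (F s - G s)) / \<bar>t - s\<bar> powr \<alpha>)) \<le>
      (SUP (s, t)\<in>{(s, t). 0 \<le> s \<and> s < t \<and> t \<le> 1}. ennreal (norm (F t - F s) / \<bar>t - s\<bar> powr \<alpha>)) +
      (SUP (s, t)\<in>{(s, t). 0 \<le> s \<and> s < t \<and> t \<le> 1}. ennreal (norm (G t - G s) / \<bar>t - s\<bar> powr \<alpha>))"
    by (simp only: p case_prod_conv)
qed

lemma holder_norm_uminus [simp]: "holder_norm \<alpha> (\<lambda>t. - F t) = holder_norm \<alpha> F"
proof -
  have "norm (- F t + F s) = norm (F t - F s)" for s t
    by (metis add.commute diff_conv_add_uminus norm_minus_commute)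
  thus ?thesis by (simp add: holder_norm_def)
qed

lemma holder_norm_add_le: "holder_norm \<alpha> (\<lambda>t. F t + G t) \<le> holder_norm \<alpha> F + holder_norm \<alpha> G"
  using holder_norm_diff_le[of \<alpha> F "\<lambda>t. - G t"] by simp

lemma holder_norm_sum_finite:
  fixes f :: "'i \<Rightarrow> real \<Rightarrow> 'a::real_normed_vector"
  assumes "finite I" "\<And>i. i \<in> I \<Longrightarrow> holder_norm \<alpha> (f i) < \<infinity>"
  shows "holder_norm \<alpha> (\<lambda>t. \<Sum>i\<in>I. f i t) < \<infinity>"
  using assms
proof (induction I)
  case empty
  have "holder_norm \<alpha> (\<lambda>t. 0::'a) \<le> ennreal 0" by (subst holder_norm_le_iff) auto
  thus ?case by simp
next
  case (insert i I)
  have "holder_norm \<alpha> (\<lambda>t. f i t + (\<Sum>i\<in>I. f i t)) \<le> holder_norm \<alpha> (f i) + holder_norm \<alpha> (\<lambda>t. \<Sum>i\<in>I. f i t)"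
    by (rule holder_norm_add_le)
  also have "\<dots> < \<infinity>" using insert by (simp add: less_top)
  finally show ?case using insert by simp
qed

lemma holder_norm_cong:
  assumes "\<And>t. t \<in> {0..1} \<Longrightarrow> F t = G t"
  shows "holder_norm \<alpha> F = holder_norm \<alpha> G"
  unfolding holder_norm_def using assms by (intro SUP_cong) auto

lemma ennreal_tendsto_0I:
  fixes f :: "'b \<Rightarrow> ennreal"
  assumes "\<And>e. 0 < e \<Longrightarrow> eventually (\<lambda>x. f x \<le> ennreal e) F"
  shows "(f \<longlongrightarrow> 0) F"
proof (rule order_tendstoI)
  fix a :: ennreal assume "0 < a"
  then obtain b where b: "0 < b" "b < a" using dense by blast
  hence "b < \<top>" using le_less_trans less_top top_greatest by (metis less_le_trans)
  then obtain e where e: "b = ennreal e" "0 \<le> e" by (cases b) auto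
  have "0 < e" using b(1) e by (simp add: ennreal_less_zero_iff)
  from assms[OF this] show "eventually (\<lambda>x. f x < a) F"
    by eventually_elim (use b e in auto)
qed simp

text \<open>All functions vanish at 0, so the value of the error at \<open>t\<close> is its
  increment from 0 to \<open>t\<close>, which the Hoelder norm controls.\<close>

lemma holder_sums_imp_sums:
  assumes "holder_sums \<alpha> f F" "t \<in> {0..1}"
  shows "(\<lambda>n. f n t) sums F t"
proof (cases "t = 0")
  case True
  thus ?thesis using assms by (auto simp: holder_sums_def holder_space_def)
next
  case False
  hence t: "0 < t" "t \<le> 1" using assms by auto
  have z: "f n 0 = 0" "F 0 = 0" for n using assms by (auto simp: holder_sums_def holder_space_def)
  show ?thesis unfolding sums_def
  proof (rule LIMSEQ_I)
    fix r :: real assume "0 < r"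
    define e where "e = r / (2 * t powr \<alpha>)"
    have "0 < e" using \<open>0 < r\<close> t by (simp add: e_def)
    have "(\<lambda>N. holder_norm \<alpha> (\<lambda>t. (\<Sum>n<N. f n t) - F t)) \<longlonglongrightarrow> 0"
      using assms by (simp add: holder_sums_def)
    from order_tendstoD(2)[OF this, of "ennreal e"] \<open>0 < e\<close>
    obtain N0 where N0: "\<And>N. N \<ge> N0 \<Longrightarrow> holder_norm \<alpha> (\<lambda>t. (\<Sum>n<N. f n t) - F t) < ennreal e"
      by (auto simp: eventually_sequentially)
    have "norm ((\<Sum>n<N. f n t) - F t) < r" if "N \<ge> N0" for N
    proof -
      have "norm ((\<Sum>n<N. f n t) - F t - ((\<Sum>n<N. f n 0) - F 0)) \<le> e * (t - 0) powr \<alpha>"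
        using less_imp_le[OF N0[OF that]] t \<open>0 < e\<close> unfolding holder_norm_le_iff[OF less_imp_le[OF \<open>0 < e\<close>]] by blast
      thus ?thesis using \<open>0 < r\<close> t by (simp add: z e_def)
    qed
    thus "\<exists>no. \<forall>n\<ge>no. norm ((\<Sum>n<n. f n t) - F t) < r" by blast
  qed
qed

text \<open>Completeness of the Hoelder space. The Cauchy side no longer mentions a limit function;
  this opens the way to measurability, and it reduces convergence to estimates on finite
  blocks.\<close>

lemma holder_summable_iff_Cauchy:
  fixes f :: "nat \<Rightarrow> real \<Rightarrow> 'a::{real_normed_vector, complete_space}"
  assumes f: "\<And>n. f n \<in> holder_space \<alpha>"
  shows "holder_summable \<alpha> f \<longleftrightarrow>
    (\<forall>e>0. \<exists>N. \<forall>m\<ge>N. \<forall>n\<ge>m. holder_norm \<alpha> (\<lambda>t. \<Sum>i\<in>{m..<n}. f i t) \<le> ennreal e)"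
    (is "_ \<longleftrightarrow> ?C")
proof
  assume "holder_summable \<alpha> f"
  then obtain F where F: "(\<lambda>N. holder_norm \<alpha> (\<lambda>t. (\<Sum>n<N. f n t) - F t)) \<longlonglongrightarrow> 0"
    by (auto simp: holder_summable_def holder_sums_def)
  show ?C
  proof (intro allI impI)
    fix e :: real assume "0 < e"
    from order_tendstoD(2)[OF F, of "ennreal (e / 2)"] \<open>0 < e\<close>
    obtain N where N: "\<And>n. n \<ge> N \<Longrightarrow> holder_norm \<alpha> (\<lambda>t. (\<Sum>i<n. f i t) - F t) < ennreal (e / 2)"
      by (auto simp: eventually_sequentially)
    show "\<exists>N. \<forall>m\<ge>N. \<forall>n\<ge>m. holder_norm \<alpha> (\<lambda>t. \<Sum>i\<in>{m..<n}. f i t) \<le> ennreal e"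
    proof (intro exI allI impI)
      fix m n assume mn: "N \<le> m" "m \<le> n"
      have "(\<Sum>i\<in>{m..<n}. f i t) = ((\<Sum>i<n. f i t) - F t) - ((\<Sum>i<m. f i t) - F t)" for t
        using mn sum_diff_nat_ivl[of 0 m n "\<lambda>i. f i t"] by (simp add: atLeast0LessThan)
      hence "holder_norm \<alpha> (\<lambda>t. \<Sum>i\<in>{m..<n}. f i t) \<le>
         holder_norm \<alpha> (\<lambda>t. (\<Sum>i<n. f i t) - F t) + holder_norm \<alpha> (\<lambda>t. (\<Sum>i<m. f i t) - F t)"
        using holder_norm_diff_le[of \<alpha> "\<lambda>t. (\<Sum>i<n. f i t) - F t" "\<lambda>t. (\<Sum>i<m. f i t) - F t"] by simp
      also have "\<dots> \<le> ennreal (e / 2) + ennreal (e / 2)"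
        using N[of m] N[of n] mn by (intro add_mono less_imp_le) auto
      also have "\<dots> = ennreal e" using \<open>0 < e\<close> by (simp flip: ennreal_plus)
      finally show "holder_norm \<alpha> (\<lambda>t. \<Sum>i\<in>{m..<n}. f i t) \<le> ennreal e" .
    qed
  qed
next
  assume C: ?C
  have z: "f n 0 = 0" for n using f by (auto simp: holder_space_def)
  have bound: "\<exists>N. \<forall>m\<ge>N. \<forall>n\<ge>m. \<forall>s t. 0 \<le> s \<longrightarrow> s < t \<longrightarrow> t \<le> 1 \<longrightarrow>
      norm ((\<Sum>i<n. f i t) - (\<Sum>i<m. f i t) - ((\<Sum>i<n. f i s) - (\<Sum>i<m. f i s))) \<le> e * (t - s) powr \<alpha>"
    if "0 < e" for e
  proof -
    obtain N where N: "\<And>m n. m \<ge> N \<Longrightarrow> n \<ge> m \<Longrightarrow> holder_norm \<alpha> (\<lambda>t. \<Sum>i\<in>{m..<n}. f i t) \<le> ennreal e"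
      using C \<open>0 < e\<close> by blast
    have "(\<Sum>i\<in>{m..<n}. f i t) = (\<Sum>i<n. f i t) - (\<Sum>i<m. f i t)" if "m \<le> n" for m n t
      using that sum_diff_nat_ivl[of 0 m n "\<lambda>i. f i t"] by (simp add: atLeast0LessThan)
    thus ?thesis using N \<open>0 < e\<close> by (intro exI[of _ N]) (simp add: holder_norm_le_iff)
  qed
  have "convergent (\<lambda>n. \<Sum>i<n. f i t)" if t: "t \<in> {0..1}" for t
  proof (cases "t = 0")
    case True
    thus ?thesis by (simp add: z convergent_const)
  next
    case False
    hence t: "0 < t" "t \<le> 1" using that by auto
    have "Cauchy (\<lambda>n. \<Sum>i<n. f i t)"
    proof (rule CauchyI')
      fix r :: real assume r: "0 < r"
      define e where "e = r / (2 * t powr \<alpha>)"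
      have "0 < e" using r t by (simp add: e_def)
      then obtain N where N: "\<forall>m\<ge>N. \<forall>n\<ge>m. \<forall>s t. 0 \<le> s \<longrightarrow> s < t \<longrightarrow> t \<le> 1 \<longrightarrow>
         norm ((\<Sum>i<n. f i t) - (\<Sum>i<m. f i t) - ((\<Sum>i<n. f i s) - (\<Sum>i<m. f i s))) \<le> e * (t - s) powr \<alpha>"
        using bound by blast
      have "norm ((\<Sum>i<m. f i t) - (\<Sum>i<n. f i t)) < r" if "m \<ge> N" "n > m" for m n
      proof -
        have "norm ((\<Sum>i<n. f i t) - (\<Sum>i<m. f i t)) \<le> e * (t - 0) powr \<alpha>"
          using N[rule_format, of m n 0 t] that t by (simp add: z)
        thus ?thesis using r t by (simp add: e_def norm_minus_commute)
      qed
      thus "\<exists>M. \<forall>m\<ge>M. \<forall>n>m. dist (\<Sum>i<m. f i t) (\<Sum>i<n. f i t) < r"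
        by (auto simp: dist_norm)
    qed
    thus ?thesis by (rule Cauchy_convergent)
  qed
  then obtain F where F: "\<And>t. t \<in> {0..1} \<Longrightarrow> (\<lambda>n. \<Sum>i<n. f i t) \<longlonglongrightarrow> F t"
    unfolding convergent_def by metis
  have ev: "\<exists>N. \<forall>m\<ge>N. holder_norm \<alpha> (\<lambda>t. (\<Sum>i<m. f i t) - F t) \<le> ennreal e" if "0 < e" for e
  proof -
    obtain N where N: "\<forall>m\<ge>N. \<forall>n\<ge>m. \<forall>s t. 0 \<le> s \<longrightarrow> s < t \<longrightarrow> t \<le> 1 \<longrightarrow>
      norm ((\<Sum>i<n. f i t) - (\<Sum>i<m. f i t) - ((\<Sum>i<n. f i s) - (\<Sum>i<m. f i s))) \<le> e * (t - s) powr \<alpha>"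
      using bound[OF \<open>0 < e\<close>] by blast
    \<comment> \<open>With \<open>m\<close> fixed let \<open>n\<close> tend to infinity:
      \<open>N\<close> does not depend on \<open>s\<close> and \<open>t\<close>, so the increment
      bound survives the pointwise limit uniformly.\<close>
    have "norm ((\<Sum>i<m. f i t) - F t - ((\<Sum>i<m. f i s) - F s)) \<le> e * (t - s) powr \<alpha>"
      if "m \<ge> N" "0 \<le> s" "s < t" "t \<le> 1" for m s t
    proof -
      have "(\<lambda>n. norm ((\<Sum>i<n. f i t) - (\<Sum>i<m. f i t) - ((\<Sum>i<n. f i s) - (\<Sum>i<m. f i s))))
         \<longlonglongrightarrow> norm (F t - (\<Sum>i<m. f i t) - (F s - (\<Sum>i<m. f i s)))"
        using that by (intro tendsto_intros F) auto
      hence "norm (F t - (\<Sum>i<m. f i t) - (F s - (\<Sum>i<m. f i s))) \<le> e * (t - s) powr \<alpha>"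
        by (rule LIMSEQ_le_const2) (use N that in blast)
      also have "F t - (\<Sum>i<m. f i t) - (F s - (\<Sum>i<m. f i s)) = - ((\<Sum>i<m. f i t) - F t - ((\<Sum>i<m. f i s) - F s))"
        by simp
      finally show ?thesis by (simp only: norm_minus_cancel)
    qed
    thus ?thesis using that by (auto simp: holder_norm_le_iff)
  qed
  have "F 0 = 0" using F[of 0] by (simp add: z LIMSEQ_const_iff)
  moreover have "holder_norm \<alpha> F < \<infinity>"
  proof -
    \<comment> \<open>One partial sum at finite Hoelder distance already forces \<open>F\<close> to
      have finite norm.\<close>
    obtain m where m: "holder_norm \<alpha> (\<lambda>t. (\<Sum>i<m. f i t) - F t) \<le> ennreal 1"
      using ev[of 1] by auto
    have "holder_norm \<alpha> F \<le> holder_norm \<alpha> (\<lambda>t. \<Sum>i<m. f i t) + holder_norm \<alpha> (\<lambda>t. (\<Sum>i<m. f i t) - F t)"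
      using holder_norm_diff_le[of \<alpha> "\<lambda>t. \<Sum>i<m. f i t" "\<lambda>t. (\<Sum>i<m. f i t) - F t"] by simp
    also have "\<dots> < \<infinity>"
      using holder_norm_sum_finite[of "{..<m}" \<alpha> f] f m
      by (auto simp: holder_space_def less_top[symmetric] dest: neq_top_trans[rotated])
    finally show ?thesis .
  qed
  moreover have "(\<lambda>N. holder_norm \<alpha> (\<lambda>t. (\<Sum>n<N. f n t) - F t)) \<longlonglongrightarrow> 0"
    using ev by (intro ennreal_tendsto_0I) (auto simp: eventually_sequentially)
  ultimately show "holder_summable \<alpha> f"
    using f unfolding holder_summable_def holder_sums_def holder_space_def by blast
qed

lemma holder_space_continuous_on:
  assumes "F \<in> holder_space \<alpha>" "0 < \<alpha>"
  shows "continuous_on {0..1} F"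
proof -
  obtain c where c: "0 \<le> c" "\<And>s t. 0 \<le> s \<Longrightarrow> s < t \<Longrightarrow> t \<le> 1 \<Longrightarrow> norm (F t - F s) \<le> c * (t - s) powr \<alpha>"
    using holder_norm_finite_bound assms(1) unfolding holder_space_def by blast
  have b: "norm (F y - F x) \<le> c * \<bar>y - x\<bar> powr \<alpha>" if "x \<in> {0..1}" "y \<in> {0..1}" for x y
    using c(2)[of x y] c(2)[of y x] that c(1)
    by (cases x y rule: linorder_cases) (auto simp: norm_minus_commute abs_minus_commute)
  show ?thesis unfolding continuous_on_def
  proof
    fix x :: real assume x: "x \<in> {0..1}"
    have "((\<lambda>y. c * \<bar>y - x\<bar> powr \<alpha>) \<longlongrightarrow> c * \<bar>x - x\<bar> powr \<alpha>) (at x within {0..1})"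
      using assms(2) by (intro tendsto_mult tendsto_powr' tendsto_const tendsto_rabs tendsto_diff tendsto_ident_at) auto
    hence "((\<lambda>y. c * \<bar>y - x\<bar> powr \<alpha>) \<longlongrightarrow> 0) (at x within {0..1})" by simp
    hence "((\<lambda>y. F y - F x) \<longlongrightarrow> 0) (at x within {0..1})"
      by (rule Lim_null_comparison[rotated]) (use b x in \<open>auto simp: eventually_at_filter\<close>)
    thus "(F \<longlongrightarrow> F x) (at x within {0..1})" by (simp add: Lim_null[symmetric])
  qed
qed

section \<open>Schauder series with slowly growing coefficients\<close>

lemma continuous_on_schauder: "continuous_on {0..1} (schauder n)"
proof (cases "n = 0")
  case True
  have "continuous_on {0..1} (schauder 0) \<longleftrightarrow> continuous_on {0..1} (\<lambda>t::real. t)"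
    by (intro continuous_on_cong) (auto simp: schauder_0)
  thus ?thesis using True by (simp add: continuous_on_id)
next
  case False
  then obtain k l where kl: "n = 2 ^ k + l" "l < 2 ^ k" using level_decomposition by blast
  have "continuous_on {0..1} (\<lambda>t. sqrt (2 ^ k) * max 0 (1 / 2 ^ (k + 1) - \<bar>t - (2 * real l + 1) / 2 ^ (k + 1)\<bar>))"
    by (intro continuous_intros)
  thus ?thesis by (rule continuous_on_eq) (use kl in \<open>simp add: schauder_level\<close>)
qed

lemma schauder_in_holder_space:
  assumes "0 \<le> \<alpha>" "\<alpha> \<le> 1"
  shows "(\<lambda>t. schauder n t *\<^sub>R z) \<in> holder_space \<alpha>"
proof -
  obtain C where C: "0 \<le> C" "\<And>s t. 0 \<le> s \<Longrightarrow> s < t \<Longrightarrow> t \<le> 1 \<Longrightarrow>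
       \<bar>schauder n t - schauder n s\<bar> \<le> C * (t - s) powr \<alpha>"
  proof (cases "n = 0")
    case True
    have "\<bar>schauder n t - schauder n s\<bar> \<le> 1 * (t - s) powr \<alpha>" if "0 \<le> s" "s < t" "t \<le> 1" for s t
      using powr_mono'[of \<alpha> 1 "t - s"] assms that True by (simp add: schauder_0)
    thus ?thesis using that[of 1] by auto
  next
    case False
    then obtain k l where kl: "n = 2 ^ k + l" "l < 2 ^ k" using level_decomposition by blast
    show ?thesis
      by (rule that[of "2 powr (- real k * (1 / 2 - \<alpha>))"])
        (use schauder_level_holder[OF kl(2) _ _ assms] kl(1) in auto)
  qed
  have "norm (schauder n t *\<^sub>R z - schauder n s *\<^sub>R z) \<le> (C * norm z) * (t - s) powr \<alpha>"
    if "0 \<le> s" "s < t" "t \<le> 1" for s t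
    using mult_right_mono[OF C(2)[OF that] norm_ge_zero[of z]]
    by (simp add: mult_ac flip: scaleR_left_diff_distrib)
  hence "holder_norm \<alpha> (\<lambda>t. schauder n t *\<^sub>R z) \<le> ennreal (C * norm z)"
    using C(1) by (subst holder_norm_le_iff) auto
  thus ?thesis by (auto simp: holder_space_def intro: le_less_trans)
qed

text \<open>Coefficients of level \<open>k\<close> are at most
  \<open>C * 2 powr ((k + 1) * \<epsilon>)\<close>, while the level is damped by
  \<open>2 powr (- k * (1 / 2 - \<alpha>))\<close>. The product decays geometrically with ratio
  \<open>q < 1\<close>.\<close>

lemma schauder_series_holder_summable:
  fixes a :: "nat \<Rightarrow> 'a::{real_normed_vector, complete_space}"
  assumes "0 \<le> \<alpha>" "0 \<le> \<epsilon>" "\<alpha> + \<epsilon> < 1 / 2"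
    and a: "\<And>n. norm (a n) \<le> C * real (Suc n) powr \<epsilon>"
  shows "holder_summable \<alpha> (\<lambda>n t. schauder n t *\<^sub>R a n)"
proof -
  define q where "q = 2 powr (- (1 / 2 - \<alpha> - \<epsilon>))"
  have q: "0 < q" "q < 1" using assms by (auto simp: q_def intro: powr_less_one)
  have qk: "q ^ k = 2 powr (real k * - (1 / 2 - \<alpha> - \<epsilon>))" for k
    using q(1) by (simp only: powr_realpow[symmetric]) (simp add: q_def powr_powr mult.commute)
  have "0 \<le> C" using order_trans[OF norm_ge_zero a[of 0]] by simp
  \<comment> \<open>The factor 2 counts the active indices of a level,
    \<open>2 powr \<epsilon>\<close> comes from bounding \<open>Suc n\<close> by
    \<open>2 ^ (k + 1)\<close>, and \<open>1 / (1 - q)\<close> is the geometric series.\<close>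
  define C' where "C' = 2 * C * 2 powr \<epsilon> / (1 - q)"
  have "0 \<le> C'" using \<open>0 \<le> C\<close> q by (simp add: C'_def)
  \<comment> \<open>Summing absolute values allows a block \<open>{m..<n}\<close> that cuts through
    levels to be enlarged to a union of whole levels.\<close>
  define g where "g s t n = \<bar>schauder n t - schauder n s\<bar> * norm (a n)" for s t n
  have g0: "0 \<le> g s t n" for s t n by (simp add: g_def)
  have level: "(\<Sum>l<2 ^ k. g s t (2 ^ k + l)) \<le> (2 * C * 2 powr \<epsilon>) * q ^ k * (t - s) powr \<alpha>"
    if "0 \<le> s" "s < t" "t \<le> 1" for s t k
  proof -
    have "(\<Sum>l<2 ^ k. g s t (2 ^ k + l)) \<le>
       (\<Sum>l<2 ^ k. \<bar>schauder (2 ^ k + l) t - schauder (2 ^ k + l) s\<bar> * (C * 2 powr (real (Suc k) * \<epsilon>)))"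
      unfolding g_def
    proof (intro sum_mono mult_left_mono)
      fix l :: nat assume "l \<in> {..<2 ^ k}"
      hence "Suc (2 ^ k + l) \<le> 2 ^ Suc k" by simp
      hence "real (Suc (2 ^ k + l)) \<le> 2 ^ Suc k" by (metis of_nat_le_iff of_nat_numeral of_nat_power)
      hence "real (Suc (2 ^ k + l)) powr \<epsilon> \<le> (2 ^ Suc k) powr \<epsilon>" using assms by (intro powr_mono2) auto
      also have "(2 ^ Suc k) powr \<epsilon> = 2 powr (real (Suc k) * \<epsilon>)"
        by (simp only: powr_realpow[symmetric] powr_powr zero_less_numeral)
      finally show "norm (a (2 ^ k + l)) \<le> C * 2 powr (real (Suc k) * \<epsilon>)"
        using a[of "2 ^ k + l"] \<open>0 \<le> C\<close> by (meson mult_left_mono order_trans)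
    qed simp
    also have "\<dots> \<le> 2 * (2 powr (- real k * (1 / 2 - \<alpha>)) * (t - s) powr \<alpha>) * (C * 2 powr (real (Suc k) * \<epsilon>))"
      unfolding sum_distrib_right[symmetric]
      using assms that \<open>0 \<le> C\<close> by (intro mult_right_mono schauder_level_sum_holder) auto
    also have "\<dots> = 2 * C * (2 powr (- real k * (1 / 2 - \<alpha>)) * 2 powr (real (Suc k) * \<epsilon>)) * (t - s) powr \<alpha>"
      by (simp add: mult_ac)
    also have "2 powr (- real k * (1 / 2 - \<alpha>)) * 2 powr (real (Suc k) * \<epsilon>) = 2 powr \<epsilon> * q ^ k"
      unfolding qk powr_add[symmetric] by (simp add: algebra_simps)
    finally show ?thesis by (simp add: mult_ac)
  qed
  have levels: "sum (g s t) {2 ^ K..<2 ^ (K + d)} = (\<Sum>k\<in>{K..<K + d}. \<Sum>l<2 ^ k. g s t (2 ^ k + l))" for s t K d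
  proof (induction d)
    case (Suc d)
    have "sum (g s t) {2 ^ K..<2 ^ (K + Suc d)} = sum (g s t) {2 ^ K..<2 ^ (K + d)} + sum (g s t) {2 ^ (K + d)..<2 ^ (K + Suc d)}"
      by (rule sum.atLeastLessThan_concat[symmetric]) (auto intro: power_increasing)
    also have "sum (g s t) {2 ^ (K + d)..<2 ^ (K + Suc d)} = (\<Sum>l<2 ^ (K + d). g s t (2 ^ (K + d) + l))"
      using sum.shift_bounds_nat_ivl[of "g s t" 0 "2 ^ (K + d)" "2 ^ (K + d)"]
      by (simp add: atLeast0LessThan add.commute mult_2)
    finally show ?case using Suc by simp
  qed simp
  have main: "sum (g s t) {m..<n} \<le> C' * q ^ K * (t - s) powr \<alpha>"
    if st: "0 \<le> s" "s < t" "t \<le> 1" and m: "2 ^ K \<le> m" for s t m n K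
  proof -
    have "n < 2 ^ n" by simp
    also have "(2 :: nat) ^ n \<le> 2 ^ (K + n)" by (intro power_increasing) auto
    finally have "{m..<n} \<subseteq> {2 ^ K..<2 ^ (K + n)}" using m by auto
    hence "sum (g s t) {m..<n} \<le> sum (g s t) {2 ^ K..<2 ^ (K + n)}" by (intro sum_mono2) (auto simp: g0)
    also have "\<dots> \<le> (\<Sum>k\<in>{K..<K + n}. (2 * C * 2 powr \<epsilon>) * q ^ k * (t - s) powr \<alpha>)"
      unfolding levels by (intro sum_mono level st)
    also have "\<dots> = (2 * C * 2 powr \<epsilon>) * (t - s) powr \<alpha> * (\<Sum>k\<in>{K..<K + n}. q ^ k)"
      by (simp add: sum_distrib_left mult_ac)
    also have "(\<Sum>k\<in>{K..<K + n}. q ^ k) = q ^ K * (\<Sum>k<n. q ^ k)"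
      using sum.shift_bounds_nat_ivl[of "\<lambda>k. q ^ k" 0 K n]
      by (simp add: atLeast0LessThan add.commute sum_distrib_left power_add mult.commute)
    also have "(\<Sum>k<n. q ^ k) \<le> 1 / (1 - q)"
      using q sum_le_suminf[OF summable_geometric[of q], of "{..<n}"] by (simp add: suminf_geometric)
    hence "(2 * C * 2 powr \<epsilon>) * (t - s) powr \<alpha> * (q ^ K * (\<Sum>k<n. q ^ k)) \<le>
        (2 * C * 2 powr \<epsilon>) * (t - s) powr \<alpha> * (q ^ K * (1 / (1 - q)))"
      using q \<open>0 \<le> C\<close> by (intro mult_left_mono) auto
    finally show ?thesis by (simp add: C'_def mult_ac)
  qed
  show ?thesis
  proof (subst holder_summable_iff_Cauchy)
    show "(\<lambda>t. schauder n t *\<^sub>R a n) \<in> holder_space \<alpha>" for n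
      using assms by (intro schauder_in_holder_space) auto
    show "\<forall>e>0. \<exists>N. \<forall>m\<ge>N. \<forall>n\<ge>m. holder_norm \<alpha> (\<lambda>t. \<Sum>i\<in>{m..<n}. schauder i t *\<^sub>R a i) \<le> ennreal e"
    proof (intro allI impI)
      fix e :: real assume "0 < e"
      have "(\<lambda>K. C' * q ^ K) \<longlonglongrightarrow> C' * 0"
        using q by (intro tendsto_intros LIMSEQ_realpow_zero) auto
      from order_tendstoD(2)[OF this, of e] \<open>0 < e\<close> obtain K where K: "C' * q ^ K < e"
        by (auto simp: eventually_sequentially)
      show "\<exists>N. \<forall>m\<ge>N. \<forall>n\<ge>m. holder_norm \<alpha> (\<lambda>t. \<Sum>i\<in>{m..<n}. schauder i t *\<^sub>R a i) \<le> ennreal e"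
      proof (intro exI allI impI)
        fix m n :: nat assume m: "2 ^ K \<le> m"
        have "norm ((\<Sum>i\<in>{m..<n}. schauder i t *\<^sub>R a i) - (\<Sum>i\<in>{m..<n}. schauder i s *\<^sub>R a i)) \<le> e * (t - s) powr \<alpha>"
          if "0 \<le> s" "s < t" "t \<le> 1" for s t
        proof -
          have "norm ((\<Sum>i\<in>{m..<n}. schauder i t *\<^sub>R a i) - (\<Sum>i\<in>{m..<n}. schauder i s *\<^sub>R a i)) \<le> sum (g s t) {m..<n}"
            unfolding sum_subtractf[symmetric] g_def
            by (rule order_trans[OF norm_sum]) (simp flip: scaleR_left_diff_distrib)
          also have "\<dots> \<le> C' * q ^ K * (t - s) powr \<alpha>" by (rule main[OF that m])
          also have "\<dots> \<le> e * (t - s) powr \<alpha>" using K by (intro mult_right_mono) auto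
          finally show ?thesis .
        qed
        thus "holder_norm \<alpha> (\<lambda>t. \<Sum>i\<in>{m..<n}. schauder i t *\<^sub>R a i) \<le> ennreal e"
          using \<open>0 < e\<close> by (subst holder_norm_le_iff) auto
      qed
    qed
  qed
qed

text \<open>At dyadic \<open>t\<close> the partial sums up to large powers of 2 are exact. Other
  points are reached by continuity of the sum in \<open>t\<close>, which Hoelder convergence
  provides.\<close>

lemma schauder_kernel_sums:
  assumes s: "s \<in> {0..1}" and t: "t \<in> {0..1}"
  shows "(\<lambda>n. schauder n s * schauder n t) sums min s t"
proof -
  \<comment> \<open>For fixed \<open>s\<close> the numbers \<open>schauder n s\<close> are bounded
    coefficients, hence growth exponent 0; 1/4 stands for any Hoelder exponent strictly between 0
    and 1/2.\<close>
  have "holder_summable (1/4) (\<lambda>n t. schauder n t *\<^sub>R schauder n s)"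
    by (rule schauder_series_holder_summable[where \<epsilon> = 0 and C = 1])
      (use s schauder_le_1 schauder_nonneg in \<open>auto simp: abs_le_iff intro: order_trans[of _ 0]\<close>)
  then obtain F where F: "holder_sums (1/4) (\<lambda>n t. schauder n t *\<^sub>R schauder n s) F"
    by (auto simp: holder_summable_def)
  have S: "(\<lambda>n. schauder n s * schauder n u) sums F u" if "u \<in> {0..1}" for u
    using holder_sums_imp_sums[OF F that] by (simp add: mult.commute)
  have cont: "continuous_on {0..1} F"
    using F by (intro holder_space_continuous_on[of _ "1/4"]) (auto simp: holder_sums_def)
  have dyadic: "F (real j / 2 ^ k) = min s (real j / 2 ^ k)" if j: "j \<le> 2 ^ k" for j k
  proof -
    let ?u = "real j / 2 ^ k"
    have "real j \<le> 2 ^ k" using j by (metis of_nat_le_iff of_nat_numeral of_nat_power)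
    hence "?u \<in> {0..1}" by simp
    have "(\<lambda>i. 2 ^ (i + k) :: nat) = (\<lambda>i. 2 ^ i) \<circ> (\<lambda>i. i + k)" by auto
    have "strict_mono (\<lambda>i. 2 ^ (i + k) :: nat)" by (auto simp: strict_mono_def)
    from LIMSEQ_subseq_LIMSEQ[OF S[OF \<open>?u \<in> {0..1}\<close>, unfolded sums_def] this]
    have "(\<lambda>i. \<Sum>n<2 ^ (i + k). schauder n s * schauder n ?u) \<longlonglongrightarrow> F ?u" by (simp add: o_def)
    \<comment> \<open>A point of the grid of level \<open>k\<close> also lies on every finer grid,
      so the dyadic identity applies at level \<open>i + k\<close>.\<close>
    moreover have "(\<Sum>n<2 ^ (i + k). schauder n s * schauder n ?u) = min s ?u" for i
    proof -
      have e: "?u = real (j * 2 ^ i) / 2 ^ (i + k)" by (simp add: power_add)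
      show ?thesis unfolding e
        by (rule schauder_kernel_dyadic) (use s j in \<open>auto simp: power_add\<close>)
    qed
    ultimately show ?thesis by (simp add: LIMSEQ_const_iff)
  qed
  define u where "u k = real (nat \<lfloor>2 ^ k * t\<rfloor>) / 2 ^ k" for k
  have fl: "real (nat \<lfloor>2 ^ k * t\<rfloor>) \<le> 2 ^ k * t" "2 ^ k * t \<le> real (nat \<lfloor>2 ^ k * t\<rfloor>) + 1" for k
    using t by (auto simp: of_nat_nat)
  have j: "nat \<lfloor>2 ^ k * t\<rfloor> \<le> 2 ^ k" for k
  proof -
    have "2 ^ k * t \<le> 2 ^ k * 1" using t by (intro mult_left_mono) auto
    hence "\<lfloor>2 ^ k * t\<rfloor> \<le> 2 ^ k" using floor_mono[of "2 ^ k * t" "2 ^ k"] by simp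
    thus ?thesis by (simp add: nat_le_iff)
  qed
  have u: "u k \<le> t" "t - (1/2) ^ k \<le> u k" "0 \<le> u k" for k
  proof -
    have "t - (1/2) ^ k = (2 ^ k * t - 1) / 2 ^ k" by (simp add: field_simps power_one_over)
    also have "\<dots> \<le> u k" unfolding u_def using fl(2)[of k] by (intro divide_right_mono) auto
    finally show "t - (1/2) ^ k \<le> u k" .
    show "u k \<le> t" using fl(1)[of k] by (simp add: u_def divide_le_eq mult.commute)
  qed (simp add: u_def)
  have "u \<longlonglongrightarrow> t"
  proof (rule tendsto_sandwich)
    show "(\<lambda>k. t - (1/2) ^ k) \<longlonglongrightarrow> t"
      using tendsto_diff[OF tendsto_const[of t] LIMSEQ_realpow_zero[of "1/2::real"]] by simp
    show "(\<lambda>k. t) \<longlonglongrightarrow> t" by simp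
  qed (use u in auto)
  have "(\<lambda>k. F (u k)) \<longlonglongrightarrow> F t"
    by (rule continuous_on_tendsto_compose[OF cont \<open>u \<longlonglongrightarrow> t\<close> t])
      (use u(3) order_trans[OF u(1), of 1] t in auto)
  moreover have "F (u k) = min s (u k)" for k unfolding u_def by (rule dyadic[OF j])
  moreover have "(\<lambda>k. min s (u k)) \<longlonglongrightarrow> min s t" by (intro tendsto_intros \<open>u \<longlonglongrightarrow> t\<close>)
  ultimately have "F t = min s t" using LIMSEQ_unique by auto
  thus ?thesis using S[OF t] by simp
qed

section \<open>Measurability of the convergence event\<close>

text \<open>Rational points are chosen strictly between \<open>s\<close> and \<open>t\<close>, so
  they stay in the unit interval even when \<open>s = 0\<close> or \<open>t = 1\<close>; both sides
  of the bound are continuous.\<close>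

lemma holder_bound_rational:
  assumes "continuous_on {0..1} F" "0 < \<alpha>"
  shows "(\<forall>s t. 0 \<le> s \<longrightarrow> s < t \<longrightarrow> t \<le> 1 \<longrightarrow> norm (F t - F s) \<le> c * (t - s) powr \<alpha>) \<longleftrightarrow>
    (\<forall>s\<in>\<rat>. \<forall>t\<in>\<rat>. 0 \<le> s \<longrightarrow> s < t \<longrightarrow> t \<le> 1 \<longrightarrow> norm (F t - F s) \<le> c * (t - s) powr \<alpha>)" (is "?L \<longleftrightarrow> ?R")
proof
  assume R: ?R
  show ?L
  proof (intro allI impI)
    fix s t :: real assume st: "0 \<le> s" "s < t" "t \<le> 1"
    \<comment> \<open>At most half of \<open>t - s\<close>, so the approximations from the two ends
      cannot cross.\<close>
    define d where "d n = (t - s) / (2 * real (Suc n))" for n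
    have d: "0 < d n" "d n \<le> (t - s) / 2" for n
      using st unfolding d_def by (simp, intro divide_left_mono) auto
    have "d \<longlonglongrightarrow> (t - s) / 2 * 0"
      unfolding d_def using tendsto_mult[OF tendsto_const[of "(t - s) / 2"] LIMSEQ_inverse_real_of_nat]
      by (simp add: field_simps)
    hence d0: "d \<longlonglongrightarrow> 0" by simp
    have "\<forall>n. \<exists>x. x \<in> \<rat> \<and> s < x \<and> x < s + d n"
      using Rats_dense_in_real[of s "s + d n" for n] d(1) by fastforce
    then obtain x where x: "\<And>n. x n \<in> \<rat>" "\<And>n. s < x n" "\<And>n. x n < s + d n" by metis
    have "\<forall>n. \<exists>y. y \<in> \<rat> \<and> t - d n < y \<and> y < t"
      using Rats_dense_in_real[of "t - d n" t for n] d(1) by fastforce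
    then obtain y where y: "\<And>n. y n \<in> \<rat>" "\<And>n. t - d n < y n" "\<And>n. y n < t" by metis
    have xy: "x n < y n" for n using x(3)[of n] y(2)[of n] d(2)[of n] by (simp add: field_simps)
    have xl: "x \<longlonglongrightarrow> s"
    proof (rule tendsto_sandwich)
      show "(\<lambda>n. s) \<longlonglongrightarrow> s" by simp
      show "(\<lambda>n. s + d n) \<longlonglongrightarrow> s" using tendsto_add[OF tendsto_const[of s] d0] by simp
    qed (use x(2,3) in \<open>auto intro!: always_eventually less_imp_le\<close>)
    have yl: "y \<longlonglongrightarrow> t"
    proof (rule tendsto_sandwich)
      show "(\<lambda>n. t - d n) \<longlonglongrightarrow> t" using tendsto_diff[OF tendsto_const[of t] d0] by simp
      show "(\<lambda>n. t) \<longlonglongrightarrow> t" by simp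
    qed (use y(2,3) in \<open>auto intro!: always_eventually less_imp_le\<close>)
    have I: "0 \<le> x n" "y n \<le> 1" "x n \<le> 1" "0 \<le> y n" for n
      using x(2)[of n] y(3)[of n] xy[of n] st by linarith+
    have "(\<lambda>n. norm (F (y n) - F (x n))) \<longlonglongrightarrow> norm (F t - F s)"
      by (intro tendsto_norm tendsto_diff continuous_on_tendsto_compose[OF assms(1)] xl yl) (use I st in auto)
    moreover have "(\<lambda>n. c * (y n - x n) powr \<alpha>) \<longlonglongrightarrow> c * (t - s) powr \<alpha>"
      using st by (intro tendsto_mult tendsto_const tendsto_powr tendsto_diff xl yl) auto
    ultimately show "norm (F t - F s) \<le> c * (t - s) powr \<alpha>"
      by (rule LIMSEQ_le) (use R x y xy I in auto)
  qed
qed auto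

text \<open>After the Cauchy criterion, tolerances \<open>1 / (j + 1)\<close> and rational times
  leave countably many conditions, each on finitely many \<open>Z i\<close>.\<close>

lemma measurable_holder_summable_schauder:
  fixes Z :: "nat \<Rightarrow> 'w \<Rightarrow> 'a::{real_normed_vector, polish_space}"
  assumes Z [measurable]: "\<And>n. Z n \<in> borel_measurable M" and \<alpha>: "0 < \<alpha>" "\<alpha> \<le> 1"
  shows "{\<omega> \<in> space M. holder_summable \<alpha> (\<lambda>n t. schauder n t *\<^sub>R Z n \<omega>)} \<in> sets M"
proof -
  have E2: "holder_summable \<alpha> (\<lambda>n t. schauder n t *\<^sub>R Z n \<omega>) \<longleftrightarrow>
    (\<forall>j::nat. \<exists>N. \<forall>m. \<forall>n. N \<le> m \<longrightarrow> m \<le> n \<longrightarrow> (\<forall>s\<in>\<rat>. \<forall>t\<in>\<rat>. 0 \<le> s \<longrightarrow> s < t \<longrightarrow> t \<le> 1 \<longrightarrow>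
      norm ((\<Sum>i\<in>{m..<n}. schauder i t *\<^sub>R Z i \<omega>) - (\<Sum>i\<in>{m..<n}. schauder i s *\<^sub>R Z i \<omega>)) \<le> inverse (real (Suc j)) * (t - s) powr \<alpha>))"
    for \<omega>
  proof -
    have E: "holder_norm \<alpha> (\<lambda>t. \<Sum>i\<in>{m..<n}. schauder i t *\<^sub>R Z i \<omega>) \<le> ennreal (inverse (real (Suc j))) \<longleftrightarrow>
        (\<forall>s\<in>\<rat>. \<forall>t\<in>\<rat>. 0 \<le> s \<longrightarrow> s < t \<longrightarrow> t \<le> 1 \<longrightarrow>
      norm ((\<Sum>i\<in>{m..<n}. schauder i t *\<^sub>R Z i \<omega>) - (\<Sum>i\<in>{m..<n}. schauder i s *\<^sub>R Z i \<omega>)) \<le> inverse (real (Suc j)) * (t - s) powr \<alpha>)" for j m n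
      by (subst holder_norm_le_iff, simp, rule holder_bound_rational)
        (auto intro!: continuous_intros continuous_on_schauder \<alpha>)
    have "holder_summable \<alpha> (\<lambda>n t. schauder n t *\<^sub>R Z n \<omega>) \<longleftrightarrow>
      (\<forall>e>0. \<exists>N. \<forall>m\<ge>N. \<forall>n\<ge>m. holder_norm \<alpha> (\<lambda>t. \<Sum>i\<in>{m..<n}. schauder i t *\<^sub>R Z i \<omega>) \<le> ennreal e)"
      by (rule holder_summable_iff_Cauchy) (use \<alpha> in \<open>auto intro: schauder_in_holder_space\<close>)
    also have "\<dots> \<longleftrightarrow> (\<forall>j. \<exists>N. \<forall>m\<ge>N. \<forall>n\<ge>m. holder_norm \<alpha> (\<lambda>t. \<Sum>i\<in>{m..<n}. schauder i t *\<^sub>R Z i \<omega>) \<le> ennreal (inverse (real (Suc j))))"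
    proof safe
      fix e :: real assume A: "\<forall>j. \<exists>N. \<forall>m\<ge>N. \<forall>n\<ge>m. holder_norm \<alpha> (\<lambda>t. \<Sum>i\<in>{m..<n}. schauder i t *\<^sub>R Z i \<omega>) \<le> ennreal (inverse (real (Suc j)))" "0 < e"
      then obtain j where "inverse (real (Suc j)) < e" using reals_Archimedean by blast
      hence "ennreal (inverse (real (Suc j))) \<le> ennreal e" by (intro ennreal_leI) auto
      thus "\<exists>N. \<forall>m\<ge>N. \<forall>n\<ge>m. holder_norm \<alpha> (\<lambda>t. \<Sum>i\<in>{m..<n}. schauder i t *\<^sub>R Z i \<omega>) \<le> ennreal e"
        using A(1) by (meson order_trans)
    qed auto
    finally show ?thesis unfolding E by blast
  qed
  have M2: "Measurable.pred M (\<lambda>\<omega>. \<forall>j::nat. \<exists>N. \<forall>m. \<forall>n. N \<le> m \<longrightarrow> m \<le> n \<longrightarrow> (\<forall>s\<in>\<rat>. \<forall>t\<in>\<rat>. 0 \<le> s \<longrightarrow> s < t \<longrightarrow> t \<le> 1 \<longrightarrow>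
      norm ((\<Sum>i\<in>{m..<n}. schauder i t *\<^sub>R Z i \<omega>) - (\<Sum>i\<in>{m..<n}. schauder i s *\<^sub>R Z i \<omega>)) \<le> inverse (real (Suc j)) * (t - s) powr \<alpha>))"
    by (rule pred_intros_countable pred_intros_imp' measurable_pred_countable(1)[OF countable_rat])+ measurable
  show ?thesis unfolding E2 using M2 by (simp only: pred_def)
qed

subsection \<open>Characteristic functionals on Hilbert spaces\<close>

text \<open>Levy's theorem speaks of probability measures. The total mass is the value at
  \<open>u = 0\<close>, so both measures are normalised by the same constant. Writing the product as
  \<open>u \<bullet> x\<close> gives the statement the shape it will have on
  \<open>H\<close>.\<close>

lemma real_finite_measure_char_unique:
  fixes \<mu> \<nu> :: "real measure"
  assumes "finite_measure \<mu>" "finite_measure \<nu>" and sets: "sets \<mu> = sets borel" "sets \<nu> = sets borel"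
    and char: "\<And>u. (LINT x|\<mu>. iexp (u \<bullet> x)) = (LINT x|\<nu>. iexp (u \<bullet> x))"
  shows "\<mu> = \<nu>"
proof -
  interpret \<mu>: finite_measure \<mu> by fact
  interpret \<nu>: finite_measure \<nu> by fact
  note [measurable_cong] = sets
  have sp: "space \<mu> = UNIV" "space \<nu> = UNIV" using sets[THEN sets_eq_imp_space_eq] by auto
  define c where "c = measure \<mu> UNIV"
  have c: "measure \<nu> UNIV = c" using char[of 0] sp by (simp add: c_def)
  have c0: "0 \<le> c" by (simp add: c_def)
  have em: "emeasure \<mu> UNIV = ennreal c" "emeasure \<nu> UNIV = ennreal c"
    using \<mu>.emeasure_eq_measure \<nu>.emeasure_eq_measure c by (simp_all add: c_def)
  show ?thesis
  proof (cases "c = 0")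
    case True
    have "emeasure \<mu> A = 0" "emeasure \<nu> A = 0" for A
      using emeasure_space[of \<mu> A] emeasure_space[of \<nu> A] em sp True by auto
    thus ?thesis by (intro measure_eqI) (auto simp: sets)
  next
    case False
    hence cp: "0 < c" using c0 by simp
    have scaled: "real_distribution (density M (\<lambda>_. ennreal (1 / c)))"
      if "sets M = sets borel" "emeasure M UNIV = ennreal c" for M :: "real measure"
      unfolding real_distribution_def real_distribution_axioms_def
    proof (intro conjI prob_spaceI)
      have "space M = UNIV" using sets_eq_imp_space_eq[OF that(1)] by simp
      thus "emeasure (density M (\<lambda>_. ennreal (1 / c))) (space (density M (\<lambda>_. ennreal (1 / c)))) = 1"
        using that(2) cp by (simp add: emeasure_density_const that(1) ennreal_mult[symmetric])
    qed (simp add: that(1))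
    have "density \<mu> (\<lambda>_. ennreal (1 / c)) = density \<nu> (\<lambda>_. ennreal (1 / c))"
    proof (rule Levy_uniqueness)
      show "char (density \<mu> (\<lambda>_. ennreal (1 / c))) = char (density \<nu> (\<lambda>_. ennreal (1 / c)))"
        using cp char by (auto simp: char_def integral_density fun_eq_iff inner_real_def)
    qed (use scaled sets em in auto)
    hence "ennreal (1 / c) * emeasure \<mu> A = ennreal (1 / c) * emeasure \<nu> A" if "A \<in> sets borel" for A
      using that emeasure_density_const[of A \<mu> "ennreal (1 / c)"] emeasure_density_const[of A \<nu> "ennreal (1 / c)"]
      by (simp add: sets)
    thus ?thesis using cp
      by (intro measure_eqI) (auto simp: sets ennreal_mult_cancel_left)
  qed
qed

lemma iexp_integrable:
  assumes "finite_measure M" "X \<in> borel_measurable M"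
  shows "integrable M (\<lambda>\<omega>. iexp (h \<bullet> (X \<omega> :: 'h::{real_inner, second_countable_topology})))"
proof -
  interpret finite_measure M by fact
  have [measurable]: "X \<in> borel_measurable M" by fact
  show ?thesis by (rule integrable_const_bound[where B = 1]) auto
qed

text \<open>Deliberately not normalised: a density such as \<open>1 + Re g\<close> has a total mass
  depending on \<open>g\<close>, which is why uniqueness is wanted for all finite measures.\<close>

definition weighted_law :: "'k measure \<Rightarrow> ('k \<Rightarrow> 'h::real_normed_vector) \<Rightarrow> ('k \<Rightarrow> real) \<Rightarrow> 'h measure" where
  "weighted_law K V w = distr (density K (\<lambda>\<omega>. ennreal (w \<omega>))) borel V"

lemma sets_weighted_law: "sets (weighted_law K V w) = sets borel"
  by (simp add: weighted_law_def)

context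
  fixes K :: "'k measure" and V :: "'k \<Rightarrow> 'h::{real_inner, second_countable_topology}"
  assumes K: "finite_measure K" and V [measurable]: "V \<in> borel_measurable K"
begin

interpretation K: finite_measure K by (rule K)

lemma finite_measure_weighted_law:
  assumes [measurable]: "w \<in> borel_measurable K" and w: "\<And>x. 0 \<le> w x" "\<And>x. w x \<le> c"
  shows "finite_measure (weighted_law K V w)"
proof -
  have "integrable K w" by (rule K.integrable_const_bound[where B = c]) (use w in auto)
  hence "finite_measure (density K (\<lambda>\<omega>. ennreal (w \<omega>)))"
    using w by (intro finite_measureI) (auto simp: emeasure_density nn_integral_eq_integral cong: nn_integral_cong_simp)
  thus ?thesis
    unfolding weighted_law_def by (rule finite_measure.finite_measure_distr) simp
qed

lemma char_weighted_law:
  assumes [measurable]: "w \<in> borel_measurable K" and w: "\<And>x. 0 \<le> w x"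
  shows "(LINT x|weighted_law K V w. iexp (h \<bullet> x)) = (LINT \<omega>|K. w \<omega> *\<^sub>R iexp (h \<bullet> V \<omega>))"
  unfolding weighted_law_def by (subst integral_distr) (use w in \<open>auto simp: integral_density\<close>)

lemma measure_weighted_law:
  assumes [measurable]: "w \<in> borel_measurable K" "B \<in> sets borel" and w: "\<And>x. 0 \<le> w x"
  shows "measure (weighted_law K V w) B = (LINT \<omega>|K. indicator B (V \<omega>) * w \<omega>)"
proof -
  have "measure (weighted_law K V w) B = (LINT x|weighted_law K V w. indicator B x)"
    by (simp add: weighted_law_def)
  also have "\<dots> = (LINT \<omega>|K. w \<omega> *\<^sub>R indicator B (V \<omega>))"
    unfolding weighted_law_def by (subst integral_distr) (use w in \<open>auto simp: integral_density\<close>)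
  finally show ?thesis by (simp add: mult.commute)
qed

text \<open>\<open>Re f\<close> is half of \<open>f + cnj f\<close>, and the conjugate is moved onto
  the exponential by replacing \<open>h\<close> with \<open>- h\<close>. So the functional of the
  weighted law is determined by the integrals of exponentials with weights \<open>1\<close> and
  \<open>f\<close>.\<close>

lemma integral_Re_weight_iexp:
  fixes f :: "'k \<Rightarrow> complex"
  assumes f_meas [measurable]: "f \<in> borel_measurable K" and f: "\<And>x. norm (f x) \<le> 1"
  shows "(LINT \<omega>|K. (1 + Re (f \<omega>)) *\<^sub>R iexp (h \<bullet> V \<omega>)) = (LINT \<omega>|K. iexp (h \<bullet> V \<omega>)) +
       ((LINT \<omega>|K. iexp (h \<bullet> V \<omega>) * f \<omega>) + cnj (LINT \<omega>|K. iexp ((- h) \<bullet> V \<omega>) * f \<omega>)) / 2"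
proof -
  have i: "integrable K (\<lambda>\<omega>. iexp (u \<bullet> V \<omega>) * f \<omega>)" for u
    by (rule K.integrable_const_bound[where B = 1]) (use f in \<open>auto simp: norm_mult\<close>)
  have e: "(1 + Re (f \<omega>)) *\<^sub>R iexp (h \<bullet> V \<omega>) = iexp (h \<bullet> V \<omega>) +
         (iexp (h \<bullet> V \<omega>) * f \<omega> + cnj (iexp ((- h) \<bullet> V \<omega>) * f \<omega>)) / 2" for \<omega>
  proof -
    have 1: "cnj (iexp ((- h) \<bullet> V \<omega>)) = iexp (h \<bullet> V \<omega>)" by (simp add: exp_cnj)
    have 2: "iexp (h \<bullet> V \<omega>) * f \<omega> + iexp (h \<bullet> V \<omega>) * cnj (f \<omega>) = iexp (h \<bullet> V \<omega>) * (2 * complex_of_real (Re (f \<omega>)))"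
      unfolding distrib_left[symmetric] by (simp add: complex_add_cnj)
    show ?thesis unfolding complex_cnj_mult 1 2 by (simp add: scaleR_conv_of_real algebra_simps)
  qed
  show ?thesis unfolding e integral_cnj[symmetric]
    using i[of h] i[of "- h"] iexp_integrable[OF K V, of h]
    by (subst Bochner_Integration.integral_add) (auto simp del: complex_cnj_mult)
qed

text \<open>Subtracting the unweighted law removes the 1 that keeps the density nonnegative.\<close>

lemma integral_Re_weight_indicator:
  fixes f :: "'k \<Rightarrow> complex"
  assumes f_meas [measurable]: "f \<in> borel_measurable K" and f: "\<And>x. norm (f x) \<le> 1"
    and A [measurable]: "A \<in> sets borel"
  shows "(LINT \<omega>|K. indicator A (V \<omega>) * Re (f \<omega>)) =
    measure (weighted_law K V (\<lambda>\<omega>. 1 + Re (f \<omega>))) A - measure (weighted_law K V (\<lambda>_. 1)) A"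
proof -
  have f': "\<bar>Re (f x)\<bar> \<le> 1" for x using abs_Re_le_cmod[of "f x"] f[of x] by linarith
  hence w: "0 \<le> 1 + Re (f x)" for x using f'[of x] by linarith
  have "integrable K (\<lambda>\<omega>. indicator A (V \<omega>) * Re (f \<omega>))" "integrable K (\<lambda>\<omega>. indicator A (V \<omega>) :: real)"
    using f' by (auto intro!: K.integrable_const_bound[where B = 1] simp: indicator_def)
  thus ?thesis
    by (subst (1 2) measure_weighted_law) (auto simp: w distrib_left)
qed

lemma integral_indicator_mult_Re_Im:
  fixes f :: "'k \<Rightarrow> complex"
  assumes f_meas [measurable]: "f \<in> borel_measurable K" and f: "\<And>x. norm (f x) \<le> 1"
    and A [measurable]: "A \<in> sets borel"
  shows "Re (LINT \<omega>|K. indicator A (V \<omega>) * f \<omega>) = (LINT \<omega>|K. indicator A (V \<omega>) * Re (f \<omega>))"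
    and "Im (LINT \<omega>|K. indicator A (V \<omega>) * f \<omega>) = (LINT \<omega>|K. indicator A (V \<omega>) * Im (f \<omega>))"
proof -
  have i: "integrable K (\<lambda>\<omega>. indicator A (V \<omega>) * f \<omega>)"
    by (rule K.integrable_const_bound[where B = 1]) (use f in \<open>auto simp: indicator_def\<close>)
  have [simp]: "Re (indicator A y) = indicator A y" "Im (indicator A y) = 0" for y
    by (auto simp: indicator_def)
  show "Re (LINT \<omega>|K. indicator A (V \<omega>) * f \<omega>) = (LINT \<omega>|K. indicator A (V \<omega>) * Re (f \<omega>))"
    using integral_Re[OF i] by simp
  show "Im (LINT \<omega>|K. indicator A (V \<omega>) * f \<omega>) = (LINT \<omega>|K. indicator A (V \<omega>) * Im (f \<omega>))"
    using integral_Im[OF i] by simp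
qed

end

text \<open>
  Adding \<open>1\<close> to the real part of a bounded weight gives a density, to which uniqueness for
  finite measures applies. The hypothesis \<open>unique\<close> makes the argument available both for \<open>\<real>\<close>,
  where it serves to prove uniqueness on \<open>H\<close>, and then for \<open>H\<close> itself.
\<close>

lemma weighted_char_unique:
  fixes X :: "'m \<Rightarrow> 'h::{real_inner, second_countable_topology}" and Y :: "'n \<Rightarrow> 'h"
    and g :: "'m \<Rightarrow> complex" and g' :: "'n \<Rightarrow> complex"
  assumes unique: "\<And>\<mu> \<nu> :: 'h measure. finite_measure \<mu> \<Longrightarrow> finite_measure \<nu> \<Longrightarrow>
      sets \<mu> = sets borel \<Longrightarrow> sets \<nu> = sets borel \<Longrightarrow>
      (\<And>h. (LINT x|\<mu>. iexp (h \<bullet> x)) = (LINT x|\<nu>. iexp (h \<bullet> x))) \<Longrightarrow> \<mu> = \<nu>"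
    and M: "finite_measure M" and N: "finite_measure N"
    and X: "X \<in> borel_measurable M" and Y: "Y \<in> borel_measurable N"
    and g: "g \<in> borel_measurable M" and g': "g' \<in> borel_measurable N"
    and g1: "\<And>x. norm (g x) \<le> 1" and g'1: "\<And>x. norm (g' x) \<le> 1"
    and eq: "\<And>h. (LINT \<omega>|M. iexp (h \<bullet> X \<omega>)) = (LINT \<omega>|N. iexp (h \<bullet> Y \<omega>))"
    and eqg: "\<And>h. (LINT \<omega>|M. iexp (h \<bullet> X \<omega>) * g \<omega>) = (LINT \<omega>|N. iexp (h \<bullet> Y \<omega>) * g' \<omega>)"
    and A: "A \<in> sets borel"
  shows "(LINT \<omega>|M. indicator A (X \<omega>) * g \<omega>) = (LINT \<omega>|N. indicator A (Y \<omega>) * g' \<omega>)"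
proof -
  have re: "(LINT \<omega>|M. indicator A (X \<omega>) * Re (g \<omega>)) = (LINT \<omega>|N. indicator A (Y \<omega>) * Re (g' \<omega>))"
    if g [measurable]: "g \<in> borel_measurable M" and g' [measurable]: "g' \<in> borel_measurable N"
      and g1: "\<And>x. norm (g x) \<le> 1" and g'1: "\<And>x. norm (g' x) \<le> 1"
      and eqg: "\<And>h. (LINT \<omega>|M. iexp (h \<bullet> X \<omega>) * g \<omega>) = (LINT \<omega>|N. iexp (h \<bullet> Y \<omega>) * g' \<omega>)"
    for g g'
  proof -
    have w: "0 \<le> 1 + Re (g x)" "1 + Re (g x) \<le> 2" "0 \<le> 1 + Re (g' y)" "1 + Re (g' y) \<le> 2" for x y
      using abs_Re_le_cmod[of "g x"] abs_Re_le_cmod[of "g' y"] g1[of x] g'1[of y] by linarith+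
    have L: "weighted_law M X (\<lambda>_. 1) = weighted_law N Y (\<lambda>_. 1)"
    proof (rule unique)
      show "finite_measure (weighted_law M X (\<lambda>_. 1))" by (rule finite_measure_weighted_law[OF M X, of _ 1]) auto
      show "finite_measure (weighted_law N Y (\<lambda>_. 1))" by (rule finite_measure_weighted_law[OF N Y, of _ 1]) auto
      show "(LINT x|weighted_law M X (\<lambda>_. 1). iexp (h \<bullet> x)) = (LINT x|weighted_law N Y (\<lambda>_. 1). iexp (h \<bullet> x))" for h
        using eq by (simp add: char_weighted_law[OF M X] char_weighted_law[OF N Y])
    qed (auto simp: sets_weighted_law)
    have Lg: "weighted_law M X (\<lambda>\<omega>. 1 + Re (g \<omega>)) = weighted_law N Y (\<lambda>\<omega>. 1 + Re (g' \<omega>))"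
    proof (rule unique)
      show "finite_measure (weighted_law M X (\<lambda>\<omega>. 1 + Re (g \<omega>)))"
        by (rule finite_measure_weighted_law[OF M X, of _ 2]) (auto simp: w)
      show "finite_measure (weighted_law N Y (\<lambda>\<omega>. 1 + Re (g' \<omega>)))"
        by (rule finite_measure_weighted_law[OF N Y, of _ 2]) (auto simp: w)
      have "(LINT x|weighted_law M X (\<lambda>\<omega>. 1 + Re (g \<omega>)). iexp (h \<bullet> x)) = (LINT \<omega>|M. (1 + Re (g \<omega>)) *\<^sub>R iexp (h \<bullet> X \<omega>))" for h
        by (rule char_weighted_law[OF M X]) (auto simp: w)
      moreover have "(LINT x|weighted_law N Y (\<lambda>\<omega>. 1 + Re (g' \<omega>)). iexp (h \<bullet> x)) = (LINT \<omega>|N. (1 + Re (g' \<omega>)) *\<^sub>R iexp (h \<bullet> Y \<omega>))" for h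
        by (rule char_weighted_law[OF N Y]) (auto simp: w)
      ultimately show "(LINT x|weighted_law M X (\<lambda>\<omega>. 1 + Re (g \<omega>)). iexp (h \<bullet> x)) = (LINT x|weighted_law N Y (\<lambda>\<omega>. 1 + Re (g' \<omega>)). iexp (h \<bullet> x))" for h
        by (simp only: integral_Re_weight_iexp[OF M X g g1] integral_Re_weight_iexp[OF N Y g' g'1] eq eqg)
    qed (auto simp: sets_weighted_law)
    show ?thesis
      unfolding integral_Re_weight_indicator[OF M X g g1 A] integral_Re_weight_indicator[OF N Y g' g'1 A] L Lg ..
  qed
  \<comment> \<open>Imaginary parts reduce to real parts: \<open>Re (- \<i> * g)\<close> is
    \<open>Im g\<close>, and the factor \<open>- \<i>\<close> preserves all hypotheses on the
    weights.\<close>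
  have "(LINT \<omega>|M. indicator A (X \<omega>) * Re (- \<i> * g \<omega>)) = (LINT \<omega>|N. indicator A (Y \<omega>) * Re (- \<i> * g' \<omega>))"
  proof (rule re)
    fix h
    have "(LINT \<omega>|M. - \<i> * (iexp (h \<bullet> X \<omega>) * g \<omega>)) = (LINT \<omega>|N. - \<i> * (iexp (h \<bullet> Y \<omega>) * g' \<omega>))"
      using eqg by (simp only: integral_mult_right_zero)
    thus "(LINT \<omega>|M. iexp (h \<bullet> X \<omega>) * (- \<i> * g \<omega>)) = (LINT \<omega>|N. iexp (h \<bullet> Y \<omega>) * (- \<i> * g' \<omega>))"
      by (simp only: mult.left_commute[of "- \<i>"])
  qed (use g g' g1 g'1 in \<open>auto simp: norm_mult\<close>)
  hence im: "(LINT \<omega>|M. indicator A (X \<omega>) * Im (g \<omega>)) = (LINT \<omega>|N. indicator A (Y \<omega>) * Im (g' \<omega>))"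
    by simp
  show ?thesis
    unfolding complex_eq_iff integral_indicator_mult_Re_Im[OF M X g g1 A] integral_indicator_mult_Re_Im[OF N Y g' g'1 A]
    using re[OF g g' g1 g'1 eqg] im by simp
qed

section \<open>Cylinder sets generate the Borel sets\<close>

lemma open_countable_Union_cball:
  fixes U :: "'a::{metric_space, second_countable_topology} set"
  assumes D: "\<And>X. open X \<Longrightarrow> X \<noteq> {} \<Longrightarrow> \<exists>d\<in>D. d \<in> (X :: 'a set)" and U: "open U"
  shows "U = (\<Union>(d, q)\<in>{(d, q). d \<in> D \<and> q \<in> \<rat> \<and> cball d q \<subseteq> U}. cball d q)"
proof (intro equalityI subsetI)
  fix x assume "x \<in> U"
  then obtain e where e: "0 < e" "cball x e \<subseteq> U" using U open_contains_cball by blast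
  obtain q where q: "q \<in> \<rat>" "0 < q" "q < e / 2" using Rats_dense_in_real[of 0 "e / 2"] e by auto
  obtain d where d: "d \<in> D" "d \<in> ball x q" using D[of "ball x q"] q by auto
  have "cball d q \<subseteq> cball x e"
  proof
    fix y assume "y \<in> cball d q"
    thus "y \<in> cball x e" using d q dist_triangle[of x y d] by auto
  qed
  hence "cball d q \<subseteq> U" using e by blast
  moreover have "x \<in> cball d q" using d by (simp add: dist_commute)
  ultimately show "x \<in> (\<Union>(d, q)\<in>{(d, q). d \<in> D \<and> q \<in> \<rat> \<and> cball d q \<subseteq> U}. cball d q)"
    using d(1) q(1) by blast
qed auto

text \<open>For \<open>x\<close> outside the ball the direction \<open>x - d\<close> separates
  strictly. Strict separation is an open condition on the direction, so some member of the dense set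
  \<open>D\<close> separates as well.\<close>

lemma cball_eq_Inter_halfspaces:
  fixes d :: "'a::real_inner"
  assumes D: "\<And>X. open X \<Longrightarrow> X \<noteq> {} \<Longrightarrow> \<exists>d\<in>D. d \<in> (X :: 'a set)" and r: "0 \<le> r"
  shows "cball d r = (\<Inter>h\<in>D. {x. h \<bullet> x \<le> h \<bullet> d + r * norm h})"
proof (intro equalityI subsetI)
  fix x assume x: "x \<in> cball d r"
  have "h \<bullet> x \<le> h \<bullet> d + r * norm h" for h
  proof -
    have "h \<bullet> (x - d) \<le> norm h * norm (x - d)" by (rule norm_cauchy_schwarz)
    also have "\<dots> \<le> norm h * r" using x by (intro mult_left_mono) (auto simp: dist_norm norm_minus_commute)
    finally show ?thesis by (simp add: inner_diff_right mult.commute)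
  qed
  thus "x \<in> (\<Inter>h\<in>D. {x. h \<bullet> x \<le> h \<bullet> d + r * norm h})" by blast
next
  fix x assume x: "x \<in> (\<Inter>h\<in>D. {x. h \<bullet> x \<le> h \<bullet> d + r * norm h})"
  show "x \<in> cball d r"
  proof (rule ccontr)
    assume "x \<notin> cball d r"
    hence n: "r < norm (x - d)" by (simp add: dist_norm norm_minus_commute)
    let ?X = "{h. r * norm h < h \<bullet> (x - d)}"
    have "open ?X" by (intro open_Collect_less continuous_intros)
    moreover have "r * norm (x - d) < norm (x - d) * norm (x - d)"
      using n r by (intro mult_strict_right_mono) auto
    hence "x - d \<in> ?X" by (simp add: dot_square_norm power2_eq_square)
    ultimately obtain h where "h \<in> D" "r * norm h < h \<bullet> (x - d)" using D[of ?X] by blast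
    thus False using x by (auto simp: inner_diff_right dest!: bspec[of _ _ h])
  qed
qed

text \<open>Constraints form a list so that an intersection of cylinders is an appended list and an
  induction can strip one constraint at a time; the empty list gives the whole space.\<close>

definition cylinder :: "('a::real_inner \<times> real set) list \<Rightarrow> 'a set" where
  "cylinder L = (\<Inter>(e, B)\<in>set L. {x. e \<bullet> x \<in> B})"

definition cylinders :: "'a::real_inner set set" where
  "cylinders = {cylinder L | L. \<forall>(e, B)\<in>set L. B \<in> sets borel}"

lemma cylinder_in_borel:
  fixes L :: "('a::{real_inner, second_countable_topology} \<times> real set) list"
  assumes L: "\<forall>(e, B)\<in>set L. B \<in> sets borel"
  shows "cylinder L \<in> sets borel"
proof -
  have "{x. e \<bullet> x \<in> B} \<in> sets borel" if "(e, B) \<in> set L" for e :: 'a and B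
  proof -
    have [measurable]: "B \<in> sets borel" using L that by auto
    have "(\<lambda>x. e \<bullet> x) -` B \<inter> space borel \<in> sets borel" by measurable
    thus ?thesis by (simp add: vimage_def)
  qed
  thus ?thesis unfolding cylinder_def by (intro sets.countable_INT'') (auto intro: countable_finite)
qed

text \<open>Half-spaces are cylinders with one constraint. Countable intersections of them give
  closed balls, and countable unions of closed balls give open sets.\<close>

lemma sets_borel_cylinders:
  "sets (borel :: 'a::{real_inner, second_countable_topology} measure) = sigma_sets UNIV cylinders"
proof
  have "cylinders \<subseteq> sets (borel :: 'a measure)"
    unfolding cylinders_def by (blast intro: cylinder_in_borel)
  from sets.sigma_sets_subset[OF this] show "sigma_sets UNIV cylinders \<subseteq> sets (borel :: 'a measure)"
    by simp
next
  let ?S = "sigma UNIV (cylinders :: 'a set set)"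
  have S: "sets ?S = sigma_sets UNIV cylinders" by (intro sets_measure_of) auto
  obtain D :: "'a set" where D: "countable D" "\<And>X. open X \<Longrightarrow> X \<noteq> {} \<Longrightarrow> \<exists>d\<in>D. d \<in> X"
    using countable_dense_setE by blast
  have half: "{x. h \<bullet> x \<le> c} \<in> sets ?S" for h :: 'a and c
  proof -
    have "{x. h \<bullet> x \<le> c} = cylinder [(h, {..c})]" by (auto simp: cylinder_def)
    also have "\<dots> \<in> cylinders" unfolding cylinders_def by (intro CollectI exI[of _ "[(h, {..c})]"]) auto
    finally show ?thesis unfolding S by (rule sigma_sets.Basic)
  qed
  have cb: "cball d r \<in> sets ?S" for d :: 'a and r
  proof (cases "0 \<le> r")
    case True
    have eq: "cball d r = (\<Inter>h\<in>D. {x. h \<bullet> x \<le> h \<bullet> d + r * norm h})"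
      by (rule cball_eq_Inter_halfspaces) (use D(2) True in auto)
    show ?thesis unfolding eq
      by (intro sets.countable_INT'' D half) (use sets.top[of ?S] in simp)
  qed (auto simp: not_le intro: sigma_sets.Empty)
  have op: "U \<in> sets ?S" if "open U" for U :: "'a set"
  proof -
    have cnt: "countable {(d, q). d \<in> D \<and> q \<in> \<rat> \<and> cball d q \<subseteq> U}"
      by (rule countable_subset[of _ "D \<times> \<rat>"]) (auto intro: D countable_rat)
    have eq: "U = (\<Union>(d, q)\<in>{(d, q). d \<in> D \<and> q \<in> \<rat> \<and> cball d q \<subseteq> U}. cball d q)"
      by (rule open_countable_Union_cball) (use D(2) that in auto)
    have "(\<Union>(d, q)\<in>C. cball d q) \<in> sets ?S" if "countable C" for C :: "('a \<times> real) set"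
      using that by (intro sets.countable_UN'') (auto intro: cb[unfolded S])
    from this[OF cnt] show ?thesis by (simp only: eq[symmetric])
  qed
  have "sigma_sets UNIV (Collect open) \<subseteq> sets ?S"
    using sets.sigma_sets_subset[of "Collect open" ?S] op by auto
  thus "sets (borel :: 'a measure) \<subseteq> sigma_sets UNIV cylinders"
    unfolding S borel_def by (subst sets_measure_of) auto
qed

text \<open>Both measures are restricted to the first constraint of a cylinder, and the induction
  hypothesis is applied to the restrictions. Their functionals still agree by exchanging exponential
  for indicator on the real line, in the direction \<open>e\<close>. Restricting changes the
  measures and their mass, so the induction runs over all pairs of finite measures.\<close>

theorem finite_measure_char_unique:
  fixes \<mu> \<nu> :: "'a::{real_inner, second_countable_topology} measure"
  assumes "finite_measure \<mu>" "finite_measure \<nu>" "sets \<mu> = sets borel" "sets \<nu> = sets borel"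
    and "\<And>h. (LINT x|\<mu>. iexp (h \<bullet> x)) = (LINT x|\<nu>. iexp (h \<bullet> x))"
  shows "\<mu> = \<nu>"
proof -
  have cyl: "emeasure \<mu> (cylinder L) = emeasure \<nu> (cylinder L)"
    if "\<forall>(e, B)\<in>set L. B \<in> sets borel" "finite_measure \<mu>" "finite_measure \<nu>"
      "sets \<mu> = sets borel" "sets \<nu> = sets borel"
      "\<And>h. (LINT x|\<mu>. iexp (h \<bullet> x)) = (LINT x|\<nu>. iexp (h \<bullet> x))"
    for L and \<mu> \<nu> :: "'a measure"
    using that
  proof (induction L arbitrary: \<mu> \<nu>)
    case Nil
    interpret \<mu>: finite_measure \<mu> by fact
    interpret \<nu>: finite_measure \<nu> by fact
    have sp: "space \<mu> = UNIV" "space \<nu> = UNIV" using Nil(4,5)[THEN sets_eq_imp_space_eq] by auto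
    have "measure \<mu> UNIV = measure \<nu> UNIV" using Nil(6)[of 0] sp by simp
    thus ?case using \<mu>.emeasure_eq_measure \<nu>.emeasure_eq_measure by (simp add: cylinder_def)
  next
    case (Cons eB L)
    obtain e B where eB: "eB = (e, B)" by force
    have B [measurable]: "B \<in> sets borel" using Cons.prems(1) eB by auto
    note fin = Cons.prems(2,3) and [measurable_cong] = Cons.prems(4,5)
    interpret \<mu>: finite_measure \<mu> by (rule fin)
    interpret \<nu>: finite_measure \<nu> by (rule fin)
    define w where "w x = (indicator B (e \<bullet> x) :: real)" for x
    have [measurable]: "w \<in> borel_measurable borel" unfolding w_def by measurable
    have w01: "0 \<le> w x" for x by (simp add: w_def)
    let ?d = "\<lambda>m. density m (\<lambda>x. ennreal (w x))"
    have fd: "finite_measure (?d m)" if "finite_measure m" and [measurable_cong]: "sets m = sets borel" for m :: "'a measure"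
    proof -
      interpret m: finite_measure m by fact
      have "integrable m w" by (rule m.integrable_const_bound[where B = 1]) (auto simp: w_def indicator_def)
      thus ?thesis using w01
        by (intro finite_measureI) (auto simp: emeasure_density nn_integral_eq_integral cong: nn_integral_cong_simp)
    qed
    have char: "(LINT x|?d \<mu>. iexp (h \<bullet> x)) = (LINT x|?d \<nu>. iexp (h \<bullet> x))" for h
    proof -
      \<comment> \<open>Here \<open>iexp (h \<bullet> x)\<close> is the weight and
        \<open>e \<bullet> x\<close> the real variable; the two required equalities are the
        hypothesis at \<open>u *\<^sub>R e\<close> and at \<open>u *\<^sub>R e + h\<close>.\<close>
      have "(LINT x|\<mu>. indicator B (e \<bullet> x) * iexp (h \<bullet> x)) = (LINT x|\<nu>. indicator B (e \<bullet> x) * iexp (h \<bullet> x))"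
      proof (rule weighted_char_unique[OF real_finite_measure_char_unique fin])
        fix u :: real
        show "(LINT x|\<mu>. iexp (u \<bullet> (e \<bullet> x))) = (LINT x|\<nu>. iexp (u \<bullet> (e \<bullet> x)))"
          using Cons.prems(6)[of "u *\<^sub>R e"] by simp
        show "(LINT x|\<mu>. iexp (u \<bullet> (e \<bullet> x)) * iexp (h \<bullet> x)) = (LINT x|\<nu>. iexp (u \<bullet> (e \<bullet> x)) * iexp (h \<bullet> x))"
          using Cons.prems(6)[of "u *\<^sub>R e + h"] by (simp add: inner_add_left distrib_left exp_add)
      qed (auto simp: B)
      moreover have "w x *\<^sub>R z = indicator B (e \<bullet> x) * z" for x and z :: complex
        by (auto simp: w_def indicator_def)
      ultimately show ?thesis using w01 by (simp add: integral_density)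
    qed
    have IH: "emeasure (?d \<mu>) (cylinder L) = emeasure (?d \<nu>) (cylinder L)"
    proof (rule Cons.IH)
      show "\<forall>(e, B)\<in>set L. B \<in> sets borel" using Cons.prems(1) by simp
      show "finite_measure (?d \<mu>)" "finite_measure (?d \<nu>)"
        by (rule fd[OF fin(1) Cons.prems(4)], rule fd[OF fin(2) Cons.prems(5)])
      show "sets (?d \<mu>) = sets borel" "sets (?d \<nu>) = sets borel"
        by (simp_all add: Cons.prems(4,5))
    qed (rule char)
    have cs: "cylinder L \<in> sets borel"
      using Cons.prems(1) by (intro cylinder_in_borel) auto
    have "emeasure (?d m) (cylinder L) = emeasure m (cylinder (eB # L))"
      if [measurable_cong]: "sets m = sets borel" for m :: "'a measure"
    proof -
      have "cylinder (eB # L) \<in> sets borel"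
        using Cons.prems(1) by (intro cylinder_in_borel)
      have "emeasure (?d m) (cylinder L) = (\<integral>\<^sup>+x. ennreal (w x) * indicator (cylinder L) x \<partial>m)"
        using cs that by (intro emeasure_density) auto
      also have "\<dots> = (\<integral>\<^sup>+x. indicator (cylinder (eB # L)) x \<partial>m)"
        by (intro nn_integral_cong) (auto simp: w_def cylinder_def eB indicator_def)
      also have "\<dots> = emeasure m (cylinder (eB # L))"
        using \<open>cylinder (eB # L) \<in> sets borel\<close> that by simp
      finally show ?thesis .
    qed
    thus ?case using IH Cons.prems(4,5) by simp
  qed
  interpret \<mu>: finite_measure \<mu> by fact
  show ?thesis
  proof (rule measure_eqI_generator_eq[where E = cylinders and \<Omega> = UNIV and A = "\<lambda>_. UNIV"])
    show "Int_stable (cylinders :: 'a set set)"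
    proof (rule Int_stableI)
      fix a b :: "'a set" assume "a \<in> cylinders" "b \<in> cylinders"
      then obtain L L' where L: "a = cylinder L" "\<forall>(e, B)\<in>set L. B \<in> sets borel"
         "b = cylinder L'" "\<forall>(e, B)\<in>set L'. B \<in> sets borel" unfolding cylinders_def by blast
      thus "a \<inter> b \<in> cylinders" unfolding cylinders_def
        by (intro CollectI exI[of _ "L @ L'"]) (auto simp: cylinder_def)
    qed
    show "emeasure \<mu> X = emeasure \<nu> X" if "X \<in> cylinders" for X
    proof -
      from that obtain L where L: "X = cylinder L" "\<forall>(e, B)\<in>set L. B \<in> sets borel"
        unfolding cylinders_def by blast
      show ?thesis unfolding L(1) by (rule cyl[OF L(2) assms])
    qed
    show "range (\<lambda>_. UNIV) \<subseteq> (cylinders :: 'a set set)"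
      unfolding cylinders_def by (auto intro!: exI[of _ "[]"] simp: cylinder_def)
    show "sets \<mu> = sigma_sets UNIV cylinders" "sets \<nu> = sigma_sets UNIV cylinders"
      using assms(3,4) sets_borel_cylinders by auto
  qed auto
qed

section \<open>Independence from factorization\<close>

text \<open>When index \<open>k\<close> is treated, the rest of the product is a bounded weight
  \<open>g\<close>. It is compared with a constant weight \<open>c\<close> over the same variable
  \<open>X k\<close>; equality of the two weighted functionals is the factorization already known,
  and the exchange turns it into factorization for an indicator of \<open>X k\<close>.\<close>

lemma (in prob_space) indep_vars_if_char_factorizes:
  fixes X :: "'i \<Rightarrow> 'a \<Rightarrow> 'h::{real_inner, second_countable_topology}"
  assumes I: "finite I" and X: "\<And>i. i \<in> I \<Longrightarrow> X i \<in> borel_measurable M"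
    and fact: "\<And>h. (LINT \<omega>|M. (\<Prod>i\<in>I. iexp (h i \<bullet> X i \<omega>))) = (\<Prod>i\<in>I. LINT \<omega>|M. iexp (h i \<bullet> X i \<omega>))"
  shows "indep_vars (\<lambda>_. borel) X I"
proof -
  have fm: "finite_measure M" by unfold_locales
  have ind: "(LINT \<omega>|M. indicator B \<omega>) = complex_of_real (prob B)" if "B \<in> events" for B
  proof -
    have "(indicator B \<omega> :: complex) = complex_of_real (indicator B \<omega>)" for \<omega>
      by (simp add: indicator_def)
    thus ?thesis using that sets.sets_into_space[OF that] by (simp add: Int_absorb2)
  qed
  have char1: "norm (LINT \<omega>|M. iexp (h \<bullet> X i \<omega>)) \<le> 1" if "i \<in> I" for i h
  proof -
    have "norm (LINT \<omega>|M. iexp (h \<bullet> X i \<omega>)) \<le> (LINT \<omega>|M. norm (iexp (h \<bullet> X i \<omega>)))"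
      by (rule integral_norm_bound)
    thus ?thesis by (simp add: prob_space)
  qed
  \<comment> \<open>Indices in \<open>J\<close> have already been exchanged. \<open>h\<close> stays
    arbitrary in the induction because the step for \<open>k\<close> needs the claim at
    \<open>h(k := h0)\<close> for every \<open>h0\<close>.\<close>
  have mixed: "(LINT \<omega>|M. (\<Prod>j\<in>J. indicator (A j) (X j \<omega>)) * (\<Prod>i\<in>I - J. iexp (h i \<bullet> X i \<omega>))) =
      (\<Prod>j\<in>J. complex_of_real (prob (X j -` A j \<inter> space M))) * (\<Prod>i\<in>I - J. LINT \<omega>|M. iexp (h i \<bullet> X i \<omega>))"
    if "J \<subseteq> I" and A: "\<And>j. j \<in> J \<Longrightarrow> A j \<in> sets borel" for J A h
  proof -
    have "finite J" using that I finite_subset by blast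
    thus ?thesis using that
    proof (induction J arbitrary: h rule: finite_induct)
      case empty
      show ?case using fact[of h] by simp
    next
      case (insert k J)
      have k: "k \<in> I" and J: "J \<subseteq> I" "k \<notin> J" using insert by auto
      have [measurable]: "X k \<in> borel_measurable M" "A k \<in> sets borel" using X k insert.prems by auto
      have Xm: "X j \<in> borel_measurable M" if "j \<in> I" for j using X that .
      have Am: "A j \<in> sets borel" if "j \<in> J" for j using insert.prems that by auto
      let ?K = "I - insert k J"
      define g where "g \<omega> = (\<Prod>j\<in>J. indicator (A j) (X j \<omega>)) * (\<Prod>i\<in>?K. iexp (h i \<bullet> X i \<omega>))" for \<omega>
      define c where "c = (\<Prod>j\<in>J. complex_of_real (prob (X j -` A j \<inter> space M))) * (\<Prod>i\<in>?K. LINT \<omega>|M. iexp (h i \<bullet> X i \<omega>))"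
      have gm: "g \<in> borel_measurable M"
        unfolding g_def
      proof (intro borel_measurable_times borel_measurable_prod)
        fix j assume j: "j \<in> J"
        have [measurable]: "X j \<in> borel_measurable M" "A j \<in> sets borel" using Xm Am j J by auto
        show "(\<lambda>\<omega>. indicator (A j) (X j \<omega>) :: complex) \<in> borel_measurable M" by measurable
      next
        fix i assume i: "i \<in> ?K"
        have [measurable]: "X i \<in> borel_measurable M" using Xm i by auto
        show "(\<lambda>\<omega>. iexp (h i \<bullet> X i \<omega>)) \<in> borel_measurable M" by measurable
      qed
      have g1: "norm (g \<omega>) \<le> 1" for \<omega>
      proof -
        have "norm (\<Prod>j\<in>J. indicator (A j) (X j \<omega>) :: complex) \<le> 1"
          unfolding prod_norm[symmetric] by (intro prod_le_1) (auto simp: indicator_def)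
        moreover have "norm (\<Prod>i\<in>?K. iexp (h i \<bullet> X i \<omega>)) = 1"
          unfolding prod_norm[symmetric] by simp
        ultimately show ?thesis by (simp add: g_def norm_mult)
      qed
      have c1: "norm c \<le> 1"
      proof -
        have "norm (\<Prod>j\<in>J. complex_of_real (prob (X j -` A j \<inter> space M))) \<le> 1"
          unfolding prod_norm[symmetric] by (intro prod_le_1) auto
        moreover have "norm (\<Prod>i\<in>?K. LINT \<omega>|M. iexp (h i \<bullet> X i \<omega>)) \<le> 1"
          unfolding prod_norm[symmetric] by (intro prod_le_1) (auto intro: char1)
        ultimately show ?thesis unfolding c_def norm_mult by (intro mult_le_one) auto
      qed
      have IJ: "I - J = insert k ?K" "k \<notin> ?K" "finite ?K" using k J I by auto
      have "(LINT \<omega>|M. indicator (A k) (X k \<omega>) * g \<omega>) = (LINT \<omega>|M. indicator (A k) (X k \<omega>) * c)"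
      proof (rule weighted_char_unique[OF finite_measure_char_unique fm fm])
        fix h0 :: 'h
        have upd: "(\<Prod>i\<in>I - J. F i ((h(k := h0)) i)) = F k h0 * (\<Prod>i\<in>?K. F i (h i))" for F :: "'i \<Rightarrow> 'h \<Rightarrow> complex"
        proof -
          have "(\<Prod>i\<in>?K. F i ((h(k := h0)) i)) = (\<Prod>i\<in>?K. F i (h i))"
            using IJ(2) by (intro prod.cong) auto
          thus ?thesis unfolding IJ(1) prod.insert[OF IJ(3,2)] by simp
        qed
        have "(LINT \<omega>|M. iexp (h0 \<bullet> X k \<omega>) * g \<omega>) =
            (LINT \<omega>|M. (\<Prod>j\<in>J. indicator (A j) (X j \<omega>)) * (\<Prod>i\<in>I - J. iexp ((h(k := h0)) i \<bullet> X i \<omega>)))"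
          unfolding g_def upd[of "\<lambda>i v. iexp (v \<bullet> X i \<omega>)" for \<omega>] by (simp only: mult.left_commute)
        also have "\<dots> = (\<Prod>j\<in>J. complex_of_real (prob (X j -` A j \<inter> space M))) * (\<Prod>i\<in>I - J. LINT \<omega>|M. iexp ((h(k := h0)) i \<bullet> X i \<omega>))"
          by (rule insert.IH[OF J(1) Am])
        also have "\<dots> = (LINT \<omega>|M. iexp (h0 \<bullet> X k \<omega>)) * c"
          unfolding c_def upd[of "\<lambda>i v. LINT \<omega>|M. iexp (v \<bullet> X i \<omega>)"] by (simp only: mult.left_commute)
        finally have "(LINT \<omega>|M. iexp (h0 \<bullet> X k \<omega>) * g \<omega>) = (LINT \<omega>|M. iexp (h0 \<bullet> X k \<omega>)) * c" .
        thus "(LINT \<omega>|M. iexp (h0 \<bullet> X k \<omega>) * g \<omega>) = (LINT \<omega>|M. iexp (h0 \<bullet> X k \<omega>) * c)"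
          by simp
      qed (use gm g1 c1 in auto)
      also have "\<dots> = (LINT \<omega>|M. indicator (A k) (X k \<omega>)) * c" by simp
      also have "(LINT \<omega>|M. indicator (A k) (X k \<omega>)) = (LINT \<omega>|M. indicator (X k -` A k \<inter> space M) \<omega> :: complex)"
        by (intro Bochner_Integration.integral_cong) (auto simp: indicator_def)
      also have "\<dots> = complex_of_real (prob (X k -` A k \<inter> space M))"
        by (intro ind measurable_sets[of "X k" M borel]) auto
      finally show ?case
        unfolding g_def c_def prod.insert[OF insert.hyps(1,2)] by (simp only: mult.assoc)
    qed
  qed
  show ?thesis unfolding indep_vars_def2 indep_sets_def
  proof (intro conjI ballI allI impI)
    fix J and B assume J: "J \<subseteq> I" "J \<noteq> {}" "finite J" and B: "B \<in> (\<Pi> i\<in>J. {X i -` A \<inter> space M |A. A \<in> sets borel})"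
    hence "\<forall>j\<in>J. \<exists>A. A \<in> sets borel \<and> B j = X j -` A \<inter> space M" by blast
    then obtain A where A: "\<And>j. j \<in> J \<Longrightarrow> A j \<in> sets borel" "\<And>j. j \<in> J \<Longrightarrow> B j = X j -` A j \<inter> space M"
      by metis
    have Bs: "(\<Inter>j\<in>J. B j) \<in> sets M"
    proof (rule sets.finite_INT[OF J(3,2)])
      fix j assume j: "j \<in> J"
      show "B j \<in> sets M" unfolding A(2)[OF j] by (rule measurable_sets[OF X A(1)]) (use j J in auto)
    qed
    have "complex_of_real (prob (\<Inter>j\<in>J. B j)) = (LINT \<omega>|M. indicator (\<Inter>j\<in>J. B j) \<omega>)"
      using ind[OF Bs] by simp
    also have "\<dots> = (LINT \<omega>|M. (\<Prod>j\<in>J. indicator (A j) (X j \<omega>)))"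
    proof (intro Bochner_Integration.integral_cong refl)
      fix \<omega> assume "\<omega> \<in> space M"
      hence "indicator (\<Inter>j\<in>J. B j) \<omega> = (\<Prod>j\<in>J. indicator (B j) \<omega> :: complex)"
        using J by (auto simp: indicator_def prod_zero_iff)
      also have "\<dots> = (\<Prod>j\<in>J. indicator (A j) (X j \<omega>))"
        using A(2) \<open>\<omega> \<in> space M\<close> by (intro prod.cong) (auto simp: indicator_def)
      finally show "indicator (\<Inter>j\<in>J. B j) \<omega> = (\<Prod>j\<in>J. indicator (A j) (X j \<omega>) :: complex)" .
    qed
    also have "\<dots> = complex_of_real (\<Prod>j\<in>J. prob (B j))"
    proof -
      \<comment> \<open>With direction 0 outside \<open>J\<close> the remaining exponentials and
        their expectations are all 1.\<close>
      have "(LINT \<omega>|M. (\<Prod>j\<in>J. indicator (A j) (X j \<omega>)) * (\<Prod>i\<in>I - J. iexp (0 \<bullet> X i \<omega>))) =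
          (\<Prod>j\<in>J. complex_of_real (prob (X j -` A j \<inter> space M))) * (\<Prod>i\<in>I - J. LINT \<omega>|M. iexp (0 \<bullet> X i \<omega>))"
        by (rule mixed) (use J A in auto)
      thus ?thesis using A(2) by (simp add: prob_space)
    qed
    finally show "prob (\<Inter>j\<in>J. B j) = (\<Prod>j\<in>J. prob (B j))" by (simp only: of_real_eq_iff)
  next
    fix i assume "i \<in> I"
    show "X i \<in> borel_measurable M" by (rule X) fact
    show "{X i -` A \<inter> space M |A. A \<in> sets borel} \<subseteq> events"
      using measurable_sets[OF X[OF \<open>i \<in> I\<close>]] by blast
  qed
qed

subsection \<open>Moments of Gaussian variables\<close>

text \<open>The functional identifies \<open>X\<close> in law with \<open>sqrt l\<close> times a
  standard normal variable. Scaling, rather than writing a density, includes the degenerate case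
  \<open>l = 0\<close>.\<close>

lemma (in prob_space) centered_gaussian_even_moment:
  fixes X :: "'a \<Rightarrow> real"
  assumes X [measurable]: "X \<in> borel_measurable M" and "0 \<le> l"
    and char: "\<And>u. (LINT \<omega>|M. iexp (u * X \<omega>)) = exp (- complex_of_real (u\<^sup>2 * l) / 2)"
  shows "(\<integral>\<^sup>+\<omega>. ennreal (X \<omega> ^ (2 * p)) \<partial>M) = ennreal (l ^ p * (fact (2 * p) / (2 ^ p * fact p)))"
proof -
  interpret N: real_distribution std_normal_distribution by (rule real_dist_normal_dist)
  have "distr M borel X = distr std_normal_distribution borel (\<lambda>x. sqrt l * x)"
  proof (rule Levy_uniqueness)
    show "char (distr M borel X) = char (distr std_normal_distribution borel (\<lambda>x. sqrt l * x))"
    proof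
      fix u
      have "char (distr M borel X) u = (LINT \<omega>|M. iexp (u * X \<omega>))"
        unfolding char_def by (rule integral_distr) auto
      also have "\<dots> = complex_of_real (exp (- (u\<^sup>2 * l) / 2))"
        unfolding char exp_of_real[symmetric] by simp
      also have "u\<^sup>2 * l = (u * sqrt l)\<^sup>2" using \<open>0 \<le> l\<close> by (simp add: power_mult_distrib)
      also have "complex_of_real (exp (- (u * sqrt l)\<^sup>2 / 2)) = char std_normal_distribution (u * sqrt l)"
        by (simp only: char_std_normal_distribution)
      also have "\<dots> = (LINT x|std_normal_distribution. iexp (u * (sqrt l * x)))"
        unfolding char_def mult.assoc ..
      also have "\<dots> = char (distr std_normal_distribution borel (\<lambda>x. sqrt l * x)) u"
        unfolding char_def by (rule integral_distr[symmetric]) auto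
      finally show "char (distr M borel X) u = char (distr std_normal_distribution borel (\<lambda>x. sqrt l * x)) u" .
    qed
    show "real_distribution (distr M borel X)" by (rule real_distribution_distr[OF X])
    show "real_distribution (distr std_normal_distribution borel (\<lambda>x. sqrt l * x))"
      by (rule N.real_distribution_distr) simp
  qed
  hence "(\<integral>\<^sup>+x. ennreal (x ^ (2 * p)) \<partial>distr M borel X) =
      (\<integral>\<^sup>+x. ennreal (x ^ (2 * p)) \<partial>distr std_normal_distribution borel (\<lambda>x. sqrt l * x))"
    by simp
  hence "(\<integral>\<^sup>+\<omega>. ennreal (X \<omega> ^ (2 * p)) \<partial>M) =
      (\<integral>\<^sup>+x. ennreal ((sqrt l * x) ^ (2 * p)) \<partial>std_normal_distribution)"
    by (simp add: nn_integral_distr)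
  also have "\<dots> = (\<integral>\<^sup>+x. ennreal (l ^ p * x ^ (2 * p)) \<partial>std_normal_distribution)"
    using \<open>0 \<le> l\<close> by (simp add: power_mult_distrib power_mult)
  also have "\<dots> = ennreal (LINT x|std_normal_distribution. l ^ p * x ^ (2 * p))"
    using \<open>0 \<le> l\<close> std_normal_distribution_even_moments(2)[of p]
    by (intro nn_integral_eq_integral integrable_mult_right) (auto simp: zero_le_even_power)
  also have "\<dots> = ennreal (l ^ p * (fact (2 * p) / (2 ^ p * fact p)))"
    by (simp only: integral_mult_right_zero std_normal_distribution_even_moments(1))
  finally show ?thesis .
qed

text \<open>Jensen's inequality for an even, hence convex, power with weights
  \<open>l e / sum l F\<close>, applied to \<open>sum l F / l e * x e\<close>. The rescaling puts
  terms \<open>x e\<close> of size \<open>l e\<close> on a common scale.\<close>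

lemma sum_power_le_weighted:
  fixes x l :: "'b \<Rightarrow> real"
  assumes "finite F" "F \<noteq> {}" "\<And>e. e \<in> F \<Longrightarrow> 0 < l e" "even p"
  shows "(\<Sum>e\<in>F. x e) ^ p \<le> (\<Sum>e\<in>F. (l e / sum l F) * (sum l F / l e) ^ p * x e ^ p)"
proof -
  have S: "0 < sum l F" using assms by (intro sum_pos)
  have "(\<Sum>e\<in>F. (l e / sum l F) *\<^sub>R (sum l F / l e * x e)) ^ p \<le> (\<Sum>e\<in>F. (l e / sum l F) * (sum l F / l e * x e) ^ p)"
  proof (rule convex_on_sum[OF assms(1,2) convex_power_even[OF assms(4)]])
    show "(\<Sum>e\<in>F. l e / sum l F) = 1" unfolding sum_divide_distrib[symmetric] using S by simp
    show "0 \<le> l e / sum l F" if "e \<in> F" for e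
      using assms(3)[OF that] S by simp
  qed simp
  moreover have "(\<Sum>e\<in>F. (l e / sum l F) *\<^sub>R (sum l F / l e * x e)) = (\<Sum>e\<in>F. x e)"
  proof (intro sum.cong refl)
    fix e assume "e \<in> F"
    hence "l e \<noteq> 0" using assms(3)[of e] by simp
    thus "(l e / sum l F) *\<^sub>R (sum l F / l e * x e) = x e" using S by simp
  qed
  ultimately show ?thesis by (simp only: power_mult_distrib mult.assoc)
qed

lemma gaussian_rv_component_char:
  assumes "gaussian_rv M X 0 Q" "bounded_linear Q"
  shows "(LINT \<omega>|M. iexp (u * (e \<bullet> X \<omega>))) = exp (- complex_of_real (u\<^sup>2 * (Q e \<bullet> e)) / 2)"
proof -
  interpret Q: bounded_linear Q by fact
  have "(LINT \<omega>|M. iexp ((u *\<^sub>R e) \<bullet> X \<omega>)) =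
     exp (\<i> * complex_of_real ((u *\<^sub>R e) \<bullet> 0) - complex_of_real (Q (u *\<^sub>R e) \<bullet> (u *\<^sub>R e)) / 2)"
    using assms(1) unfolding gaussian_rv_def by blast
  thus ?thesis by (simp add: Q.scaleR power2_eq_square mult.assoc)
qed

text \<open>With variances as weights, each direction contributes its variance times one common
  constant, so the bound sees the directions only through the partial trace.\<close>

lemma (in prob_space) gaussian_finite_projection_moment:
  fixes X :: "'a \<Rightarrow> 'h::{real_inner, second_countable_topology}"
  assumes X: "gaussian_rv M X 0 Q" and Q: "positive_op Q" and F: "finite F" and p: "even p" "0 < p"
  shows "(\<integral>\<^sup>+\<omega>. ennreal ((\<Sum>e\<in>F. (e \<bullet> X \<omega>)\<^sup>2) ^ p) \<partial>M)
    \<le> ennreal ((\<Sum>e\<in>F. Q e \<bullet> e) ^ p * (fact (2 * p) / (2 ^ p * fact p)))"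
proof -
  have bl: "bounded_linear Q" and l0: "0 \<le> Q e \<bullet> e" for e using Q by (auto simp: positive_op_def)
  have [measurable]: "X \<in> borel_measurable M" using X by (simp add: gaussian_rv_def)
  define m where "m = (fact (2 * p) / (2 ^ p * fact p) :: real)"
  have m0: "0 \<le> m" by (simp add: m_def)
  have moment: "(\<integral>\<^sup>+\<omega>. ennreal ((e \<bullet> X \<omega>) ^ (2 * k)) \<partial>M) = ennreal ((Q e \<bullet> e) ^ k * (fact (2 * k) / (2 ^ k * fact k)))" for e k
    by (rule centered_gaussian_even_moment[OF _ l0 gaussian_rv_component_char[OF X bl]]) simp
  \<comment> \<open>The weights divide by the variance, so directions with
    \<open>Q e \<bullet> e = 0\<close> are split off; their second moment vanishes, hence
    \<open>e \<bullet> X\<close> is 0 almost surely.\<close>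
  define G where "G = {e\<in>F. 0 < Q e \<bullet> e}"
  have G: "finite G" "G \<subseteq> F" using F by (auto simp: G_def)
  have zl: "Q e \<bullet> e = 0" if "e \<in> F - G" for e using that l0[of e] by (auto simp: G_def)
  have zero: "AE \<omega> in M. e \<bullet> X \<omega> = 0" if "e \<in> F - G" for e
  proof -
    have "(\<integral>\<^sup>+\<omega>. ennreal ((e \<bullet> X \<omega>) ^ (2 * 1)) \<partial>M) = 0"
      unfolding moment zl[OF that] by simp
    hence "AE \<omega> in M. ennreal ((e \<bullet> X \<omega>) ^ (2 * 1)) = 0" by (subst (asm) nn_integral_0_iff_AE) auto
    thus ?thesis by eventually_elim (simp add: ennreal_eq_0_iff)
  qed
  have "AE \<omega> in M. \<forall>e\<in>F - G. e \<bullet> X \<omega> = 0" using zero F by (intro AE_finite_allI) auto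
  hence red: "AE \<omega> in M. (\<Sum>e\<in>F. (e \<bullet> X \<omega>)\<^sup>2) = (\<Sum>e\<in>G. (e \<bullet> X \<omega>)\<^sup>2)"
    by eventually_elim (use F G in \<open>auto intro!: sum.mono_neutral_right\<close>)
  define S where "S = (\<Sum>e\<in>G. Q e \<bullet> e)"
  have S: "S = (\<Sum>e\<in>F. Q e \<bullet> e)"
    unfolding S_def using F G zl by (intro sum.mono_neutral_left) auto
  have "(\<integral>\<^sup>+\<omega>. ennreal ((\<Sum>e\<in>F. (e \<bullet> X \<omega>)\<^sup>2) ^ p) \<partial>M) = (\<integral>\<^sup>+\<omega>. ennreal ((\<Sum>e\<in>G. (e \<bullet> X \<omega>)\<^sup>2) ^ p) \<partial>M)"
    by (rule nn_integral_cong_AE, rule eventually_mono[OF red]) simp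
  also have "\<dots> \<le> ennreal (S ^ p * m)"
  proof (cases "G = {}")
    case True
    thus ?thesis using p by (simp add: zero_power)
  next
    case False
    have Sp: "0 < S" unfolding S_def using G False by (intro sum_pos) (auto simp: G_def)
    \<comment> \<open>Jensen's weight with the rescaling absorbed. Multiplied by the moment it
      leaves \<open>(Q e \<bullet> e) * (S ^ p * m / S)\<close>, linear in the variance, and these
      terms sum to \<open>S ^ p * m\<close>.\<close>
    define w where "w e = (Q e \<bullet> e / S) * (S / (Q e \<bullet> e)) ^ p" for e
    have w0: "0 \<le> w e" for e unfolding w_def using Sp l0[of e] by simp
    have "(\<integral>\<^sup>+\<omega>. ennreal ((\<Sum>e\<in>G. (e \<bullet> X \<omega>)\<^sup>2) ^ p) \<partial>M) \<le> (\<integral>\<^sup>+\<omega>. (\<Sum>e\<in>G. ennreal (w e) * ennreal ((e \<bullet> X \<omega>) ^ (2 * p))) \<partial>M)"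
    proof (intro nn_integral_mono)
      fix \<omega>
      have "(\<Sum>e\<in>G. (e \<bullet> X \<omega>)\<^sup>2) ^ p \<le> (\<Sum>e\<in>G. w e * ((e \<bullet> X \<omega>)\<^sup>2) ^ p)"
        unfolding w_def S_def by (rule sum_power_le_weighted) (use G False p in \<open>auto simp: G_def\<close>)
      hence "ennreal ((\<Sum>e\<in>G. (e \<bullet> X \<omega>)\<^sup>2) ^ p) \<le> ennreal (\<Sum>e\<in>G. w e * (e \<bullet> X \<omega>) ^ (2 * p))"
        by (simp add: power_mult ennreal_leI)
      also have "\<dots> = (\<Sum>e\<in>G. ennreal (w e) * ennreal ((e \<bullet> X \<omega>) ^ (2 * p)))"
        using w0 by (subst sum_ennreal[symmetric]) (auto simp: ennreal_mult zero_le_even_power)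
      finally show "ennreal ((\<Sum>e\<in>G. (e \<bullet> X \<omega>)\<^sup>2) ^ p) \<le> (\<Sum>e\<in>G. ennreal (w e) * ennreal ((e \<bullet> X \<omega>) ^ (2 * p)))" .
    qed
    also have "\<dots> = (\<Sum>e\<in>G. ennreal (w e) * (\<integral>\<^sup>+\<omega>. ennreal ((e \<bullet> X \<omega>) ^ (2 * p)) \<partial>M))"
      by (subst nn_integral_sum) (auto simp: nn_integral_cmult)
    also have "\<dots> = (\<Sum>e\<in>G. ennreal ((Q e \<bullet> e) * (S ^ p * m / S)))"
    proof (intro sum.cong refl)
      fix e assume "e \<in> G"
      hence "Q e \<bullet> e \<noteq> 0" by (auto simp: G_def)
      hence "w e * ((Q e \<bullet> e) ^ p * m) = (Q e \<bullet> e) * (S ^ p * m / S)"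
        using Sp by (simp add: w_def power_divide)
      thus "ennreal (w e) * (\<integral>\<^sup>+\<omega>. ennreal ((e \<bullet> X \<omega>) ^ (2 * p)) \<partial>M) = ennreal ((Q e \<bullet> e) * (S ^ p * m / S))"
        unfolding moment m_def[symmetric] using w0 by (simp flip: ennreal_mult')
    qed
    also have "\<dots> = ennreal (\<Sum>e\<in>G. (Q e \<bullet> e) * (S ^ p * m / S))"
      using l0 Sp m0 by (intro sum_ennreal) auto
    also have "(\<Sum>e\<in>G. (Q e \<bullet> e) * (S ^ p * m / S)) = S ^ p * m"
      unfolding sum_distrib_right[symmetric] S_def[symmetric] using Sp by simp
    finally show ?thesis by simp
  qed
  finally show ?thesis by (simp only: S m_def)
qed

text \<open>Fatou's lemma along finite sets exhausting the countable basis: Parseval identifies the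
  limit, and the partial traces are bounded by the full trace.\<close>

lemma (in prob_space) gaussian_norm_moment:
  fixes X :: "'a \<Rightarrow> 'h::{real_inner, second_countable_topology}"
  assumes X: "gaussian_rv M X 0 Q" and Q: "positive_op Q" and p: "even p" "0 < p"
    and B: "orthonormal_basis B" "(\<lambda>e. Q e \<bullet> e) summable_on B"
  shows "(\<integral>\<^sup>+\<omega>. ennreal (norm (X \<omega>) ^ (2 * p)) \<partial>M)
    \<le> ennreal (infsum (\<lambda>e. Q e \<bullet> e) B ^ p * (fact (2 * p) / (2 ^ p * fact p)))" (is "_ \<le> ?K")
proof -
  have [measurable]: "X \<in> borel_measurable M" using X by (simp add: gaussian_rv_def)
  have l0: "0 \<le> Q e \<bullet> e" for e using Q by (auto simp: positive_op_def)
  have cB: "countable B" by (rule countable_orthonormal_basis[OF B(1)])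
  define F where "F k = {e\<in>B. to_nat_on B e < k}" for k
  have F: "incseq F" "finite (F k)" "(\<Union>k. F k) = B" for k
  proof -
    have "finite (to_nat_on B ` F k)" by (rule finite_subset[of _ "{..<k}"]) (auto simp: F_def)
    moreover have "inj_on (to_nat_on B) (F k)"
      by (rule inj_on_subset[OF inj_on_to_nat_on[OF cB]]) (auto simp: F_def)
    ultimately show "finite (F k)" by (rule finite_imageD)
    show "incseq F" by (auto simp: F_def incseq_def)
    have "e \<in> F (Suc (to_nat_on B e))" if "e \<in> B" for e using that by (simp add: F_def)
    thus "(\<Union>k. F k) = B" by (auto simp: F_def)
  qed
  have L: "(\<lambda>k. ennreal ((\<Sum>e\<in>F k. (e \<bullet> X \<omega>)\<^sup>2) ^ p)) \<longlonglongrightarrow> ennreal (((norm (X \<omega>))\<^sup>2) ^ p)" for \<omega>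
    by (intro tendsto_ennrealI tendsto_power orthonormal_basis_Parseval[OF B(1) F])
  have lim: "ennreal (norm (X \<omega>) ^ (2 * p)) = liminf (\<lambda>k. ennreal ((\<Sum>e\<in>F k. (e \<bullet> X \<omega>)\<^sup>2) ^ p))" for \<omega>
    using lim_imp_Liminf[OF sequentially_bot L[of \<omega>]] by (simp add: power_mult)
  have "(\<integral>\<^sup>+\<omega>. ennreal (norm (X \<omega>) ^ (2 * p)) \<partial>M) \<le> liminf (\<lambda>k. \<integral>\<^sup>+\<omega>. ennreal ((\<Sum>e\<in>F k. (e \<bullet> X \<omega>)\<^sup>2) ^ p) \<partial>M)"
    unfolding lim by (rule nn_integral_liminf) simp
  also have "\<dots> \<le> ?K"
  proof (rule Liminf_le)
    have "(\<integral>\<^sup>+\<omega>. ennreal ((\<Sum>e\<in>F k. (e \<bullet> X \<omega>)\<^sup>2) ^ p) \<partial>M) \<le> ?K" for k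
    proof -
      have "(\<integral>\<^sup>+\<omega>. ennreal ((\<Sum>e\<in>F k. (e \<bullet> X \<omega>)\<^sup>2) ^ p) \<partial>M) \<le> ennreal ((\<Sum>e\<in>F k. Q e \<bullet> e) ^ p * (fact (2 * p) / (2 ^ p * fact p)))"
        by (rule gaussian_finite_projection_moment[OF X Q F(2) p])
      also have "\<dots> \<le> ?K"
      proof (intro ennreal_leI mult_right_mono power_mono)
        show "(\<Sum>e\<in>F k. Q e \<bullet> e) \<le> infsum (\<lambda>e. Q e \<bullet> e) B"
          by (rule finite_sum_le_infsum[OF B(2) F(2)]) (auto simp: F_def l0)
      qed (auto simp: l0 intro: sum_nonneg)
      finally show ?thesis .
    qed
    thus "\<forall>\<^sub>F k in sequentially. (\<integral>\<^sup>+\<omega>. ennreal ((\<Sum>e\<in>F k. (e \<bullet> X \<omega>)\<^sup>2) ^ p) \<partial>M) \<le> ?K" by simp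
  qed simp
  finally show ?thesis .
qed

section \<open>Almost sure growth and pathwise limits\<close>

text \<open>The series of \<open>norm (Z n) ^ q / (n + 1) ^ 2\<close> has finite expectation, so
  almost surely it has a finite sum \<open>S\<close>, which bounds every term. Since
  \<open>2 \<le> q * \<epsilon>\<close>, the factor \<open>(n + 1) ^ 2\<close> is at most the
  \<open>q\<close>-th power of \<open>(n + 1) powr \<epsilon>\<close>.\<close>

lemma AE_growth_from_moment:
  fixes Z :: "nat \<Rightarrow> 'w \<Rightarrow> 'h::{real_normed_vector, second_countable_topology}"
  assumes Z [measurable]: "\<And>n. Z n \<in> borel_measurable M"
    and K: "\<And>n. (\<integral>\<^sup>+\<omega>. ennreal (norm (Z n \<omega>) ^ q) \<partial>M) \<le> ennreal K" and q: "2 \<le> real q * \<epsilon>" and "0 \<le> \<epsilon>"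
  shows "AE \<omega> in M. \<exists>C. \<forall>n. norm (Z n \<omega>) \<le> C * real (Suc n) powr \<epsilon>"
proof -
  define c where "c n = inverse (real (Suc n) ^ 2)" for n
  have c0: "0 \<le> c n" for n by (simp add: c_def)
  define K' where "K' = max 0 K"
  have K': "0 \<le> K'" "K \<le> K'" by (auto simp: K'_def)
  have sc: "summable (\<lambda>n. K' * c n)"
    unfolding c_def using inverse_power_summable[of 2, where ?'a = real]
    by (intro summable_mult) (subst summable_Suc_iff, simp)
  have q0: "0 < q" using q by (cases q) auto
  have "(\<integral>\<^sup>+\<omega>. (\<Sum>n. ennreal (c n) * ennreal (norm (Z n \<omega>) ^ q)) \<partial>M) = (\<Sum>n. ennreal (c n) * (\<integral>\<^sup>+\<omega>. ennreal (norm (Z n \<omega>) ^ q) \<partial>M))"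
    by (subst nn_integral_suminf) (auto simp: nn_integral_cmult)
  also have "\<dots> \<le> (\<Sum>n. ennreal (K' * c n))"
  proof (intro suminf_le)
    fix n
    have "ennreal (c n) * (\<integral>\<^sup>+\<omega>. ennreal (norm (Z n \<omega>) ^ q) \<partial>M) \<le> ennreal (c n) * ennreal (K')"
      by (intro mult_left_mono order_trans[OF K] ennreal_leI K') auto
    also have "\<dots> = ennreal (K' * c n)" using c0 K' by (simp add: mult.commute flip: ennreal_mult)
    finally show "ennreal (c n) * (\<integral>\<^sup>+\<omega>. ennreal (norm (Z n \<omega>) ^ q) \<partial>M) \<le> ennreal (K' * c n)" .
  qed auto
  also have "\<dots> = ennreal (\<Sum>n. K' * c n)"
    by (rule suminf_ennreal2[OF _ sc]) (simp add: c0 K')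
  also have "\<dots> < \<infinity>" by simp
  finally have "AE \<omega> in M. (\<Sum>n. ennreal (c n) * ennreal (norm (Z n \<omega>) ^ q)) \<noteq> \<infinity>"
    by (intro nn_integral_PInf_AE) auto
  thus ?thesis
  proof eventually_elim
    case (elim \<omega>)
    then obtain S where S: "0 \<le> S" "(\<Sum>n. ennreal (c n) * ennreal (norm (Z n \<omega>) ^ q)) = ennreal S"
      by (cases "\<Sum>n. ennreal (c n) * ennreal (norm (Z n \<omega>) ^ q)") auto
    \<comment> \<open>\<open>max 1 S\<close> replaces the \<open>q\<close>-th root of
      \<open>S\<close>: a ratio \<open>y\<close> with \<open>y ^ q \<le> S\<close> is at most 1 or
      at most \<open>y ^ q\<close>.\<close>
    have "norm (Z n \<omega>) \<le> max 1 S * real (Suc n) powr \<epsilon>" for n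
    proof -
      let ?y = "norm (Z n \<omega>) / real (Suc n) powr \<epsilon>"
      have "ennreal (c n * norm (Z n \<omega>) ^ q) \<le> ennreal S"
        unfolding S(2)[symmetric] using c0 sum_le_suminf[of "\<lambda>n. ennreal (c n) * ennreal (norm (Z n \<omega>) ^ q)" "{n}"]
        by (simp add: ennreal_mult)
      hence "norm (Z n \<omega>) ^ q \<le> S * real (Suc n) ^ 2"
        using S(1) by (simp add: c_def field_simps)
      also have "real (Suc n) ^ 2 = real (Suc n) powr 2" by (subst powr_realpow[symmetric]) auto
      also have "\<dots> \<le> real (Suc n) powr (real q * \<epsilon>)" using q by (intro powr_mono) auto
      also have "\<dots> = (real (Suc n) powr \<epsilon>) ^ q"
        by (subst powr_realpow[symmetric]) (auto simp: powr_powr mult.commute)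
      finally have "norm (Z n \<omega>) ^ q \<le> S * (real (Suc n) powr \<epsilon>) ^ q" using S(1) by (simp add: mult_left_mono)
      hence yS: "?y ^ q \<le> S" by (simp add: power_divide divide_le_eq)
      have "?y \<le> max 1 S"
      proof (cases "?y \<le> 1")
        case True
        thus ?thesis by (rule order_trans) simp
      next
        case False
        hence "?y ^ 1 \<le> ?y ^ q" using q0 by (intro power_increasing) auto
        thus ?thesis using yS by simp
      qed
      thus ?thesis by (simp add: divide_le_eq)
    qed
    thus ?case by blast
  qed
qed

lemma holder_sums_cong:
  assumes "holder_sums \<alpha> f F" "\<And>t. t \<in> {0..1} \<Longrightarrow> F t = G t"
  shows "holder_sums \<alpha> f G"
proof -
  have "holder_norm \<alpha> F = holder_norm \<alpha> G" by (rule holder_norm_cong[OF assms(2)])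
  moreover have "holder_norm \<alpha> (\<lambda>t. (\<Sum>n<N. f n t) - F t) = holder_norm \<alpha> (\<lambda>t. (\<Sum>n<N. f n t) - G t)" for N
    by (rule holder_norm_cong) (simp add: assms(2))
  ultimately show ?thesis
    using assms(1) assms(2)[of 0] by (simp add: holder_sums_def holder_space_def)
qed

text \<open>The limit obtained from summability is arbitrary outside the unit interval; inside it is
  the pointwise sum, and only those values enter the norm.\<close>

lemma schauder_process_holder_sums:
  assumes "holder_summable \<alpha> (\<lambda>n t. schauder n t *\<^sub>R Z n \<omega>)"
  shows "holder_sums \<alpha> (\<lambda>n t. schauder n t *\<^sub>R Z n \<omega>) (\<lambda>t. schauder_process \<alpha> Z t \<omega>)"
proof -
  obtain F where F: "holder_sums \<alpha> (\<lambda>n t. schauder n t *\<^sub>R Z n \<omega>) F"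
    using assms by (auto simp: holder_summable_def)
  show ?thesis
    by (rule holder_sums_cong[OF F])
      (use holder_sums_imp_sums[OF F] assms in \<open>auto simp: schauder_process_def sums_unique\<close>)
qed

section \<open>Increments along a partition\<close>

lemma partition_mono:
  fixes t :: "nat \<Rightarrow> real"
  assumes "\<And>i. i < n \<Longrightarrow> t i \<le> t (Suc i)" "i \<le> j" "j \<le> n"
  shows "t i \<le> t j"
  using assms(2,3)
  by (induction j rule: dec_induct) (auto simp: Suc_le_eq intro: order_trans[OF _ assms(1)])

text \<open>Increments of Schauder functions are integrals of Haar functions over the partition
  intervals, so this is Parseval's identity for indicators of these intervals, read off from
  \<open>min\<close> by bilinearity.\<close>

lemma schauder_increments_orthogonal:
  fixes t :: "nat \<Rightarrow> real"
  assumes t: "0 \<le> t 0" "\<And>i. i < n \<Longrightarrow> t i \<le> t (Suc i)" "t n \<le> 1" and ij: "i < n" "j < n"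
  shows "(\<lambda>m. (schauder m (t (Suc i)) - schauder m (t i)) * (schauder m (t (Suc j)) - schauder m (t j)))
    sums (if i = j then t (Suc i) - t i else 0)"
proof -
  have mono: "t i \<le> t j" if "i \<le> j" "j \<le> n" for i j
    using partition_mono[of n t i j] t(2) that by simp
  have I: "t k \<in> {0..1}" if "k \<le> n" for k
    using mono[of 0 k] mono[of k n] that t by auto
  have "(\<lambda>m. schauder m (t (Suc i)) * schauder m (t (Suc j)) - schauder m (t (Suc i)) * schauder m (t j)
      - (schauder m (t i) * schauder m (t (Suc j)) - schauder m (t i) * schauder m (t j)))
    sums (min (t (Suc i)) (t (Suc j)) - min (t (Suc i)) (t j) - (min (t i) (t (Suc j)) - min (t i) (t j)))"
    using ij by (intro sums_diff schauder_kernel_sums I) auto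
  also have "min (t (Suc i)) (t (Suc j)) - min (t (Suc i)) (t j) - (min (t i) (t (Suc j)) - min (t i) (t j))
      = (if i = j then t (Suc i) - t i else 0)"
  proof (cases i j rule: linorder_cases)
    case less
    hence "t i \<le> t (Suc i)" "t (Suc i) \<le> t j" "t j \<le> t (Suc j)" using ij by (auto intro!: mono)
    thus ?thesis using less by (simp add: min_def)
  next
    case greater
    hence "t j \<le> t (Suc j)" "t (Suc j) \<le> t i" "t i \<le> t (Suc i)" using ij by (auto intro!: mono)
    thus ?thesis using greater by (simp add: min_def)
  next
    case equal
    have "t i \<le> t (Suc i)" using ij by (auto intro!: mono)
    thus ?thesis using equal by (simp add: min_def)
  qed
  finally show ?thesis by (simp add: algebra_simps)
qed

subsection \<open>The Wiener process\<close>

lemma even_exponent_exists: "0 < \<epsilon> \<Longrightarrow> \<exists>p. even p \<and> 0 < p \<and> 2 \<le> real (2 * p) * (\<epsilon>::real)"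
proof -
  assume "0 < \<epsilon>"
  obtain k :: nat where k: "1 / \<epsilon> \<le> real k" using real_arch_simple by blast
  have "1 \<le> real (Suc k) * \<epsilon>" using k \<open>0 < \<epsilon>\<close> by (simp add: field_simps)
  thus ?thesis using \<open>0 < \<epsilon>\<close> by (intro exI[of _ "2 * Suc k"]) (auto simp: algebra_simps)
qed

lemma (in prob_space) AE_holder_summable_schauder:
  fixes Q :: "'h::{real_inner, polish_space} \<Rightarrow> 'h"
  assumes \<alpha>: "0 < \<alpha>" "\<alpha> < 1 / 2" and Q: "positive_op Q" "self_adjoint_op Q" "trace_class_op Q"
    and Z: "\<And>n. gaussian_rv M (Z n) 0 Q"
  shows "AE \<omega> in M. holder_summable \<alpha> (\<lambda>n t. schauder n t *\<^sub>R Z n \<omega>)"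
proof -
  obtain B where B: "orthonormal_basis B" "(\<lambda>e. Q e \<bullet> e) summable_on B"
    using positive_trace_class_summable[OF Q] by blast
  \<comment> \<open>Half of the room between \<alpha> and 1/2 is given to the growth of the
    coefficients.\<close>
  define \<epsilon> where "\<epsilon> = (1 / 2 - \<alpha>) / 2"
  have \<epsilon>: "0 < \<epsilon>" "\<alpha> + \<epsilon> < 1 / 2" using \<alpha> by (auto simp: \<epsilon>_def field_simps)
  obtain p where p: "even p" "0 < p" "2 \<le> real (2 * p) * \<epsilon>" using even_exponent_exists[OF \<epsilon>(1)] by blast
  have "AE \<omega> in M. \<exists>C. \<forall>n. norm (Z n \<omega>) \<le> C * real (Suc n) powr \<epsilon>"
  proof (rule AE_growth_from_moment)
    show "(\<integral>\<^sup>+\<omega>. ennreal (norm (Z n \<omega>) ^ (2 * p)) \<partial>M)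
      \<le> ennreal (infsum (\<lambda>e. Q e \<bullet> e) B ^ p * (fact (2 * p) / (2 ^ p * fact p)))" for n
      by (rule gaussian_norm_moment[OF Z Q(1) p(1,2) B])
  qed (use Z p \<epsilon> in \<open>auto simp: gaussian_rv_def\<close>)
  thus ?thesis
  proof eventually_elim
    case (elim \<omega>)
    then obtain C where "\<And>n. norm (Z n \<omega>) \<le> C * real (Suc n) powr \<epsilon>" by blast
    thus ?case using \<alpha> \<epsilon> by (intro schauder_series_holder_summable[of \<alpha> \<epsilon>]) auto
  qed
qed

text \<open>Cutting the partial sums off outside the event used in the definition makes them
  converge at every point of the space, so the limit is measurable without completing
  \<open>M\<close>.\<close>

lemma schauder_process_measurable:
  fixes Z :: "nat \<Rightarrow> 'w \<Rightarrow> 'h::{real_normed_vector, polish_space}"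
  assumes Z [measurable]: "\<And>n. Z n \<in> borel_measurable M" and \<alpha>: "0 < \<alpha>" "\<alpha> \<le> 1" and t: "t \<in> {0..1}"
  shows "schauder_process \<alpha> Z t \<in> borel_measurable M"
proof -
  define G where "G = {\<omega> \<in> space M. holder_summable \<alpha> (\<lambda>n t. schauder n t *\<^sub>R Z n \<omega>)}"
  have [measurable]: "G \<in> sets M" unfolding G_def by (rule measurable_holder_summable_schauder[OF Z \<alpha>])
  show ?thesis
  proof (rule borel_measurable_LIMSEQ_metric)
    show "(\<lambda>\<omega>. if \<omega> \<in> G then \<Sum>n<N. schauder n t *\<^sub>R Z n \<omega> else 0) \<in> borel_measurable M" for N
      by measurable
    fix \<omega> assume "\<omega> \<in> space M"
    show "(\<lambda>N. if \<omega> \<in> G then \<Sum>n<N. schauder n t *\<^sub>R Z n \<omega> else 0) \<longlonglongrightarrow> schauder_process \<alpha> Z t \<omega>"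
    proof (cases "\<omega> \<in> G")
      case True
      hence "holder_summable \<alpha> (\<lambda>n t. schauder n t *\<^sub>R Z n \<omega>)" by (simp add: G_def)
      from holder_sums_imp_sums[OF schauder_process_holder_sums[where Z = Z, OF this] t] True
      show ?thesis by (simp add: sums_def)
    next
      case False
      thus ?thesis using \<open>\<omega> \<in> space M\<close> by (simp add: G_def schauder_process_def)
    qed
  qed
qed

text \<open>Regrouping by \<open>m\<close> writes the exponent as a series of independent terms
  \<open>v m \<bullet> Z m\<close>, so the partial products have an explicit expectation. All
  integrands have modulus 1, so dominated convergence applies, and the orthogonality of increments
  removes the mixed terms from the limit.\<close>

lemma (in prob_space) schauder_process_joint_char:
  fixes Q :: "'h::{real_inner, polish_space} \<Rightarrow> 'h"
  assumes Q: "bounded_linear Q" and \<alpha>: "0 < \<alpha>" "\<alpha> \<le> 1"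
    and indep: "indep_vars (\<lambda>_. borel) Z UNIV" and Z: "\<And>n. gaussian_rv M (Z n) 0 Q"
    and summable: "AE \<omega> in M. holder_summable \<alpha> (\<lambda>n t. schauder n t *\<^sub>R Z n \<omega>)"
    and t: "0 \<le> t 0" "\<And>i. i < n \<Longrightarrow> t i \<le> t (Suc i)" "t n \<le> 1"
  shows "(LINT \<omega>|M. (\<Prod>i<n. iexp (h i \<bullet> (schauder_process \<alpha> Z (t (Suc i)) \<omega> - schauder_process \<alpha> Z (t i) \<omega>)))) =
    exp (- complex_of_real (\<Sum>i<n. (t (Suc i) - t i) * (Q (h i) \<bullet> h i)) / 2)"
proof -
  interpret Q: bounded_linear Q by fact
  let ?W = "schauder_process \<alpha> Z"
  have Zm [measurable]: "Z k \<in> borel_measurable M" for k using Z by (simp add: gaussian_rv_def)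
  have mono: "t i \<le> t j" if "i \<le> j" "j \<le> n" for i j
    using partition_mono[of n t i j] t(2) that by simp
  have I: "t k \<in> {0..1}" if "k \<le> n" for k
    using mono[of 0 k] mono[of k n] that t by auto
  have Wm: "?W (t k) \<in> borel_measurable M" if "k \<le> n" for k
    by (rule schauder_process_measurable[OF Zm \<alpha> I[OF that]])
  define c where "c m i = schauder m (t (Suc i)) - schauder m (t i)" for m i
  define v where "v m = (\<Sum>i<n. c m i *\<^sub>R h i)" for m
  define Y where "Y N \<omega> = (\<Prod>m<N. iexp (v m \<bullet> Z m \<omega>))" for N \<omega>
  define L where "L \<omega> = (\<Prod>i<n. iexp (h i \<bullet> (?W (t (Suc i)) \<omega> - ?W (t i) \<omega>)))" for \<omega>
  have Lm: "L \<in> borel_measurable M"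
    unfolding L_def
  proof (intro borel_measurable_prod)
    fix i assume "i \<in> {..<n}"
    hence [measurable]: "?W (t i) \<in> borel_measurable M" "?W (t (Suc i)) \<in> borel_measurable M"
      by (auto intro: Wm)
    show "(\<lambda>\<omega>. iexp (h i \<bullet> (?W (t (Suc i)) \<omega> - ?W (t i) \<omega>))) \<in> borel_measurable M" by measurable
  qed
  have Ym: "Y N \<in> borel_measurable M" for N unfolding Y_def by measurable
  have Y1: "norm (Y N \<omega>) \<le> 1" for N \<omega>
    unfolding Y_def prod_norm[symmetric] by simp
  have "AE \<omega> in M. (\<lambda>N. Y N \<omega>) \<longlonglongrightarrow> L \<omega>"
    using summable
  proof eventually_elim
    case (elim \<omega>)
    note S = holder_sums_imp_sums[OF schauder_process_holder_sums[where Z = Z, OF elim] I]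
    have "(\<lambda>m. \<Sum>i<n. h i \<bullet> (schauder m (t (Suc i)) *\<^sub>R Z m \<omega> - schauder m (t i) *\<^sub>R Z m \<omega>)) sums
       (\<Sum>i<n. h i \<bullet> (?W (t (Suc i)) \<omega> - ?W (t i) \<omega>))"
      by (intro sums_sum bounded_linear.sums[OF bounded_linear_inner_right] sums_diff S) auto
    also have "(\<lambda>m. \<Sum>i<n. h i \<bullet> (schauder m (t (Suc i)) *\<^sub>R Z m \<omega> - schauder m (t i) *\<^sub>R Z m \<omega>)) = (\<lambda>m. v m \<bullet> Z m \<omega>)"
      by (simp add: v_def c_def inner_sum_left flip: scaleR_left_diff_distrib)
    finally have "(\<lambda>N. iexp (\<Sum>m<N. v m \<bullet> Z m \<omega>)) \<longlonglongrightarrow> iexp (\<Sum>i<n. h i \<bullet> (?W (t (Suc i)) \<omega> - ?W (t i) \<omega>))"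
      unfolding sums_def by (intro tendsto_intros)
    thus "(\<lambda>N. Y N \<omega>) \<longlonglongrightarrow> L \<omega>"
      by (simp add: Y_def L_def exp_sum sum_distrib_left)
  qed
  hence conv: "(\<lambda>N. LINT \<omega>|M. Y N \<omega>) \<longlonglongrightarrow> (LINT \<omega>|M. L \<omega>)"
    by (intro integral_dominated_convergence[where w = "\<lambda>_. 1"]) (auto simp: Lm Ym Y1)
  have EY: "(LINT \<omega>|M. Y N \<omega>) = exp (- complex_of_real (\<Sum>m<N. Q (v m) \<bullet> v m) / 2)" for N
  proof -
    have "indep_vars (\<lambda>_. borel) (\<lambda>m \<omega>. iexp (v m \<bullet> Z m \<omega>)) {..<N}"
      by (rule indep_vars_compose2[where M' = "\<lambda>_. borel"])
        (auto intro: indep_vars_subset[OF indep])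
    hence "(LINT \<omega>|M. Y N \<omega>) = (\<Prod>m<N. LINT \<omega>|M. iexp (v m \<bullet> Z m \<omega>))"
      unfolding Y_def by (intro indep_vars_lebesgue_integral iexp_integrable) (auto intro: finite_measure_axioms)
    also have "\<dots> = (\<Prod>m<N. exp (- complex_of_real (Q (v m) \<bullet> v m) / 2))"
      using Z by (simp add: gaussian_rv_def)
    also have "\<dots> = exp (- complex_of_real (\<Sum>m<N. Q (v m) \<bullet> v m) / 2)"
      by (simp add: exp_sum[symmetric] sum_negf sum_divide_distrib[symmetric])
    finally show ?thesis .
  qed
  \<comment> \<open>The bilinear expansion of \<open>Q (v m) \<bullet> v m\<close>, summed over
    \<open>m\<close> separately for each pair \<open>(i, j)\<close>.\<close>
  have "(\<lambda>m. \<Sum>i<n. \<Sum>j<n. c m i * c m j * (Q (h i) \<bullet> h j)) sums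
      (\<Sum>i<n. \<Sum>j<n. (if i = j then t (Suc i) - t i else 0) * (Q (h i) \<bullet> h j))"
    unfolding c_def by (intro sums_sum sums_mult2 schauder_increments_orthogonal[of t n] t) auto
  also have "(\<Sum>i<n. \<Sum>j<n. (if i = j then t (Suc i) - t i else 0) * (Q (h i) \<bullet> h j)) =
      (\<Sum>i<n. (t (Suc i) - t i) * (Q (h i) \<bullet> h i))"
  proof (rule sum.cong[OF refl])
    fix i assume "i \<in> {..<n}"
    have "(\<Sum>j<n. (if i = j then t (Suc i) - t i else 0) * (Q (h i) \<bullet> h j)) =
        (\<Sum>j<n. if i = j then (t (Suc i) - t i) * (Q (h i) \<bullet> h j) else 0)"
      by (intro sum.cong) auto
    thus "(\<Sum>j<n. (if i = j then t (Suc i) - t i else 0) * (Q (h i) \<bullet> h j)) = (t (Suc i) - t i) * (Q (h i) \<bullet> h i)"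
      using \<open>i \<in> {..<n}\<close> by simp
  qed
  also have "(\<lambda>m. \<Sum>i<n. \<Sum>j<n. c m i * c m j * (Q (h i) \<bullet> h j)) = (\<lambda>m. Q (v m) \<bullet> v m)"
  proof
    fix m
    have "Q (v m) = (\<Sum>i<n. c m i *\<^sub>R Q (h i))" by (simp only: v_def Q.sum Q.scaleR)
    hence "Q (v m) \<bullet> v m = (\<Sum>i<n. c m i * (Q (h i) \<bullet> v m))" by (simp only: inner_sum_left inner_scaleR_left)
    also have "\<dots> = (\<Sum>i<n. \<Sum>j<n. c m i * c m j * (Q (h i) \<bullet> h j))"
      by (simp only: v_def inner_sum_right inner_scaleR_right sum_distrib_left mult.assoc)
    finally show "(\<Sum>i<n. \<Sum>j<n. c m i * c m j * (Q (h i) \<bullet> h j)) = Q (v m) \<bullet> v m" ..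
  qed
  finally have "(\<lambda>N. exp (- complex_of_real (\<Sum>m<N. Q (v m) \<bullet> v m) / 2)) \<longlonglongrightarrow>
      exp (- complex_of_real (\<Sum>i<n. (t (Suc i) - t i) * (Q (h i) \<bullet> h i)) / 2)"
    unfolding sums_def by (intro tendsto_intros) auto
  with conv have "(LINT \<omega>|M. L \<omega>) = exp (- complex_of_real (\<Sum>i<n. (t (Suc i) - t i) * (Q (h i) \<bullet> h i)) / 2)"
    unfolding EY by (rule LIMSEQ_unique)
  thus ?thesis by (simp only: L_def)
qed

theorem proposition1:
  fixes M :: "'w measure"
    and Q :: "'a::{real_inner, polish_space} \<Rightarrow> 'a"
    and Z :: "nat \<Rightarrow> 'w \<Rightarrow> 'a"
    and \<alpha> :: real
  assumes "prob_space M"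
    and "0 < \<alpha>" and "\<alpha> < 1 / 2"
    and "positive_op Q" and "self_adjoint_op Q" and "trace_class_op Q"
    and "prob_space.indep_vars M (\<lambda>_. borel) Z UNIV"
    and "\<And>n. gaussian_rv M (Z n) 0 Q"
  shows "(AE \<omega> in M. holder_sums \<alpha> (\<lambda>n t. schauder n t *\<^sub>R Z n \<omega>)
                        (\<lambda>t. schauder_process \<alpha> Z t \<omega>)) \<and>
         wiener_process M Q (schauder_process \<alpha> Z)"
proof -
  interpret prob_space M by fact
  let ?W = "schauder_process \<alpha> Z"
  have \<alpha>: "0 < \<alpha>" "\<alpha> \<le> 1" using assms(2,3) by auto
  have Q: "bounded_linear Q" using assms(4) by (simp add: positive_op_def)
  have Zm: "Z n \<in> borel_measurable M" for n using assms(8) by (simp add: gaussian_rv_def)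
  have Wm: "?W t \<in> borel_measurable M" if "t \<in> {0..1}" for t
    by (rule schauder_process_measurable[OF Zm \<alpha> that])
  have AE: "AE \<omega> in M. holder_summable \<alpha> (\<lambda>n t. schauder n t *\<^sub>R Z n \<omega>)"
    by (rule AE_holder_summable_schauder[OF assms(2-6,8)])
  \<comment> \<open>Holds at every \<omega>, so that all trajectories are continuous and not only
    almost all: off the convergence event the path is 0.\<close>
  have summable_or_0: "holder_sums \<alpha> (\<lambda>n t. schauder n t *\<^sub>R Z n \<omega>) (\<lambda>t. ?W t \<omega>) \<or> (\<forall>t. ?W t \<omega> = 0)" for \<omega>
    using schauder_process_holder_sums[of \<alpha> Z \<omega>] by (auto simp: schauder_process_def)
  have joint: "(LINT \<omega>|M. (\<Prod>i<n. iexp (h i \<bullet> (?W (t (Suc i)) \<omega> - ?W (t i) \<omega>)))) =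
      exp (- complex_of_real (\<Sum>i<n. (t (Suc i) - t i) * (Q (h i) \<bullet> h i)) / 2)"
    if "0 \<le> t 0" "\<forall>i<n. t i \<le> t (Suc i)" "t n \<le> 1" for h t and n :: nat
    by (rule schauder_process_joint_char[OF Q \<alpha> assms(7,8) AE]) (use that in auto)
  \<comment> \<open>The joint functional for the partition consisting of one interval.\<close>
  have single: "(LINT \<omega>|M. iexp (h \<bullet> (?W t \<omega> - ?W s \<omega>))) = exp (- complex_of_real ((t - s) * (Q h \<bullet> h)) / 2)"
    if "0 \<le> s" "s \<le> t" "t \<le> 1" for h s t
    using joint[of "\<lambda>i. if i = 0 then s else t" 1 "\<lambda>_. h"] that by simp
  have "indep_vars (\<lambda>_. borel) (\<lambda>i \<omega>. ?W (t (Suc i)) \<omega> - ?W (t i) \<omega>) {..<n}"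
    if t: "0 \<le> t 0" "\<forall>i<n. t i \<le> t (Suc i)" "t n \<le> 1" for n :: nat and t
  proof (rule indep_vars_if_char_factorizes)
    have mono: "t i \<le> t j" if "i \<le> j" "j \<le> n" for i j
      using partition_mono[of n t i j] t(2) that by simp
    have I: "t k \<in> {0..1}" if "k \<le> n" for k
      using mono[of 0 k] mono[of k n] that t by auto
    show "(\<lambda>\<omega>. ?W (t (Suc i)) \<omega> - ?W (t i) \<omega>) \<in> borel_measurable M" if "i \<in> {..<n}" for i
      using that by (intro borel_measurable_diff Wm I) auto
    fix h
    have "(\<Prod>i<n. LINT \<omega>|M. iexp (h i \<bullet> (?W (t (Suc i)) \<omega> - ?W (t i) \<omega>))) =
        (\<Prod>i<n. exp (- complex_of_real ((t (Suc i) - t i) * (Q (h i) \<bullet> h i)) / 2))"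
      using I t(2) by (intro prod.cong single) (auto simp: Suc_le_eq)
    also have "\<dots> = exp (- complex_of_real (\<Sum>i<n. (t (Suc i) - t i) * (Q (h i) \<bullet> h i)) / 2)"
      by (simp add: exp_sum[symmetric] sum_negf sum_divide_distrib[symmetric] del: of_real_mult)
    finally show "(LINT \<omega>|M. (\<Prod>i<n. iexp (h i \<bullet> (?W (t (Suc i)) \<omega> - ?W (t i) \<omega>)))) =
        (\<Prod>i<n. LINT \<omega>|M. iexp (h i \<bullet> (?W (t (Suc i)) \<omega> - ?W (t i) \<omega>)))"
      using joint[OF t] by simp
  qed simp
  moreover have "gaussian_rv M (\<lambda>\<omega>. ?W t \<omega> - ?W s \<omega>) 0 (\<lambda>h. (t - s) *\<^sub>R Q h)"
    if "0 \<le> s" "s \<le> t" "t \<le> 1" for s t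
    using single[OF that] that Wm unfolding gaussian_rv_def by (auto intro!: borel_measurable_diff)
  moreover have "?W 0 \<omega> = 0" for \<omega> by (simp add: schauder_process_def)
  moreover have "continuous_on {0..1} (\<lambda>t. ?W t \<omega>)" for \<omega>
    using summable_or_0[of \<omega>] \<alpha>(1) by (auto simp: holder_sums_def intro: holder_space_continuous_on)
  ultimately have "wiener_process M Q ?W" using Wm unfolding wiener_process_def by blast
  moreover have "AE \<omega> in M. holder_sums \<alpha> (\<lambda>n t. schauder n t *\<^sub>R Z n \<omega>) (\<lambda>t. ?W t \<omega>)"
    using AE by eventually_elim (rule schauder_process_holder_sums)
  ultimately show ?thesis by blast
qed

end
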